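(* Consider the torus (periodic) discretization for a block $G=(V,E,K,s,t)$ with $\mathrm{tw}(G)\ge 2$. Set $N=|\Lambda_n|=n^d$ and $\mathrm{tw}=\mathrm{tw}(\tilde G)$, where $\tilde G=G+(s,t)$ (the graph $G$ with an additional edge between $s$ and $t$) for $s\neq t$ and $\tilde G=G$ otherwise. Set the pin $p=s$ and choose an elimination ordering $\pi$ of $V\setminus\{p\}$ satisfying $|S_j|\le\mathrm{tw}$ for every $j$ and eliminating $t$ last when $s\neq t$. Then $\mathcal Z_G^{(n)}(\boldsymbol k)$ can be computed, either for a single momentum or on the full momentum grid $\mathrm{BZ}_n$, using $\mathcal O(N^{\mathrm{tw}})$ operations and $\mathcal O(N^{\mathrm{tw}-1})$ memory. If every elimination step $j$ at maximum width ($|S_j|=w(\pi)$) is convolutional, then the arithmetic cost reduces to $\mathcal O(N^{\mathrm{tw}-1}\log N)$. (Here $G$ is fixed and the asymptotics are in $N$.)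
   Context: Lattice: $\Lambda=A\mathbb Z^d$ with $A\in\mathbb R^{d\times d}$ invertible, reciprocal lattice $\Lambda^*=A^{-T}\mathbb Z^d$, $\mathrm{BZ}=A^{-T}[0,1)^d$, momentum grid $\mathrm{BZ}_n=(\Lambda^*/n)/\Lambda^*$, balanced cell $\Lambda_n=A\{-\lceil n/2\rceil+1,\dots,\lfloor n/2\rfloor\}^d$, containing each residue class modulo $n\Lambda$ exactly once. $G=(V,E,K,s,t)$ is a finite connected multigraph with oriented edges $e=(e^-,e^+)$, $e^-\neq e^+$, kernels $K_e\in\ell^1(\Lambda)$ and terminals $s,t\in V$. It is a block if it is connected and has no cutvertex. Treewidth $\mathrm{tw}$ is that of the underlying simple graph. Periodic (torus) discretization: for $u,v\in V$, $\delta\boldsymbol x^{(n)}_{(u,v)}\in\Lambda_n$ is the representative in $\Lambda_n$ of $\boldsymbol x_v-\boldsymbol x_u$ modulo $n\Lambda$, $\delta\boldsymbol x_e^{(n)}=\delta\boldsymbol x^{(n)}_{(e^-,e^+)}$, and $$\mathcal Z_G^{(n)}(\boldsymbol k)=\sum_{\{\boldsymbol x_v\in\Lambda_n\}_{v\ne p}}e^{-2\pi i\,\delta\boldsymbol x^{(n)}_{(s,t)}\cdot\boldsymbol k}\prod_{e\in E}K_e(\delta\boldsymbol x_e^{(n)}),\qquad\boldsymbol x_p=\boldsymbol 0.$$ Factors: for $U\subseteq V$, a factor with scope $U$ is a function $\phi:\{\boldsymbol x_U:U\to\Lambda_n\}\to\mathbb C$. A two-point factor with scope $\{u,v\}$ is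 translation invariant if it depends only on $\delta\boldsymbol x^{(n)}_{(u,v)}$. The initial factor family $\mathcal P_1$ consists of the edge factors $\phi_e=K_e(\delta\boldsymbol x_e^{(n)})$ with scope $\{e^-,e^+\}$, $e\in E$, and the momentum factor $\phi_{\boldsymbol k}=e^{-2\pi i\delta\boldsymbol x^{(n)}_{(s,t)}\cdot\boldsymbol k}$ with scope $\{s,t\}$. Bucket elimination: an elimination ordering is a permutation $\pi=(v_1,\dots,v_m)$ of $V\setminus\{p\}$, $m=|V|-1$. For $j=1,\dots,m$, the bucket is $\Phi_j=\{\phi\in\mathcal P_j:v_j\in\mathrm{scope}(\phi)\}$, its remaining scope is $S_j=\big(\bigcup_{\phi\in\Phi_j}\mathrm{scope}(\phi)\big)\setminus\{v_j\}$; eliminating $v_j$ produces $\tau_j(\boldsymbol x_{S_j})=\sum_{\boldsymbol x_{v_j}\in\Lambda_n}\prod_{\phi\in\Phi_j}\phi(\boldsymbol x_{\mathrm{scope}(\phi)})$ with scope $S_j$, and $\mathcal P_{j+1}=(\mathcal P_j\setminus\Phi_j)\cup\{\tau_j\}$. The width is $w(\pi)=\max_{1\le j\le m}|S_j|$. Step $j$ is convolutional if there exists $u\in S_j$ such that every factor in $\Phi_j$ whose scope contains $u$ is a translation-invariant two-point factor with scope $\{u,v_j\}$. Cost is measured in arithmetic operations on, and stored, complex numbers; products of kernels may be evaluated in $\mathcal O(1)$ per value, and cyclic convolutions and discrete Fourier transforms of size $N$ on $\Lambda/(n\Lambda)$ can be done by FFT in $\mathcal O(N\log N)$ operations. *)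

theory Defs
  imports
    "HOL-Analysis.Analysis"
    "HOL-Library.Multiset"
    "HOL-Library.Landau_Symbols"
    "Graph_Theory.Digraph_Component"
begin

section \<open>Lattice, torus cell and momentum grid\<close>

definition int_vecs :: "(real ^ 'd::finite) set" where
  "int_vecs = {z. \<forall>i. z $ i \<in> \<int>}"

definition lattice_of :: "real ^ 'd ^ 'd::finite \<Rightarrow> (real ^ 'd) set" where
  "lattice_of A = (\<lambda>z. A *v z) ` int_vecs"

definition dual_lattice :: "real ^ 'd ^ 'd::finite \<Rightarrow> (real ^ 'd) set" where
  "dual_lattice A = (\<lambda>z. matrix_inv (transpose A) *v z) ` int_vecs"

definition cell :: "real ^ 'd ^ 'd::finite \<Rightarrow> nat \<Rightarrow> (real ^ 'd) set" where
  "cell A n = (\<lambda>z. A *v z) `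
     {z \<in> int_vecs. \<forall>i. - of_int \<lceil>real n / 2\<rceil> + 1 \<le> z $ i \<and> z $ i \<le> of_int \<lfloor>real n / 2\<rfloor>}"

definition wrap :: "real ^ 'd ^ 'd::finite \<Rightarrow> nat \<Rightarrow> real ^ 'd \<Rightarrow> real ^ 'd" where
  "wrap A n y = (THE r. r \<in> cell A n \<and> y - r \<in> (\<lambda>z. real n *\<^sub>R z) ` lattice_of A)"

definition delta :: "real ^ 'd ^ 'd::finite \<Rightarrow> nat \<Rightarrow> real ^ 'd \<Rightarrow> real ^ 'd \<Rightarrow> real ^ 'd" where
  "delta A n xu xv = wrap A n (xv - xu)"

text \<open>The grid is a genuine quotient: its elements are classes of momenta modulo the
  reciprocal lattice.\<close>

definition momentum_grid :: "real ^ 'd ^ 'd::finite \<Rightarrow> nat \<Rightarrow> (real ^ 'd) set set" where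
  "momentum_grid A n =
     (let M = (\<lambda>k. (1 / real n) *\<^sub>R k) ` dual_lattice A
      in M // {(k, k'). k \<in> M \<and> k' \<in> M \<and> k - k' \<in> dual_lattice A})"

definition phase :: "real ^ 'd::finite \<Rightarrow> real ^ 'd \<Rightarrow> complex" where
  "phase k y = cis (- 2 * pi * (y \<bullet> k))"


section \<open>Graphs\<close>

text \<open>A multigraph with oriented edges is a \<^typ>\<open>('v, 'e) pre_digraph\<close>; an edge \<open>e\<close> runs from
  \<open>tail G e\<close> to \<open>head G e\<close>. Connectivity ignores orientations.\<close>

definition joined :: "('v, 'e) pre_digraph \<Rightarrow> 'v \<Rightarrow> 'v \<Rightarrow> bool" where
  "joined G u w \<longleftrightarrow> reachable (with_proj (mk_symmetric G)) u w"

definition cutvertex :: "('v, 'e) pre_digraph \<Rightarrow> 'v \<Rightarrow> bool" where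
  "cutvertex G v \<longleftrightarrow> v \<in> verts G \<and>
     (\<exists>u \<in> verts G - {v}. \<exists>w \<in> verts G - {v}.
        joined G u w \<and> \<not> joined (pre_digraph.del_vert G v) u w)"

definition is_block :: "('v, 'e) pre_digraph \<Rightarrow> bool" where
  "is_block G \<longleftrightarrow> Digraph_Component.connected G \<and> \<not> (\<exists>v. cutvertex G v)"

definition add_edge :: "('v, 'e) pre_digraph \<Rightarrow> 'v \<Rightarrow> 'v \<Rightarrow> ('v, 'e option) pre_digraph" where
  "add_edge G u w = \<lparr> verts = verts G, arcs = insert None (Some ` arcs G),
     tail = case_option u (tail G), head = case_option w (head G) \<rparr>"

definition simple_edges :: "('v, 'e) pre_digraph \<Rightarrow> 'v set set" where
  "simple_edges G = {{tail G e, head G e} | e. e \<in> arcs G \<and> tail G e \<noteq> head G e}"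


subsection \<open>Treewidth\<close>

definition connected_on :: "'a set set \<Rightarrow> 'a set \<Rightarrow> bool" where
  "connected_on F X \<longleftrightarrow> X \<noteq> {} \<and>
     (\<forall>x \<in> X. \<forall>y \<in> X. (x, y) \<in> {(a, b). a \<in> X \<and> b \<in> X \<and> {a, b} \<in> F}\<^sup>*)"

definition has_cycle :: "'a set set \<Rightarrow> bool" where
  "has_cycle F \<longleftrightarrow> (\<exists>c. 3 \<le> length c \<and> distinct c \<and>
     (\<forall>i < length c. {c ! i, c ! (Suc i mod length c)} \<in> F))"

text \<open>The predicate \<open>tree\<close> of \<open>Graph_Theory\<close> only excludes directed cycles, so it is unsuitable
  here.\<close>

definition undirected_tree :: "'a set \<Rightarrow> 'a set set \<Rightarrow> bool" where
  "undirected_tree I F \<longleftrightarrow> finite I \<and> (\<forall>f \<in> F. f \<subseteq> I \<and> card f = 2) \<and>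
     connected_on F I \<and> \<not> has_cycle F"

definition tree_decomposition ::
  "'v set \<Rightarrow> 'v set set \<Rightarrow> nat set \<Rightarrow> nat set set \<Rightarrow> (nat \<Rightarrow> 'v set) \<Rightarrow> bool" where
  "tree_decomposition V E I F B \<longleftrightarrow> undirected_tree I F \<and>
     (\<Union>i \<in> I. B i) = V \<and>
     (\<forall>e \<in> E. \<exists>i \<in> I. e \<subseteq> B i) \<and>
     (\<forall>v \<in> V. connected_on F {i \<in> I. v \<in> B i})"

definition treewidth :: "('v, 'e) pre_digraph \<Rightarrow> nat" where
  "treewidth G = (LEAST k. \<exists>I F B. tree_decomposition (verts G) (simple_edges G) I F B \<and>
     k = Max ((\<lambda>i. card (B i)) ` I) - 1)"

definition treewidth_st :: "('v, 'e) pre_digraph \<Rightarrow> 'v \<Rightarrow> 'v \<Rightarrow> nat" where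
  "treewidth_st G s t = (if s \<noteq> t then treewidth (add_edge G s t) else treewidth G)"


section \<open>The torus-discretized lattice sum\<close>

type_synonym ('e, 'd) kernels = "'e \<Rightarrow> real ^ 'd \<Rightarrow> complex"

definition l1_kernels ::
  "real ^ 'd ^ 'd::finite \<Rightarrow> ('v, 'e) pre_digraph \<Rightarrow> ('e, 'd) kernels \<Rightarrow> bool" where
  "l1_kernels A G K \<longleftrightarrow> (\<forall>e \<in> arcs G. (\<lambda>x. norm (K e x)) summable_on lattice_of A)"

definition torus_sum ::
  "real ^ 'd ^ 'd::finite \<Rightarrow> nat \<Rightarrow> ('v, 'e) pre_digraph \<Rightarrow> ('e, 'd) kernels \<Rightarrow> 'v \<Rightarrow> 'v \<Rightarrow> 'v
     \<Rightarrow> real ^ 'd \<Rightarrow> complex" where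
  "torus_sum A n G K s t p k =
     (\<Sum>x0 \<in> (verts G - {p}) \<rightarrow>\<^sub>E cell A n.
        let x = x0(p := 0) in
          phase k (delta A n (x s) (x t)) *
          (\<Prod>e \<in> arcs G. K e (delta A n (x (tail G e)) (x (head G e)))))"


section \<open>Bucket elimination\<close>

text \<open>A factor consists of its scope \<open>U\<close> and a function of configurations \<open>U \<rightarrow> \<Lambda>\<^sub>n\<close>,
  represented as functions that are \<open>undefined\<close> outside of \<open>U\<close>. Families of factors are
  multisets, so that equal factors (such as parallel edges with the same kernel) are not
  merged.\<close>

type_synonym ('v, 'd) factor = "'v set \<times> (('v \<Rightarrow> real ^ 'd) \<Rightarrow> complex)"

definition factor_at :: "('v, 'd::finite) factor \<Rightarrow> ('v \<Rightarrow> real ^ 'd) \<Rightarrow> complex" where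
  "factor_at \<phi> x = snd \<phi> (restrict x (fst \<phi>))"

definition translation_invariant ::
  "real ^ 'd ^ 'd::finite \<Rightarrow> nat \<Rightarrow> 'v \<Rightarrow> 'v \<Rightarrow> ('v, 'd) factor \<Rightarrow> bool" where
  "translation_invariant A n u v \<phi> \<longleftrightarrow> fst \<phi> = {u, v} \<and>
     (\<exists>g. \<forall>x \<in> {u, v} \<rightarrow>\<^sub>E cell A n. snd \<phi> x = g (delta A n (x u) (x v)))"

definition edge_factor ::
  "real ^ 'd ^ 'd::finite \<Rightarrow> nat \<Rightarrow> ('v, 'e) pre_digraph \<Rightarrow> ('e, 'd) kernels \<Rightarrow> 'e
     \<Rightarrow> ('v, 'd) factor" where
  "edge_factor A n G K e =
     ({tail G e, head G e}, \<lambda>x. K e (delta A n (x (tail G e)) (x (head G e))))"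

definition momentum_factor ::
  "real ^ 'd ^ 'd::finite \<Rightarrow> nat \<Rightarrow> 'v \<Rightarrow> 'v \<Rightarrow> real ^ 'd \<Rightarrow> ('v, 'd) factor" where
  "momentum_factor A n s t k = ({s, t}, \<lambda>x. phase k (delta A n (x s) (x t)))"

definition initial_factors ::
  "real ^ 'd ^ 'd::finite \<Rightarrow> nat \<Rightarrow> ('v, 'e) pre_digraph \<Rightarrow> ('e, 'd) kernels \<Rightarrow> 'v \<Rightarrow> 'v
     \<Rightarrow> real ^ 'd \<Rightarrow> ('v, 'd) factor multiset" where
  "initial_factors A n G K s t k =
     add_mset (momentum_factor A n s t k)
       (image_mset (edge_factor A n G K) (mset_set (arcs G)))"

definition bucket :: "'v \<Rightarrow> ('v, 'd::finite) factor multiset \<Rightarrow> ('v, 'd) factor multiset" where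
  "bucket v P = {# \<phi> \<in># P. v \<in> fst \<phi> #}"

definition bucket_scope :: "'v \<Rightarrow> 'v set multiset \<Rightarrow> 'v set" where
  "bucket_scope v Us = \<Union> (set_mset {# U \<in># Us. v \<in> U #}) - {v}"

definition eliminate ::
  "real ^ 'd ^ 'd::finite \<Rightarrow> nat \<Rightarrow> 'v \<Rightarrow> ('v, 'd) factor multiset \<Rightarrow> ('v, 'd) factor multiset" where
  "eliminate A n v P =
     add_mset (bucket_scope v (image_mset fst P),
               \<lambda>x. \<Sum>y \<in> cell A n. \<Prod>\<phi> \<in># bucket v P. factor_at \<phi> (x(v := y)))
       (P - bucket v P)"

text \<open>The ordering \<open>\<pi>\<close> is indexed from 0: step \<open>j\<close> eliminates \<open>\<pi> ! j\<close>.\<close>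

definition factors_before ::
  "real ^ 'd ^ 'd::finite \<Rightarrow> nat \<Rightarrow> ('v, 'e) pre_digraph \<Rightarrow> ('e, 'd) kernels \<Rightarrow> 'v \<Rightarrow> 'v
     \<Rightarrow> real ^ 'd \<Rightarrow> 'v list \<Rightarrow> nat \<Rightarrow> ('v, 'd) factor multiset" where
  "factors_before A n G K s t k \<pi> j =
     fold (eliminate A n) (take j \<pi>) (initial_factors A n G K s t k)"

text \<open>The scopes evolve independently of the values of the factors, hence of \<open>n\<close>, \<open>K\<close> and
  \<open>k\<close>; lemma \<open>scopes_before_eq\<close> below connects the two recursions.\<close>

definition initial_scopes :: "('v, 'e) pre_digraph \<Rightarrow> 'v \<Rightarrow> 'v \<Rightarrow> 'v set multiset" where
  "initial_scopes G s t =
     add_mset {s, t} (image_mset (\<lambda>e. {tail G e, head G e}) (mset_set (arcs G)))"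

definition eliminate_scope :: "'v \<Rightarrow> 'v set multiset \<Rightarrow> 'v set multiset" where
  "eliminate_scope v Us = add_mset (bucket_scope v Us) {# U \<in># Us. v \<notin> U #}"

definition scopes_before ::
  "('v, 'e) pre_digraph \<Rightarrow> 'v \<Rightarrow> 'v \<Rightarrow> 'v list \<Rightarrow> nat \<Rightarrow> 'v set multiset" where
  "scopes_before G s t \<pi> j = fold eliminate_scope (take j \<pi>) (initial_scopes G s t)"

definition step_scope :: "('v, 'e) pre_digraph \<Rightarrow> 'v \<Rightarrow> 'v \<Rightarrow> 'v list \<Rightarrow> nat \<Rightarrow> 'v set" where
  "step_scope G s t \<pi> j = bucket_scope (\<pi> ! j) (scopes_before G s t \<pi> j)"

lemma scopes_eliminate:
  "image_mset fst (eliminate A n v P) = eliminate_scope v (image_mset fst P)"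
proof -
  have "P - bucket v P = {# \<phi> \<in># P. v \<notin> fst \<phi> #}"
    unfolding bucket_def by (simp add: multiset_eq_iff)
  then show ?thesis
    by (simp add: eliminate_def eliminate_scope_def filter_mset_image_mset)
qed

lemma scopes_fold_eliminate:
  "image_mset fst (fold (eliminate A n) vs P) = fold eliminate_scope vs (image_mset fst P)"
  by (induction vs arbitrary: P) (simp_all add: scopes_eliminate)

lemma scopes_before_eq:
  "image_mset fst (factors_before A n G K s t k \<pi> j) = scopes_before G s t \<pi> j"
proof -
  have "image_mset fst (initial_factors A n G K s t k) = initial_scopes G s t"
    by (simp add: initial_factors_def initial_scopes_def momentum_factor_def edge_factor_def
        image_mset.compositionality o_def)
  then show ?thesis
    by (simp add: factors_before_def scopes_before_def scopes_fold_eliminate)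
qed

definition width :: "('v, 'e) pre_digraph \<Rightarrow> 'v \<Rightarrow> 'v \<Rightarrow> 'v list \<Rightarrow> nat" where
  "width G s t \<pi> = Max ((\<lambda>j. card (step_scope G s t \<pi> j)) ` {..<length \<pi>})"

text \<open>The elimination orderings for the pin \<open>p = s\<close>.\<close>

definition admissible_ordering :: "('v, 'e) pre_digraph \<Rightarrow> 'v \<Rightarrow> 'v \<Rightarrow> 'v list \<Rightarrow> bool" where
  "admissible_ordering G s t \<pi> \<longleftrightarrow>
     distinct \<pi> \<and> set \<pi> = verts G - {s} \<and>
     (\<forall>j < length \<pi>. card (step_scope G s t \<pi> j) \<le> treewidth_st G s t) \<and>
     (s \<noteq> t \<longrightarrow> last \<pi> = t)"

definition convolutional_step ::
  "real ^ 'd ^ 'd::finite \<Rightarrow> nat \<Rightarrow> ('v, 'e) pre_digraph \<Rightarrow> ('e, 'd) kernels \<Rightarrow> 'v \<Rightarrow> 'v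
     \<Rightarrow> real ^ 'd \<Rightarrow> 'v list \<Rightarrow> nat \<Rightarrow> bool" where
  "convolutional_step A n G K s t k \<pi> j \<longleftrightarrow>
     (\<exists>u \<in> step_scope G s t \<pi> j.
        \<forall>\<phi> \<in># bucket (\<pi> ! j) (factors_before A n G K s t k \<pi> j).
          u \<in> fst \<phi> \<longrightarrow> translation_invariant A n u (\<pi> ! j) \<phi>)"

definition max_steps_convolutional ::
  "real ^ 'd ^ 'd::finite \<Rightarrow> nat \<Rightarrow> ('v, 'e) pre_digraph \<Rightarrow> ('e, 'd) kernels \<Rightarrow> 'v \<Rightarrow> 'v
     \<Rightarrow> real ^ 'd \<Rightarrow> 'v list \<Rightarrow> bool" where
  "max_steps_convolutional A n G K s t k \<pi> \<longleftrightarrow>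
     (\<forall>j < length \<pi>. card (step_scope G s t \<pi> j) = width G s t \<pi>
        \<longrightarrow> convolutional_step A n G K s t k \<pi> j)"


section \<open>Cost model\<close>

text \<open>Straight-line programs over complex registers. A program is written for one value of \<open>n\<close>,
  but it has to work for all kernels (and, for a single momentum, for all momenta), whose values
  it can obtain only through \<open>Input\<close>; constants are therefore independent of these data. Every
  instruction costs one operation, except for \<open>Convolve\<close> and \<open>Fourier\<close>, the cyclic convolution and
  the discrete Fourier transform on \<open>\<Lambda>/(n\<Lambda>)\<close>. These two act on arrays of registers indexed by
  the cell and, for the output of \<open>Fourier\<close>, by the momentum grid, and are charged
  \<open>fft_ops N\<close> operations and \<open>fft_space N\<close> auxiliary storage, where \<open>N\<close> is the
  number of points of the cell.\<close>

datatype ('i, 'x) instr =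
    Const nat complex
  | Input nat 'i
  | Add nat nat nat
  | Sub nat nat nat
  | Mult nat nat nat
  | Convolve "'x \<Rightarrow> nat" "'x \<Rightarrow> nat" "'x \<Rightarrow> nat"
  | Fourier "'x set \<Rightarrow> nat" "'x \<Rightarrow> nat"

text \<open>The first argument is the target. If two indices of an output array share a register, an
  arbitrary one of the two values is stored there.\<close>

fun exec ::
  "real ^ 'd ^ 'd::finite \<Rightarrow> nat \<Rightarrow> ('i \<Rightarrow> complex) \<Rightarrow> ('i, real ^ 'd) instr
     \<Rightarrow> (nat \<Rightarrow> complex) \<Rightarrow> nat \<Rightarrow> complex" where
  "exec A n inp (Const r c) \<sigma> = \<sigma>(r := c)"
| "exec A n inp (Input r i) \<sigma> = \<sigma>(r := inp i)"
| "exec A n inp (Add r a b) \<sigma> = \<sigma>(r := \<sigma> a + \<sigma> b)"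
| "exec A n inp (Sub r a b) \<sigma> = \<sigma>(r := \<sigma> a - \<sigma> b)"
| "exec A n inp (Mult r a b) \<sigma> = \<sigma>(r := \<sigma> a * \<sigma> b)"
| "exec A n inp (Convolve h f g) \<sigma> = (\<lambda>r.
     if r \<in> h ` cell A n
     then let x = inv_into (cell A n) h r
          in \<Sum>y \<in> cell A n. \<sigma> (f y) * \<sigma> (g (delta A n y x))
     else \<sigma> r)"
| "exec A n inp (Fourier h f) \<sigma> = (\<lambda>r.
     if r \<in> h ` momentum_grid A n
     then let k = (SOME k. k \<in> inv_into (momentum_grid A n) h r)
          in \<Sum>y \<in> cell A n. phase k y * \<sigma> (f y)
     else \<sigma> r)"

definition run ::
  "real ^ 'd ^ 'd::finite \<Rightarrow> nat \<Rightarrow> ('i \<Rightarrow> complex) \<Rightarrow> ('i, real ^ 'd) instr list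
     \<Rightarrow> (nat \<Rightarrow> complex) \<Rightarrow> nat \<Rightarrow> complex" where
  "run A n inp P = fold (exec A n inp) P"

fun is_fft :: "('i, 'x) instr \<Rightarrow> bool" where
  "is_fft (Convolve h f g) \<longleftrightarrow> True"
| "is_fft (Fourier h f) \<longleftrightarrow> True"
| "is_fft _ \<longleftrightarrow> False"

fun registers ::
  "real ^ 'd ^ 'd::finite \<Rightarrow> nat \<Rightarrow> ('i, real ^ 'd) instr \<Rightarrow> nat set" where
  "registers A n (Const r c) = {r}"
| "registers A n (Input r i) = {r}"
| "registers A n (Add r a b) = {r, a, b}"
| "registers A n (Sub r a b) = {r, a, b}"
| "registers A n (Mult r a b) = {r, a, b}"
| "registers A n (Convolve h f g) = h ` cell A n \<union> f ` cell A n \<union> g ` cell A n"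
| "registers A n (Fourier h f) = h ` momentum_grid A n \<union> f ` cell A n"

definition operations ::
  "(nat \<Rightarrow> nat) \<Rightarrow> real ^ 'd ^ 'd::finite \<Rightarrow> nat \<Rightarrow> ('i, real ^ 'd) instr list \<Rightarrow> nat" where
  "operations fft_ops A n P =
     (\<Sum>c \<leftarrow> P. if is_fft c then fft_ops (card (cell A n)) else 1)"

definition memory ::
  "(nat \<Rightarrow> nat) \<Rightarrow> real ^ 'd ^ 'd::finite \<Rightarrow> nat \<Rightarrow> ('i, real ^ 'd) instr list \<Rightarrow> nat" where
  "memory fft_space A n P =
     card (\<Union>c \<in> set P. registers A n c) +
     (if \<exists>c \<in> set P. is_fft c then fft_space (card (cell A n)) else 0)"


subsection \<open>Evaluation of the lattice sum\<close>

text \<open>With a single momentum \<open>k\<close>, the inputs are the values \<open>K e x\<close> and \<open>phase k x\<close>; on the full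
  momentum grid there are only the former. Registers initially hold arbitrary values.\<close>

datatype ('e, 'x) single_input = Kernel_Value 'e 'x | Phase_Value 'x

fun input_values :: "('e, 'd::finite) kernels \<Rightarrow> real ^ 'd \<Rightarrow> ('e, real ^ 'd) single_input \<Rightarrow> complex"
  where
  "input_values K k (Kernel_Value e x) = K e x"
| "input_values K k (Phase_Value x) = phase k x"

definition evaluates_at_momentum ::
  "real ^ 'd ^ 'd::finite \<Rightarrow> nat \<Rightarrow> ('v, 'e) pre_digraph \<Rightarrow> ('e, 'd) kernels \<Rightarrow> 'v \<Rightarrow> 'v
     \<Rightarrow> real ^ 'd \<Rightarrow> (('e, real ^ 'd) single_input, real ^ 'd) instr list \<Rightarrow> nat \<Rightarrow> bool" where
  "evaluates_at_momentum A n G K s t k P out \<longleftrightarrow>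
     (\<forall>\<sigma>. run A n (input_values K k) P \<sigma> out = torus_sum A n G K s t s k)"

definition evaluates_on_grid ::
  "real ^ 'd ^ 'd::finite \<Rightarrow> nat \<Rightarrow> ('v, 'e) pre_digraph \<Rightarrow> ('e, 'd) kernels \<Rightarrow> 'v \<Rightarrow> 'v
     \<Rightarrow> ('e \<times> (real ^ 'd), real ^ 'd) instr list \<Rightarrow> ((real ^ 'd) set \<Rightarrow> nat) \<Rightarrow> bool" where
  "evaluates_on_grid A n G K s t P out \<longleftrightarrow>
     (\<forall>\<sigma>. \<forall>\<kappa> \<in> momentum_grid A n. \<forall>k \<in> \<kappa>.
        run A n (\<lambda>(e, x). K e x) P \<sigma> (out \<kappa>) = torus_sum A n G K s t s k)"

end

theory Submission
  imports Defs
begin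

text \<open>
  An elimination ordering exists because a tree decomposition can be taken apart leaf by leaf. The
  vertices that occur only in a leaf bag are eliminated, which creates scopes inside that bag only,
  and then the leaf is deleted. The edge between \<open>s\<close> and \<open>t\<close> forces a bag that contains both; it
  is kept to the end, and \<open>t\<close> is eliminated last (\<open>eliminate_down_to_bag\<close>,
  \<open>admissible_ordering_exists\<close>).

  The saving in memory comes from translation invariance. Every kernel depends on a displacement
  only, and a common shift of all positions permutes the cell, so every message of the bucket
  elimination is invariant under translations of all its arguments. A message with scope \<open>S\<close> can
  thus be stored in a table with one vertex of \<open>S\<close> pinned at \<open>0\<close>, which has \<open>N ^ (card S - 1)\<close>
  entries, and it can be read at any other configuration after a shift (\<open>message_value\<close>). Filling
  the table directly takes about \<open>N\<close> operations per entry, hence \<open>N ^ card S\<close> in total. If some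
  \<open>u \<in> S\<close> shares with the eliminated vertex \<open>v\<close> only factors of scope \<open>{u, v}\<close>, then for fixed
  values of the other variables the sum over \<open>v\<close> is a convolution indexed by \<open>u\<close>. Pinning a vertex
  other than \<open>u\<close> leaves \<open>N ^ (card S - 2)\<close> such convolutions, each with the cost of an FFT
  (\<open>conv_prog_computes_message\<close>).

  Correctness is an invariant: the sum over the remaining variables of the product of all tables
  does not change in a step (\<open>eliminate_vertex\<close>). The invariant admits a weight that does not
  depend on the eliminated vertices. For a single momentum the phases are read into the table of
  the momentum factor and the weight is \<open>1\<close>. For the full grid the table of the momentum factor is
  filled with ones, the phase is the weight, and the elimination stops before \<open>t\<close>; what is left is
  a function of the position of \<open>t\<close>, whose discrete Fourier transform is the lattice sum at all grid
  momenta (\<open>fourier_prog_run\<close>). For \<open>s = t\<close> the phase is \<open>1\<close> and the sum does not depend on the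
  momentum.

  The programs use a convolution wherever the scopes allow one, so the same program serves the
  general and the convolutional bound. Whether a step is convolutional is seen from the scopes
  alone (\<open>convolutional_steps\<close>). All tables are determined by the graph and the ordering, so the
  number of tables and the sizes of the buckets enter the bounds as constants.
\<close>

section \<open>Elimination orderings from tree decompositions\<close>

definition walk :: "'a set set \<Rightarrow> 'a list \<Rightarrow> bool" where
  "walk F xs \<longleftrightarrow> (\<forall>i. Suc i < length xs \<longrightarrow> {xs ! i, xs ! Suc i} \<in> F)"

lemma connected_on_neighbour:
  assumes "connected_on F X" and "r \<in> X" and "X \<noteq> {r}"
  obtains y where "y \<in> X" "y \<noteq> r" "{r, y} \<in> F"
proof -
  obtain z where z: "z \<in> X" "z \<noteq> r" using assms by blast
  have "(r, z) \<in> {(a, b). a \<in> X \<and> b \<in> X \<and> {a, b} \<in> F}\<^sup>*"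
    using assms z unfolding connected_on_def by blast
  then have "\<exists>y. y \<in> X \<and> y \<noteq> r \<and> {r, y} \<in> F"
    using z(2) by (induction rule: rtrancl_induct) auto
  then show thesis using that by blast
qed

lemma walk_snoc:
  assumes "walk F xs" and "xs \<noteq> []" and "{last xs, y} \<in> F"
  shows "walk F (xs @ [y])"
  unfolding walk_def
proof (intro allI impI)
  fix i assume i: "Suc i < length (xs @ [y])"
  show "{(xs @ [y]) ! i, (xs @ [y]) ! Suc i} \<in> F"
  proof (cases "Suc i < length xs")
    case True
    then show ?thesis using assms(1) by (simp add: walk_def nth_append)
  next
    case False
    then have "i = length xs - 1" "Suc i = length xs" using i assms(2) by auto
    then show ?thesis using assms by (simp add: nth_append last_conv_nth)
  qed
qed

text \<open>The cycle is the end of the walk from the neighbour on, which has at least three vertices.\<close>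

lemma chord_closes_cycle:
  assumes "walk F xs" and "distinct xs" and "Suc (Suc i) < length xs" and "{last xs, xs ! i} \<in> F"
  shows "has_cycle F"
proof -
  define c where "c = drop i xs"
  have len: "length c = length xs - i" by (simp add: c_def)
  have edge: "{c ! j, c ! (Suc j mod length c)} \<in> F" if j: "j < length c" for j
  proof (cases "Suc j < length c")
    case True
    then have "Suc (i + j) < length xs" using len by simp
    then show ?thesis using assms(1) True by (simp add: walk_def c_def)
  next
    case False
    then have j': "Suc j = length c" using j by simp
    have "c \<noteq> []" using j by auto
    then have "c ! j = last c" using j' by (simp add: last_conv_nth flip: j')
    also have "last c = last xs" using assms(3) by (simp add: c_def)
    finally have "c ! j = last xs" .
    moreover have "c ! 0 = xs ! i" using assms(3) by (simp add: c_def)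
    ultimately show ?thesis using assms(4) j' by simp
  qed
  show ?thesis
    unfolding has_cycle_def
    using edge len assms(2,3) by (intro exI[of _ c]) (auto simp: c_def)
qed

text \<open>The end of a longest path from \<open>r\<close> is a leaf: its neighbours lie on the path, and a
  neighbour other than its predecessor would close a cycle.\<close>

lemma tree_has_leaf:
  assumes tree: "undirected_tree I F" and r: "r \<in> I" and ne: "I \<noteq> {r}"
  obtains x p where "x \<in> I" "x \<noteq> r" "p \<in> I" "p \<noteq> x" "\<And>y. {x, y} \<in> F \<Longrightarrow> y = p"
proof -
  have fin: "finite I" and edges: "\<And>f. f \<in> F \<Longrightarrow> f \<subseteq> I \<and> card f = 2"
    and conn: "connected_on F I" and acyclic: "\<not> has_cycle F"
    using tree by (auto simp: undirected_tree_def)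
  define path where
    "path xs \<longleftrightarrow> distinct xs \<and> set xs \<subseteq> I \<and> xs \<noteq> [] \<and> hd xs = r \<and> walk F xs" for xs
  have "length xs \<le> card I" if "path xs" for xs
    using that card_mono[OF fin, of "set xs"] by (simp add: path_def distinct_card)
  then have bound: "\<forall>xs. path xs \<longrightarrow> length xs < Suc (card I)" by (simp add: le_imp_less_Suc)
  obtain y where y: "y \<in> I" "y \<noteq> r" "{r, y} \<in> F"
    using connected_on_neighbour[OF conn r ne] .
  have "path [r, y]" using y r by (auto simp: path_def walk_def)
  then obtain xs where xs: "path xs" and longest: "\<And>ys. path ys \<Longrightarrow> length ys \<le> length xs"
    using ex_has_greatest_nat[of path "[r, y]" length "Suc (card I)"] bound by blast
  have len: "length xs \<ge> 2" using longest[OF \<open>path [r, y]\<close>] by simp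
  define x where "x = last xs"
  define m where "m = length xs - 2"
  have xm: "x = xs ! Suc m"
  proof -
    have "Suc m = length xs - 1" "xs \<noteq> []" using len by (auto simp: m_def)
    then show ?thesis by (simp add: x_def last_conv_nth)
  qed
  have m: "Suc m < length xs" using len by (simp add: m_def)
  have rx: "r = xs ! 0" using xs by (metis path_def hd_conv_nth)
  have xI: "x \<in> I" and pI: "xs ! m \<in> I"
    using xs m xm by (auto simp: path_def subset_iff)
  have ne1: "x \<noteq> r" "xs ! m \<noteq> x"
    using xs m len by (auto simp: xm rx path_def nth_eq_iff_index_eq)
  have "z = xs ! m" if z: "{x, z} \<in> F" for z
  proof -
    have zI: "z \<in> I" "z \<noteq> x" using edges[OF z] by (auto simp: card_insert_if split: if_splits)
    have "z \<in> set xs"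
    proof (rule ccontr)
      assume "z \<notin> set xs"
      then have "path (xs @ [z])"
        using xs zI z by (auto simp: path_def x_def intro: walk_snoc)
      from longest[OF this] show False by simp
    qed
    then obtain i where i: "i < length xs" "z = xs ! i" by (auto simp: in_set_conv_nth)
    have "\<not> Suc (Suc i) < length xs"
      using chord_closes_cycle[of F xs i] xs z acyclic i by (auto simp: path_def x_def)
    moreover have "i \<noteq> Suc m" using i zI xm by auto
    ultimately have "i = m" using i m by (simp add: m_def)
    then show ?thesis using i by simp
  qed
  then show thesis using that[OF xI ne1(1) pI ne1(2)] by blast
qed

text \<open>Moving a leaf to its neighbour maps walks to walks, so that deleting the leaf keeps
  connected sets connected.\<close>

lemma connected_on_delete_leaf:
  assumes conn: "connected_on F X" and leaf: "\<And>y. {x, y} \<in> F \<Longrightarrow> y = p" and px: "p \<noteq> x"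
    and ne: "X \<noteq> {x}"
  shows "connected_on {f \<in> F. x \<notin> f} (X - {x})"
proof -
  let ?R = "{(a, b). a \<in> X \<and> b \<in> X \<and> {a, b} \<in> F}"
  let ?R' = "{(a, b). a \<in> X - {x} \<and> b \<in> X - {x} \<and> {a, b} \<in> {f \<in> F. x \<notin> f}}"
  \<comment> \<open>A step to or from the leaf becomes a step from the neighbour to itself.\<close>
  let ?move = "\<lambda>c. if c = x then p else c"
  have walk: "(a, ?move b) \<in> ?R'\<^sup>*" if "(a, b) \<in> ?R\<^sup>*" "a \<noteq> x" for a b
    using that
  proof (induction rule: rtrancl_induct)
    case base
    then show ?case by simp
  next
    case (step b c)
    have IH: "(a, ?move b) \<in> ?R'\<^sup>*" using step by blast
    have bc: "b \<in> X" "c \<in> X" "{b, c} \<in> F" using step by auto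
    consider "b = x" | "c = x" | "b \<noteq> x" "c \<noteq> x" by blast
    then show ?case
    proof cases
      case 1
      then have "c = p" using leaf bc by auto
      then show ?thesis using IH 1 px by simp
    next
      case 2
      then have "b = p" using leaf[of b] bc by (simp add: insert_commute)
      then show ?thesis using IH 2 px by simp
    next
      case 3
      then have "(b, c) \<in> ?R'" using bc by auto
      then show ?thesis using IH 3 by (simp add: rtrancl.rtrancl_into_rtrancl)
    qed
  qed
  show ?thesis
    unfolding connected_on_def
  proof (intro conjI ballI)
    show "X - {x} \<noteq> {}" using conn ne by (auto simp: connected_on_def)
  next
    fix a b assume ab: "a \<in> X - {x}" "b \<in> X - {x}"
    then have "(a, b) \<in> ?R\<^sup>*" using conn by (auto simp: connected_on_def)
    then show "(a, b) \<in> ?R'\<^sup>*" using walk[of a b] ab by auto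
  qed
qed

lemma undirected_tree_delete_leaf:
  assumes tree: "undirected_tree I F" and leaf: "\<And>y. {x, y} \<in> F \<Longrightarrow> y = p" and px: "p \<noteq> x"
    and ne: "I \<noteq> {x}"
  shows "undirected_tree (I - {x}) {f \<in> F. x \<notin> f}"
proof -
  have "connected_on {f \<in> F. x \<notin> f} (I - {x})"
    using connected_on_delete_leaf[OF _ leaf px ne] tree by (simp add: undirected_tree_def)
  moreover have "\<not> has_cycle {f \<in> F. x \<notin> f}"
    using tree unfolding undirected_tree_def has_cycle_def by blast
  ultimately show ?thesis using tree by (auto simp: undirected_tree_def)
qed

text \<open>Recursion on the ordering fits the proofs by induction better than the step index; the two
  forms are related by \<open>all_steps_iff\<close>.\<close>

fun all_steps :: "('v \<Rightarrow> 'v set multiset \<Rightarrow> bool) \<Rightarrow> 'v set multiset \<Rightarrow> 'v list \<Rightarrow> bool" where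
  "all_steps Q Us [] \<longleftrightarrow> True"
| "all_steps Q Us (v # vs) \<longleftrightarrow> Q v Us \<and> all_steps Q (eliminate_scope v Us) vs"

lemma all_steps_append:
  "all_steps Q Us (vs @ ws) \<longleftrightarrow> all_steps Q Us vs \<and> all_steps Q (fold eliminate_scope vs Us) ws"
  by (induction vs arbitrary: Us) auto

lemma all_steps_iff:
  "all_steps Q Us vs \<longleftrightarrow> (\<forall>j<length vs. Q (vs ! j) (fold eliminate_scope (take j vs) Us))"
  by (induction vs arbitrary: Us) (auto simp: All_less_Suc2)

abbreviation width_at_most :: "nat \<Rightarrow> 'v set multiset \<Rightarrow> 'v list \<Rightarrow> bool" where
  "width_at_most k \<equiv> all_steps (\<lambda>v Us. card (bucket_scope v Us) \<le> k)"

text \<open>A new scope is the union of scopes that contain the eliminated vertex. These lie in the bag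
  \<open>B\<close>, and so does the new scope, without the eliminated vertex; hence the bound, and hence the
  hypothesis for the next vertex.\<close>

lemma eliminate_private_vertices:
  assumes "finite B" and "card B \<le> Suc k" and "set ws \<subseteq> B" and "distinct ws"
    and "\<And>U. U \<in># Us \<Longrightarrow> U \<subseteq> B \<or> U \<inter> set ws = {}"
  shows "width_at_most k Us ws \<and>
    (\<forall>U \<in># fold eliminate_scope ws Us. U \<subseteq> B - set ws \<or> U \<in># Us \<and> U \<inter> set ws = {})"
  using assms
proof (induction ws arbitrary: Us B)
  case Nil
  then show ?case by auto
next
  case (Cons v ws)
  let ?S = "bucket_scope v Us" and ?Us = "eliminate_scope v Us"
  have S: "?S \<subseteq> B - {v}"
    using Cons.prems(5) by (fastforce simp: bucket_scope_def)
  have vB: "v \<in> B" using Cons.prems(3) by simp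
  have card: "card (B - {v}) \<le> k" using Cons.prems(1,2) vB by simp
  have "card ?S \<le> card (B - {v})" using S Cons.prems(1) by (intro card_mono) auto
  then have cardS: "card ?S \<le> k" using card by simp
  have mem: "U \<in># ?Us \<longleftrightarrow> U = ?S \<or> U \<in># Us \<and> v \<notin> U" for U
    by (auto simp: eliminate_scope_def)
  have "width_at_most k ?Us ws \<and>
    (\<forall>U \<in># fold eliminate_scope ws ?Us. U \<subseteq> (B - {v}) - set ws \<or> U \<in># ?Us \<and> U \<inter> set ws = {})"
  proof (rule Cons.IH)
    show "U \<subseteq> B - {v} \<or> U \<inter> set ws = {}" if "U \<in># ?Us" for U
      using that S Cons.prems(5)[of U] by (auto simp: mem)
  qed (use Cons.prems card in auto)
  moreover have "U \<subseteq> B - set (v # ws) \<or> U \<in># Us \<and> U \<inter> set (v # ws) = {}"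
    if "U \<subseteq> (B - {v}) - set ws \<or> U \<in># ?Us \<and> U \<inter> set ws = {}" for U
    using that S by (auto simp: mem)
  ultimately show ?case using cardS by simp
qed

text \<open>Induction on the number of bags: the vertices of a leaf bag that do not occur in the
  neighbouring bag occur in no other bag, and eliminating them only creates scopes inside the leaf
  bag. What is left of the leaf bag is contained in the neighbouring one, so the leaf can be
  deleted. The bag \<open>r\<close> is kept to the end.\<close>

lemma eliminate_down_to_bag:
  assumes "undirected_tree I F" and "r \<in> I"
    and "\<And>i. i \<in> I \<Longrightarrow> finite (B i) \<and> card (B i) \<le> Suc k"
    and "\<And>v. v \<in> (\<Union>i\<in>I. B i) \<Longrightarrow> connected_on F {i \<in> I. v \<in> B i}"
    and "\<And>U. U \<in># Us \<Longrightarrow> \<exists>i\<in>I. U \<subseteq> B i"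
  shows "\<exists>vs. distinct vs \<and> set vs = (\<Union>i\<in>I. B i) - B r \<and> width_at_most k Us vs \<and>
    (\<forall>U \<in># fold eliminate_scope vs Us. U \<subseteq> B r)"
  using assms
proof (induction "card I" arbitrary: I F Us rule: less_induct)
  case less
  show ?case
  proof (cases "I = {r}")
    case True
    then show ?thesis using less.prems(5) by (intro exI[of _ "[]"]) auto
  next
    case False
    obtain x p where x: "x \<in> I" "x \<noteq> r" and p: "p \<in> I" "p \<noteq> x"
      and leaf: "\<And>y. {x, y} \<in> F \<Longrightarrow> y = p"
      by (rule tree_has_leaf[OF less.prems(1,2) False]) blast
    let ?F = "{f \<in> F. x \<notin> f}"
    have fin: "finite I" using less.prems(1) by (simp add: undirected_tree_def)
    have only_leaf: "v \<in> B p" if "v \<in> B x" "v \<in> B i" "i \<in> I" "i \<noteq> x" for v i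
    proof -
      have "connected_on F {i \<in> I. v \<in> B i}" using less.prems(4) that by blast
      moreover have "x \<in> {i \<in> I. v \<in> B i}" "{i \<in> I. v \<in> B i} \<noteq> {x}" using that x by auto
      ultimately obtain y where "y \<in> {i \<in> I. v \<in> B i}" "{x, y} \<in> F"
        by (rule connected_on_neighbour)
      then show ?thesis using leaf by auto
    qed
    obtain ws where ws: "set ws = B x - B p" "distinct ws"
      using finite_distinct_list[of "B x - B p"] less.prems(3)[OF x(1)] by auto
    have "U \<subseteq> B x \<or> U \<inter> set ws = {}" if "U \<in># Us" for U
    proof -
      obtain i where "i \<in> I" "U \<subseteq> B i" using less.prems(5) \<open>U \<in># Us\<close> by blast
      then show ?thesis using only_leaf ws(1) by (cases "i = x") auto
    qed
    then have inside: "width_at_most k Us ws"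
      "\<And>U. U \<in># fold eliminate_scope ws Us \<Longrightarrow>
        U \<subseteq> B x - set ws \<or> U \<in># Us \<and> U \<inter> set ws = {}"
      using eliminate_private_vertices[of "B x" k ws Us] less.prems(3)[OF x(1)] ws by auto
    have "\<exists>vs. distinct vs \<and> set vs = (\<Union>i\<in>I - {x}. B i) - B r \<and>
      width_at_most k (fold eliminate_scope ws Us) vs \<and>
      (\<forall>U \<in># fold eliminate_scope vs (fold eliminate_scope ws Us). U \<subseteq> B r)"
    proof (rule less.hyps)
      show "card (I - {x}) < card I" by (rule card_Diff1_less[OF fin x(1)])
      show "undirected_tree (I - {x}) ?F"
        using undirected_tree_delete_leaf[OF less.prems(1) leaf p(2)] x less.prems(2) by auto
      show "connected_on ?F {i \<in> I - {x}. v \<in> B i}" if v: "v \<in> (\<Union>i\<in>I - {x}. B i)" for v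
      proof -
        have conn_v: "connected_on F {i \<in> I. v \<in> B i}" using v less.prems(4) by blast
        have ne_v: "{i \<in> I. v \<in> B i} \<noteq> {x}" using v by blast
        have "connected_on ?F ({i \<in> I. v \<in> B i} - {x})"
          by (rule connected_on_delete_leaf[OF conn_v _ p(2) ne_v]) (rule leaf)
        moreover have "{i \<in> I. v \<in> B i} - {x} = {i \<in> I - {x}. v \<in> B i}" by blast
        ultimately show ?thesis by simp
      qed
      show "\<exists>i\<in>I - {x}. U \<subseteq> B i" if "U \<in># fold eliminate_scope ws Us" for U
        using inside(2)[OF that]
      proof
        assume "U \<subseteq> B x - set ws"
        then show ?thesis using ws(1) p by blast
      next
        assume U: "U \<in># Us \<and> U \<inter> set ws = {}"
        then obtain i where "i \<in> I" "U \<subseteq> B i" using less.prems(5) by blast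
        then show ?thesis using U ws(1) p by (cases "i = x") blast+
      qed
    qed (use x less.prems in auto)
    then obtain vs where vs: "distinct vs" "set vs = (\<Union>i\<in>I - {x}. B i) - B r"
      "width_at_most k (fold eliminate_scope ws Us) vs"
      "\<forall>U \<in># fold eliminate_scope vs (fold eliminate_scope ws Us). U \<subseteq> B r"
      by blast
    have disj: "set ws \<inter> B i = {}" if "i \<in> I" "i \<noteq> x" for i
      using only_leaf[OF _ _ that] ws(1) by blast
    have "set ws \<inter> set vs = {}" unfolding vs(2) using disj by blast
    then have "distinct (ws @ vs)" using vs(1) ws(2) by simp
    moreover have "set (ws @ vs) = (\<Union>i\<in>I. B i) - B r"
      using vs(2) ws(1) disj[OF less.prems(2)] x p by auto
    moreover have "width_at_most k Us (ws @ vs)"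
      using inside(1) vs(3) by (simp add: all_steps_append)
    ultimately show ?thesis using vs(4) by (intro exI[of _ "ws @ vs"]) auto
  qed
qed

lemma tree_decomposition_exists:
  assumes "finite V" and "V \<noteq> {}" and "\<And>e. e \<in> E \<Longrightarrow> e \<subseteq> V"
  shows "tree_decomposition V E {0} {} (\<lambda>_. V)"
proof -
  have "connected_on {} {i::nat. i = 0}"
    by (auto simp: connected_on_def)
  moreover have "\<not> has_cycle ({} :: nat set set)"
    by (fastforce simp: has_cycle_def)
  ultimately show ?thesis
    using assms by (auto simp: tree_decomposition_def undirected_tree_def)
qed

text \<open>The minimum that defines the treewidth is attained, as there is the decomposition with one bag.\<close>

lemma treewidth_decomposition:
  assumes "finite (verts G)" and "verts G \<noteq> {}" and "\<And>e. e \<in> simple_edges G \<Longrightarrow> e \<subseteq> verts G"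
  obtains I F B where "tree_decomposition (verts G) (simple_edges G) I F B"
    and "treewidth G = Max ((\<lambda>i. card (B i)) ` I) - 1"
proof -
  have "\<exists>k I F B. tree_decomposition (verts G) (simple_edges G) I F B \<and>
     k = Max ((\<lambda>i. card (B i)) ` I) - 1"
    using tree_decomposition_exists[OF assms] by blast
  from LeastI_ex[OF this] show thesis using that unfolding treewidth_def by blast
qed

lemma treewidth_mono:
  assumes "finite (verts H)" and "verts H \<noteq> {}" and "\<And>e. e \<in> simple_edges H \<Longrightarrow> e \<subseteq> verts H"
    and "verts G = verts H" and "simple_edges G \<subseteq> simple_edges H"
  shows "treewidth G \<le> treewidth H"
proof -
  obtain I F B where "tree_decomposition (verts H) (simple_edges H) I F B"
    "treewidth H = Max ((\<lambda>i. card (B i)) ` I) - 1"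
    using treewidth_decomposition[OF assms(1-3)] .
  moreover from this have "tree_decomposition (verts G) (simple_edges G) I F B"
    using assms(4,5) by (auto simp: tree_decomposition_def)
  ultimately show ?thesis
    unfolding treewidth_def[of G] by (intro Least_le) blast
qed

lemma simple_edges_add_edge:
  "simple_edges (add_edge G s t) = simple_edges G \<union> (if s = t then {} else {{s, t}})"
  by (auto simp: simple_edges_def add_edge_def split: option.splits)

lemma verts_add_edge: "verts (add_edge G s t) = verts G"
  by (simp add: add_edge_def)

context
  fixes G :: "('v, 'e) pre_digraph" and s t :: 'v
  assumes fin: "fin_digraph G" and s: "s \<in> verts G" and t: "t \<in> verts G"
begin

interpretation fin_digraph G by (fact fin)

lemma simple_edges_subset: "e \<in> simple_edges G \<Longrightarrow> e \<subseteq> verts G"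
  by (auto simp: simple_edges_def)

lemma treewidth_le_treewidth_st: "treewidth G \<le> treewidth_st G s t"
proof (cases "s = t")
  case False
  have "treewidth G \<le> treewidth (add_edge G s t)"
    using s t simple_edges_subset
    by (intro treewidth_mono) (auto simp: simple_edges_add_edge verts_add_edge split: if_splits)
  then show ?thesis using False by (simp add: treewidth_st_def)
qed (simp add: treewidth_st_def)

text \<open>The edge between \<open>s\<close> and \<open>t\<close> lies in some bag. The vertices outside of it come first, then
  those of the bag, where each scope consists of at most the other vertices of the bag.\<close>

lemma admissible_ordering_exists: "\<exists>\<pi>. admissible_ordering G s t \<pi>"
proof -
  define H :: "('v, 'e option) pre_digraph" where "H = add_edge G s t"
  define E where "E = simple_edges G \<union> (if s = t then {} else {{s, t}})"
  define k where "k = treewidth_st G s t"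
  have E: "e \<subseteq> verts G" if "e \<in> E" for e
    using that s t simple_edges_subset by (auto simp: E_def split: if_splits)
  have "\<exists>I F B. tree_decomposition (verts G) E I F B \<and> k = Max ((\<lambda>i. card (B i)) ` I) - 1"
  proof (cases "s = t")
    case True
    then have "E = simple_edges G" by (simp add: E_def)
    then show ?thesis
      using treewidth_decomposition[of G] E s True unfolding k_def treewidth_st_def
      by (metis empty_iff finite_verts)
  next
    case False
    have "verts H = verts G" "simple_edges H = E"
      by (simp_all only: H_def verts_add_edge simple_edges_add_edge E_def)
    then show ?thesis
      using treewidth_decomposition[of H] E s False unfolding k_def treewidth_st_def H_def
      by (metis empty_iff finite_verts)
  qed
  then obtain I F B where dec: "tree_decomposition (verts G) E I F B"
    and k: "k = Max ((\<lambda>i. card (B i)) ` I) - 1" by blast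
  have tree: "undirected_tree I F" and cover: "(\<Union>i\<in>I. B i) = verts G"
    and edges: "\<And>e. e \<in> E \<Longrightarrow> \<exists>i\<in>I. e \<subseteq> B i"
    and conn: "\<And>v. v \<in> verts G \<Longrightarrow> connected_on F {i \<in> I. v \<in> B i}"
    using dec by (auto simp: tree_decomposition_def)
  have finI: "finite I" using tree by (simp add: undirected_tree_def)
  have finB: "finite (B i)" if "i \<in> I" for i
    using that cover by (auto intro: finite_subset[OF _ finite_verts])
  have card: "card (B i) \<le> Suc k" if "i \<in> I" for i
  proof -
    have "card (B i) \<le> Max ((\<lambda>i. card (B i)) ` I)" using that finI by (intro Max_ge) auto
    then show ?thesis using k by linarith
  qed
  have in_bag: "\<exists>i\<in>I. {u, w} \<subseteq> B i" if "u = w \<and> u \<in> verts G \<or> {u, w} \<in> E" for u w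
    using that cover edges[of "{u, w}"] by auto
  have "s = t \<or> {s, t} \<in> E" by (simp add: E_def)
  then obtain r where r: "r \<in> I" "{s, t} \<subseteq> B r" using in_bag s by blast
  let ?Us = "initial_scopes G s t"
  have "\<exists>i\<in>I. U \<subseteq> B i" if U: "U \<in># ?Us" for U
  proof -
    consider "U = {s, t}" | e where "e \<in> arcs G" "U = {tail G e, head G e}"
      using U by (auto simp: initial_scopes_def)
    then show ?thesis
    proof cases
      case 1
      then show ?thesis using r by blast
    next
      case 2
      then have "tail G e = head G e \<or> U \<in> E" by (auto simp: E_def simple_edges_def)
      then show ?thesis using in_bag 2 by auto
    qed
  qed
  then obtain vs where vs: "distinct vs" "set vs = verts G - B r" "width_at_most k ?Us vs"
    "\<And>U. U \<in># fold eliminate_scope vs ?Us \<Longrightarrow> U \<subseteq> B r"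
    using eliminate_down_to_bag[OF tree r(1), of B k ?Us] finB card conn cover by auto
  obtain ws where ws: "set ws = B r - {s, t}" "distinct ws"
    using finite_distinct_list[of "B r - {s, t}"] finB[OF r(1)] by auto
  define rest where "rest = ws @ (if s = t then [] else [t])"
  have rest: "distinct rest" "set rest = B r - {s}"
    using ws r by (auto simp: rest_def)
  have "width_at_most k (fold eliminate_scope vs ?Us) rest"
    using eliminate_private_vertices[of "B r" k rest "fold eliminate_scope vs ?Us"]
      finB[OF r(1)] card[OF r(1)] rest vs(4) by auto
  then have "width_at_most k ?Us (vs @ rest)" using vs by (simp add: all_steps_append)
  moreover have "distinct (vs @ rest)" "set (vs @ rest) = verts G - {s}"
    using vs rest r cover by auto
  moreover have "s \<noteq> t \<longrightarrow> last (vs @ rest) = t" by (simp add: rest_def)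
  ultimately have "admissible_ordering G s t (vs @ rest)"
    by (simp add: admissible_ordering_def all_steps_iff step_scope_def scopes_before_def k_def)
  then show ?thesis by blast
qed

end

section \<open>Arithmetic on the torus cell and the momentum grid\<close>

text \<open>The cell in the coordinates of the basis \<open>A\<close>.\<close>

definition int_cell :: "nat \<Rightarrow> (real ^ 'd::finite) set" where
  "int_cell n = {z \<in> int_vecs.
     \<forall>i. - of_int \<lceil>real n / 2\<rceil> + 1 \<le> z $ i \<and> z $ i \<le> of_int \<lfloor>real n / 2\<rfloor>}"

lemma cell_eq: "cell A n = (\<lambda>z. A *v z) ` int_cell n"
  by (simp add: cell_def int_cell_def)

lemma int_vecs_diff: "z \<in> int_vecs \<Longrightarrow> w \<in> int_vecs \<Longrightarrow> z - w \<in> int_vecs"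
  by (simp add: int_vecs_def)

lemma additive_image_diff:
  assumes "\<And>z w. f (z - w) = f z - f w" and "\<And>z w. z \<in> S \<Longrightarrow> w \<in> S \<Longrightarrow> z - w \<in> S"
    and "x \<in> f ` S" and "y \<in> f ` S"
  shows "x - y \<in> f ` S"
proof -
  obtain z w where "x = f z" "y = f w" "z \<in> S" "w \<in> S" using assms(3,4) by blast
  then have "x - y = f (z - w)" "z - w \<in> S" using assms(1,2) by simp_all
  then show ?thesis by blast
qed

text \<open>The range of each coordinate consists of \<open>n\<close> consecutive integers, so it is a complete residue
  system modulo \<open>n\<close>.\<close>

lemma half_sum: "\<lfloor>real n / 2\<rfloor> = - \<lceil>real n / 2\<rceil> + int n"
proof (cases "even n")
  case True
  then obtain m where "n = 2 * m" by blast
  then show ?thesis by simp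
next
  case False
  then obtain m where m: "n = 2 * m + 1" by (blast elim: oddE)
  have "\<lfloor>real n / 2\<rfloor> = int m" by (rule floor_unique) (auto simp: m)
  moreover have "\<lceil>real n / 2\<rceil> = int m + 1" by (rule ceiling_unique) (auto simp: m)
  ultimately show ?thesis by (simp add: m)
qed

lemma int_cell_residue:
  assumes n: "n \<ge> 1" and z: "(z :: real ^ 'd::finite) \<in> int_vecs"
  obtains r q where "r \<in> int_cell n" "q \<in> int_vecs" "z - r = real n *\<^sub>R q"
proof -
  define lo where "lo = - \<lceil>real n / 2\<rceil> + 1"
  define r :: "real ^ 'd" where "r = (\<chi> i. of_int (lo + (\<lfloor>z $ i\<rfloor> - lo) mod int n))"
  define q :: "real ^ 'd" where "q = (\<chi> i. of_int ((\<lfloor>z $ i\<rfloor> - lo) div int n))"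
  have "0 \<le> (\<lfloor>z $ i\<rfloor> - lo) mod int n \<and> (\<lfloor>z $ i\<rfloor> - lo) mod int n < int n" for i
    using n by simp
  then have "lo \<le> lo + (\<lfloor>z $ i\<rfloor> - lo) mod int n \<and>
      lo + (\<lfloor>z $ i\<rfloor> - lo) mod int n \<le> \<lfloor>real n / 2\<rfloor>" for i
    unfolding half_sum lo_def by (smt (verit))
  then have "real_of_int lo \<le> r $ i \<and> r $ i \<le> of_int \<lfloor>real n / 2\<rfloor>" for i
    unfolding r_def vec_lambda_beta of_int_le_iff by blast
  then have "r \<in> int_cell n"
    by (auto simp: int_cell_def int_vecs_def lo_def r_def)
  moreover have "z - r = real n *\<^sub>R q"
  proof (rule vec_eq_iff[THEN iffD2], rule allI)
    fix i
    have zi: "z $ i = of_int \<lfloor>z $ i\<rfloor>" using z by (simp add: int_vecs_def)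
    have "\<lfloor>z $ i\<rfloor> = lo + ((\<lfloor>z $ i\<rfloor> - lo) mod int n) + int n * ((\<lfloor>z $ i\<rfloor> - lo) div int n)"
      by (simp add: algebra_simps)
    then have "real_of_int \<lfloor>z $ i\<rfloor> = of_int (lo + ((\<lfloor>z $ i\<rfloor> - lo) mod int n)
        + int n * ((\<lfloor>z $ i\<rfloor> - lo) div int n))" by (simp only:)
    then have "real_of_int \<lfloor>z $ i\<rfloor> - of_int (lo + ((\<lfloor>z $ i\<rfloor> - lo) mod int n))
        = real n * of_int ((\<lfloor>z $ i\<rfloor> - lo) div int n)"
      unfolding of_int_add of_int_mult of_int_of_nat_eq by linarith
    then show "(z - r) $ i = (real n *\<^sub>R q) $ i"
      unfolding r_def q_def vector_minus_component vector_scaleR_component vec_lambda_beta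
        real_scaleR_def zi[symmetric] .
  qed
  moreover have "q \<in> int_vecs" by (simp add: q_def int_vecs_def)
  ultimately show thesis using that by blast
qed

lemma int_cell_unique:
  assumes r: "(r :: real ^ 'd::finite) \<in> int_cell n" and r': "r' \<in> int_cell n"
    and q: "r - r' = real n *\<^sub>R q" "q \<in> int_vecs"
  shows "r = r'"
proof (rule vec_eq_iff[THEN iffD2], rule allI)
  fix i
  obtain a b c where abc: "r $ i = of_int a" "r' $ i = of_int b" "q $ i = of_int c"
    using r r' q(2) unfolding int_cell_def int_vecs_def by (auto elim!: Ints_cases dest!: spec[of _ i])
  have "(r - r') $ i = (real n *\<^sub>R q) $ i" by (simp only: q(1))
  then have "r $ i - r' $ i = real n * q $ i" by simp
  then have "real_of_int (a - b) = of_int (int n * c)" using abc by simp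
  then have eq: "a - b = int n * c" by (simp only: of_int_eq_iff)
  have "real_of_int (- \<lceil>real n / 2\<rceil> + 1) \<le> of_int a" "real_of_int a \<le> of_int \<lfloor>real n / 2\<rfloor>"
    "real_of_int (- \<lceil>real n / 2\<rceil> + 1) \<le> of_int b" "real_of_int b \<le> of_int \<lfloor>real n / 2\<rfloor>"
    using r r' abc unfolding int_cell_def by (auto dest!: spec[of _ i])
  then have "- \<lceil>real n / 2\<rceil> + 1 \<le> a" "a \<le> \<lfloor>real n / 2\<rfloor>"
    "- \<lceil>real n / 2\<rceil> + 1 \<le> b" "b \<le> \<lfloor>real n / 2\<rfloor>"
    by (simp_all only: of_int_le_iff)
  then have "\<bar>a - b\<bar> < int n" using half_sum[of n] by linarith
  then have "int n * \<bar>c\<bar> < int n * 1" using eq by (simp add: abs_mult)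
  then have "\<bar>c\<bar> < 1" by (rule mult_left_less_imp_less) simp
  then show "r $ i = r' $ i" using eq abc by simp
qed

lemma finite_int_cell: "finite (int_cell n :: (real ^ 'd::finite) set)"
proof -
  define S where "S = real_of_int ` {- \<lceil>real n / 2\<rceil> + 1..\<lfloor>real n / 2\<rfloor>}"
  have "z \<in> vec_lambda ` (UNIV \<rightarrow>\<^sub>E S)" if z: "z \<in> int_cell n" for z :: "real ^ 'd"
  proof -
    have "z $ i \<in> S" for i
    proof -
      obtain a where a: "z $ i = of_int a"
        using z unfolding int_cell_def int_vecs_def by (auto elim!: Ints_cases dest!: spec[of _ i])
      have "real_of_int (- \<lceil>real n / 2\<rceil> + 1) \<le> of_int a" "real_of_int a \<le> of_int \<lfloor>real n / 2\<rfloor>"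
        using z a unfolding int_cell_def by (auto dest!: spec[of _ i])
      then show ?thesis unfolding S_def a of_int_le_iff by auto
    qed
    then have "z = vec_lambda (vec_nth z)" "vec_nth z \<in> UNIV \<rightarrow>\<^sub>E S" by auto
    then show ?thesis by blast
  qed
  moreover have "finite (vec_lambda ` (UNIV \<rightarrow>\<^sub>E S) :: (real ^ 'd) set)"
    by (intro finite_imageI finite_PiE) (auto simp: S_def)
  ultimately show ?thesis by (rule finite_subset[OF subsetI])
qed

lemma card_int_cell_ge: "n \<le> card (int_cell n :: (real ^ 'd::finite) set)"
proof -
  define f :: "nat \<Rightarrow> real ^ 'd" where "f j = (\<chi> i. of_int (- \<lceil>real n / 2\<rceil> + 1 + int j))" for j
  have "inj_on f {..<n}" by (auto simp: inj_on_def f_def vec_eq_iff)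
  moreover have "f ` {..<n} \<subseteq> int_cell n"
  proof clarify
    fix j assume j: "j < n"
    have "- \<lceil>real n / 2\<rceil> + 1 \<le> - \<lceil>real n / 2\<rceil> + 1 + int j"
      "- \<lceil>real n / 2\<rceil> + 1 + int j \<le> \<lfloor>real n / 2\<rfloor>" using j by (auto simp: half_sum)
    then have "real_of_int (- \<lceil>real n / 2\<rceil> + 1) \<le> of_int (- \<lceil>real n / 2\<rceil> + 1 + int j)"
      "real_of_int (- \<lceil>real n / 2\<rceil> + 1 + int j) \<le> of_int \<lfloor>real n / 2\<rfloor>"
      by (simp_all only: of_int_le_iff)
    then show "f j \<in> int_cell n" by (simp add: int_cell_def int_vecs_def f_def)
  qed
  ultimately have "card {..<n} \<le> card (int_cell n :: (real ^ 'd) set)"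
    by (intro card_inj_on_le[of f] finite_int_cell)
  then show ?thesis by simp
qed

locale torus =
  fixes A :: "real ^ 'd ^ 'd::finite" and n :: nat
  assumes invertible: "invertible A" and n_pos: "n \<ge> 1"
begin

abbreviation N :: nat where "N \<equiv> card (cell A n)"

lemma inj_A: "inj ((*v) A)"
  using invertible by (rule inj_matrix_vector_mult)

lemma finite_cell: "finite (cell A n)"
  by (simp add: cell_eq finite_int_cell)

lemma card_cell: "N = card (int_cell n :: (real ^ 'd) set)"
  unfolding cell_eq by (rule card_image) (rule inj_on_subset[OF inj_A], simp)

lemma n_le_card_cell: "n \<le> N"
  by (simp add: card_cell card_int_cell_ge)

lemma card_cell_pos: "1 \<le> N"
  using n_le_card_cell n_pos by simp

lemma cell_subset: "x \<in> cell A n \<Longrightarrow> x \<in> lattice_of A"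
  by (auto simp: cell_def lattice_of_def)

lemma zero_in_lattice: "0 \<in> lattice_of A"
  unfolding lattice_of_def by (rule image_eqI[of _ _ 0]) (simp_all add: int_vecs_def)

lemma lattice_diff: "x \<in> lattice_of A \<Longrightarrow> y \<in> lattice_of A \<Longrightarrow> x - y \<in> lattice_of A"
  unfolding lattice_of_def
  by (rule additive_image_diff) (rule matrix_vector_mult_diff_distrib, rule int_vecs_diff)

definition periods :: "(real ^ 'd) set" where
  "periods = (\<lambda>z. real n *\<^sub>R z) ` lattice_of A"

lemma periods_diff: "x \<in> periods \<Longrightarrow> y \<in> periods \<Longrightarrow> x - y \<in> periods"
  unfolding periods_def
  by (rule additive_image_diff) (rule scaleR_right_diff_distrib, rule lattice_diff)

lemma zero_in_periods: "0 \<in> periods"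
  unfolding periods_def by (rule image_eqI[of _ _ 0]) (simp_all add: zero_in_lattice)

lemma cell_unique:
  assumes "r \<in> cell A n" and "r' \<in> cell A n" and "r - r' \<in> periods"
  shows "r = r'"
proof -
  obtain z z' q where z: "r = A *v z" "z \<in> int_cell n" and z': "r' = A *v z'" "z' \<in> int_cell n"
    and q: "q \<in> int_vecs" "r - r' = real n *\<^sub>R (A *v q)"
    using assms by (auto simp: cell_eq periods_def lattice_of_def)
  have "A *v (z - z') = A *v (real n *\<^sub>R q)"
    using q(2) by (simp add: z z' matrix_vector_mult_diff_distrib matrix_vector_mult_scaleR)
  then have "z - z' = real n *\<^sub>R q" using inj_A by (simp add: inj_def)
  then show ?thesis using int_cell_unique[OF z(2) z'(2)] q(1) z z' by blast
qed

lemma wrap_eqI: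
  assumes "r \<in> cell A n" and "y - r \<in> periods"
  shows "wrap A n y = r"
  unfolding wrap_def periods_def[symmetric]
proof (rule the_equality)
  fix r' assume r': "r' \<in> cell A n \<and> y - r' \<in> periods"
  then have "(y - r) - (y - r') \<in> periods" using periods_diff[OF assms(2)] by blast
  moreover have "(y - r) - (y - r') = r' - r" by simp
  ultimately show "r' = r" using cell_unique[of r' r] r' assms(1) by metis
qed (use assms in simp)

lemma wrap_in_cell:
  assumes "y \<in> lattice_of A"
  shows "wrap A n y \<in> cell A n" and "y - wrap A n y \<in> periods"
proof -
  obtain z where z: "y = A *v z" "z \<in> int_vecs" using assms by (auto simp: lattice_of_def)
  obtain r q where r: "r \<in> int_cell n" "q \<in> int_vecs" "z - r = real n *\<^sub>R q"
    using int_cell_residue[OF n_pos z(2)] by blast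
  have cell: "A *v r \<in> cell A n" using r by (auto simp: cell_eq)
  have "y - A *v r = real n *\<^sub>R (A *v q)"
    unfolding z(1) matrix_vector_mult_diff_distrib[symmetric] r(3) by (rule matrix_vector_mult_scaleR)
  then have per: "y - A *v r \<in> periods" using r by (auto simp: periods_def lattice_of_def)
  show "wrap A n y \<in> cell A n" "y - wrap A n y \<in> periods"
    using wrap_eqI[OF cell per] cell per by auto
qed

lemma delta_in_cell: "x \<in> lattice_of A \<Longrightarrow> y \<in> lattice_of A \<Longrightarrow> delta A n x y \<in> cell A n"
  by (simp add: delta_def wrap_in_cell lattice_diff)

lemma delta_cell [simp]: "x \<in> cell A n \<Longrightarrow> y \<in> cell A n \<Longrightarrow> delta A n x y \<in> cell A n"
  by (simp add: delta_in_cell cell_subset)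

lemma zero_in_cell [simp]: "0 \<in> cell A n"
proof -
  have "real_of_int (- \<lceil>real n / 2\<rceil> + 1) \<le> of_int 0" "real_of_int 0 \<le> of_int \<lfloor>real n / 2\<rfloor>"
    unfolding of_int_le_iff using n_pos by linarith+
  then have "0 \<in> (int_cell n :: (real ^ 'd) set)" by (simp add: int_cell_def int_vecs_def)
  then show ?thesis unfolding cell_eq by (rule rev_image_eqI) simp
qed

lemma delta_zero [simp]: "y \<in> cell A n \<Longrightarrow> delta A n 0 y = y"
  by (simp add: delta_def wrap_eqI zero_in_periods)

lemma delta_self [simp]: "delta A n x x = 0"
  by (simp add: delta_def wrap_eqI zero_in_periods)

text \<open>The errors that the three roundings into the cell cause are periods, and so is their
  combination. This is the translation invariance on which the storage of factors relies.\<close>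

lemma delta_shift [simp]:
  assumes "a \<in> cell A n" and "b \<in> cell A n" and "c \<in> cell A n"
  shows "delta A n (delta A n c a) (delta A n c b) = delta A n a b"
proof -
  have L: "a \<in> lattice_of A" "b \<in> lattice_of A" "c \<in> lattice_of A"
    using assms by (auto simp: cell_subset)
  note per = wrap_in_cell(2)[OF lattice_diff]
  have "((b - a) - delta A n a b) - ((b - c) - delta A n c b)
      - (0 - ((a - c) - delta A n c a)) \<in> periods"
    using periods_diff[OF periods_diff[OF per[OF L(2,1)] per[OF L(2,3)]]
        periods_diff[OF zero_in_periods per[OF L(1,3)]]]
    by (simp only: delta_def)
  then have "(delta A n c b - delta A n c a) - delta A n a b \<in> periods"
    by (simp add: algebra_simps)
  then show ?thesis
    using wrap_eqI[of "delta A n a b"] assms by (simp add: delta_def[of A n "delta A n c a"])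
qed

lemma bij_delta:
  assumes "c \<in> cell A n"
  shows "bij_betw (delta A n c) (cell A n) (cell A n)"
proof -
  have "inj_on (delta A n c) (cell A n)"
  proof (rule inj_onI)
    fix a b assume ab: "a \<in> cell A n" "b \<in> cell A n" "delta A n c a = delta A n c b"
    have "delta A n 0 a = delta A n (delta A n c 0) (delta A n c a)"
      by (rule delta_shift[symmetric, OF zero_in_cell ab(1) assms])
    also have "\<dots> = delta A n 0 b"
      unfolding ab(3) by (rule delta_shift[OF zero_in_cell ab(2) assms])
    finally show "a = b" by (simp only: delta_zero ab)
  qed
  moreover have "delta A n c ` cell A n \<subseteq> cell A n"
    by (rule image_subsetI) (rule delta_cell[OF assms])
  ultimately show ?thesis
    unfolding bij_betw_def by (intro conjI endo_inj_surj finite_cell)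
qed

definition "grid_rel = {(k, k'). k \<in> (\<lambda>k. (1 / real n) *\<^sub>R k) ` dual_lattice A \<and>
  k' \<in> (\<lambda>k. (1 / real n) *\<^sub>R k) ` dual_lattice A \<and> k - k' \<in> dual_lattice A}"

lemma momentum_grid_eq:
  "momentum_grid A n = (\<lambda>k. (1 / real n) *\<^sub>R k) ` dual_lattice A // grid_rel"
  by (simp add: momentum_grid_def grid_rel_def)

lemma dual_lattice_diff: "x \<in> dual_lattice A \<Longrightarrow> y \<in> dual_lattice A \<Longrightarrow> x - y \<in> dual_lattice A"
  unfolding dual_lattice_def
  by (rule additive_image_diff) (rule matrix_vector_mult_diff_distrib, rule int_vecs_diff)

lemma zero_in_dual_lattice: "0 \<in> dual_lattice A"
  unfolding dual_lattice_def by (rule image_eqI[of _ _ 0]) (simp_all add: int_vecs_def)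

lemma equiv_grid_rel: "equiv ((\<lambda>k. (1 / real n) *\<^sub>R k) ` dual_lattice A) grid_rel"
proof (rule equivI)
  show "grid_rel \<subseteq> (\<lambda>k. (1 / real n) *\<^sub>R k) ` dual_lattice A \<times> (\<lambda>k. (1 / real n) *\<^sub>R k) ` dual_lattice A"
    by (auto simp: grid_rel_def)
  show "refl_on ((\<lambda>k. (1 / real n) *\<^sub>R k) ` dual_lattice A) grid_rel"
    by (auto simp: refl_on_def grid_rel_def zero_in_dual_lattice)
  show "sym grid_rel"
    using dual_lattice_diff[OF zero_in_dual_lattice]
    by (fastforce simp: sym_def grid_rel_def)
  show "trans grid_rel"
  proof (rule transI)
    fix x y z assume xy: "(x, y) \<in> grid_rel" and yz: "(y, z) \<in> grid_rel"
    have "x - y \<in> dual_lattice A" "y - z \<in> dual_lattice A"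
      using xy yz by (simp_all add: grid_rel_def)
    from dual_lattice_diff[OF this(1) dual_lattice_diff[OF zero_in_dual_lattice this(2)]]
    have "x - z \<in> dual_lattice A" by simp
    then show "(x, z) \<in> grid_rel" using xy yz by (simp add: grid_rel_def)
  qed
qed

lemma grid_class:
  assumes "\<kappa> \<in> momentum_grid A n"
  shows "\<kappa> \<noteq> {}" and "k \<in> \<kappa> \<Longrightarrow> k' \<in> \<kappa> \<Longrightarrow> k - k' \<in> dual_lattice A"
proof -
  note \<kappa> = assms[unfolded momentum_grid_eq]
  show "\<kappa> \<noteq> {}" using in_quotient_imp_non_empty[OF equiv_grid_rel \<kappa>] .
  assume "k \<in> \<kappa>" "k' \<in> \<kappa>"
  then have "(k, k') \<in> grid_rel"
    using quotient_eqI[OF equiv_grid_rel \<kappa> \<kappa>] quotient_eq_iff[OF equiv_grid_rel \<kappa> \<kappa>] by blast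
  then show "k - k' \<in> dual_lattice A" by (simp add: grid_rel_def)
qed

text \<open>In the coordinates of the reciprocal basis, multiplied by \<open>n\<close>, the grid is the set of residue
  classes of integer vectors modulo \<open>n\<close>, each of which meets the integer cell.\<close>

lemma finite_momentum_grid: "finite (momentum_grid A n)"
  and card_momentum_grid: "card (momentum_grid A n) \<le> N"
proof -
  define B where "B = matrix_inv (transpose A)"
  define cl where "cl z = grid_rel `` {(1 / real n) *\<^sub>R (B *v z)}" for z
  have "momentum_grid A n \<subseteq> cl ` int_cell n"
  proof
    fix \<kappa> assume "\<kappa> \<in> momentum_grid A n"
    then obtain z where z: "z \<in> int_vecs" "\<kappa> = cl z"
      by (auto simp: momentum_grid_eq quotient_def dual_lattice_def cl_def B_def)
    obtain r q where r: "r \<in> int_cell n" "q \<in> int_vecs" "z - r = real n *\<^sub>R q"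
      using int_cell_residue[OF n_pos z(1)] by blast
    have "(1 / real n) *\<^sub>R (B *v z) - (1 / real n) *\<^sub>R (B *v r) = B *v q"
      unfolding scaleR_right_diff_distrib[symmetric] matrix_vector_mult_diff_distrib[symmetric] r(3)
        matrix_vector_mult_scaleR
      using n_pos by simp
    then have "((1 / real n) *\<^sub>R (B *v z), (1 / real n) *\<^sub>R (B *v r)) \<in> grid_rel"
      using z r by (auto simp: grid_rel_def dual_lattice_def B_def int_cell_def)
    then have "\<kappa> = cl r"
      unfolding z cl_def by (rule equiv_class_eq[OF equiv_grid_rel])
    then show "\<kappa> \<in> cl ` int_cell n" using r(1) by blast
  qed
  then show "finite (momentum_grid A n)" "card (momentum_grid A n) \<le> N"
    unfolding card_cell
    by (rule finite_subset[OF _ finite_imageI[OF finite_int_cell]],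
        rule surj_card_le[OF finite_int_cell])
qed

text \<open>The inner product of a lattice vector and a reciprocal lattice vector is an integer. So the
  Fourier instruction may pick any representative of a grid class.\<close>

lemma phase_eq_of_grid_class:
  assumes "\<kappa> \<in> momentum_grid A n" and "k \<in> \<kappa>" and "k' \<in> \<kappa>" and "y \<in> cell A n"
  shows "phase k y = phase k' y"
proof -
  obtain z where z: "y = A *v z" "z \<in> int_vecs" using assms(4) by (auto simp: cell_eq int_cell_def)
  obtain w where w: "k - k' = matrix_inv (transpose A) *v w" "w \<in> int_vecs"
    using grid_class(2)[OF assms(1-3)] by (auto simp: dual_lattice_def)
  let ?B = "matrix_inv (transpose A)"
  have "invertible (transpose A)" using invertible
    by (metis invertible_def matrix_transpose_mul transpose_mat)
  then have "transpose A ** ?B = mat 1"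
    unfolding invertible_def matrix_inv_def by (rule someI2_ex) blast
  then have "transpose A *v (?B *v w) = w"
    by (simp only: matrix_vector_mul_assoc matrix_vector_mul_lid)
  moreover have "y \<bullet> (k - k') = z \<bullet> (transpose A *v (?B *v w))"
    unfolding z(1) w(1) dot_lmul_matrix[symmetric] vector_transpose_matrix ..
  ultimately have "y \<bullet> (k - k') = z \<bullet> w" by simp
  also have "z \<bullet> w \<in> \<int>"
    using z(2) w(2) by (auto simp: inner_vec_def int_vecs_def intro!: Ints_sum Ints_mult)
  finally have int: "- (y \<bullet> (k - k')) \<in> \<int>" by simp
  have "phase k y = cis (- 2 * pi * (y \<bullet> k')) * cis (2 * pi * (- (y \<bullet> (k - k'))))"
    by (simp add: phase_def cis_mult inner_diff_right algebra_simps)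
  also have "\<dots> = phase k' y" using cis_multiple_2pi[OF int] by (simp add: phase_def)
  finally show ?thesis .
qed

lemma phase_zero [simp]: "phase k 0 = 1"
  by (simp add: phase_def)

end

section \<open>Straight-line programs\<close>

text \<open>The order in which a loop runs through its index set is irrelevant, hence an arbitrary one.\<close>

definition enum :: "'a set \<Rightarrow> 'a list" where
  "enum S = (SOME xs. set xs = S \<and> distinct xs)"

lemma
  assumes "finite S"
  shows set_enum: "set (enum S) = S" and distinct_enum: "distinct (enum S)"
proof -
  have "set (enum S) = S \<and> distinct (enum S)"
    unfolding enum_def by (rule someI_ex) (rule finite_distinct_list[OF assms])
  then show "set (enum S) = S" "distinct (enum S)" by auto
qed

lemma length_enum: "finite S \<Longrightarrow> length (enum S) = card S"
  by (metis distinct_card distinct_enum set_enum)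

lemma sum_list_enum: "finite S \<Longrightarrow> (\<Sum>x\<leftarrow>enum S. f x) = sum f S"
  by (simp add: sum_list_distinct_conv_sum_set distinct_enum set_enum)

lemma run_Nil [simp]: "run A n inp [] \<sigma> = \<sigma>"
  and run_Cons [simp]: "run A n inp (c # P) \<sigma> = run A n inp P (exec A n inp c \<sigma>)"
  and run_append [simp]: "run A n inp (P @ Q) \<sigma> = run A n inp Q (run A n inp P \<sigma>)"
  by (simp_all add: run_def)

text \<open>All values are computed from registers that the loop leaves alone, so no round spoils the work
  of another one. The registers \<open>X\<close> are scratch space.\<close>

lemma run_loop:
  assumes "\<And>b \<sigma> a. b \<in> set bs \<Longrightarrow> a \<in> W b \<Longrightarrow> run A n inp (P b) \<sigma> (r a) = f a \<sigma>"
    and "\<And>b \<sigma> q. b \<in> set bs \<Longrightarrow> q \<notin> r ` W b \<union> X \<Longrightarrow> run A n inp (P b) \<sigma> q = \<sigma> q"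
    and "inj_on r (\<Union>b\<in>set bs. W b)"
    and "X \<inter> r ` (\<Union>b\<in>set bs. W b) = {}"
    and "\<And>a (\<sigma> :: nat \<Rightarrow> complex) \<sigma>'. a \<in> (\<Union>b\<in>set bs. W b) \<Longrightarrow>
      (\<And>q. q \<notin> r ` (\<Union>b\<in>set bs. W b) \<union> X \<Longrightarrow> \<sigma> q = \<sigma>' q) \<Longrightarrow> f a \<sigma> = f a \<sigma>'"
  shows "(\<forall>a \<in> (\<Union>b\<in>set bs. W b). run A n inp (concat (map P bs)) \<sigma> (r a) = f a \<sigma>) \<and>
    (\<forall>q. q \<notin> r ` (\<Union>b\<in>set bs. W b) \<union> X \<longrightarrow> run A n inp (concat (map P bs)) \<sigma> q = \<sigma> q)"
  using assms
proof (induction bs rule: rev_induct)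
  case Nil
  show ?case by simp
next
  case (snoc b bs)
  let ?W = "\<Union>b\<in>set bs. W b"
  let ?\<tau> = "run A n inp (concat (map P bs)) \<sigma>"
  have sub: "?W \<subseteq> (\<Union>b\<in>set (bs @ [b]). W b)" "W b \<subseteq> (\<Union>b\<in>set (bs @ [b]). W b)" by auto
  have IH: "(\<forall>a \<in> ?W. ?\<tau> (r a) = f a \<sigma>) \<and> (\<forall>q. q \<notin> r ` ?W \<union> X \<longrightarrow> ?\<tau> q = \<sigma> q)"
  proof (rule snoc.IH)
    show "inj_on r ?W" using snoc.prems(3) sub(1) by (rule inj_on_subset)
    show "X \<inter> r ` ?W = {}" using snoc.prems(4) sub(1) by blast
    fix a and \<sigma> \<sigma>' :: "nat \<Rightarrow> complex" assume a: "a \<in> ?W" and eq: "\<And>q. q \<notin> r ` ?W \<union> X \<Longrightarrow> \<sigma> q = \<sigma>' q"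
    show "f a \<sigma> = f a \<sigma>'"
    proof (rule snoc.prems(5))
      show "a \<in> (\<Union>b\<in>set (bs @ [b]). W b)" using a sub(1) by blast
      fix q assume "q \<notin> r ` (\<Union>b\<in>set (bs @ [b]). W b) \<union> X"
      then have "q \<notin> r ` ?W \<union> X" by auto
      then show "\<sigma> q = \<sigma>' q" by (rule eq)
    qed
  qed (use snoc.prems(1,2) in simp_all)
  have run: "run A n inp (concat (map P (bs @ [b]))) \<sigma> = run A n inp (P b) ?\<tau>" by simp
  show ?case
    unfolding run
  proof (intro conjI ballI allI impI)
    fix a assume a: "a \<in> (\<Union>b\<in>set (bs @ [b]). W b)"
    show "run A n inp (P b) ?\<tau> (r a) = f a \<sigma>"
    proof (cases "a \<in> W b")
      case True
      have "f a ?\<tau> = f a \<sigma>"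
      proof (rule snoc.prems(5)[OF a])
        fix q assume "q \<notin> r ` (\<Union>b\<in>set (bs @ [b]). W b) \<union> X"
        then have "q \<notin> r ` ?W \<union> X" by auto
        then show "?\<tau> q = \<sigma> q" using IH by blast
      qed
      then show ?thesis using snoc.prems(1)[of b a ?\<tau>] True by simp
    next
      case False
      then have aW: "a \<in> ?W" using a by auto
      have "r a \<notin> r ` W b" using inj_onD[OF snoc.prems(3) _ a] sub(2) False by blast
      moreover have "r a \<notin> X" using snoc.prems(4) a by blast
      moreover have "?\<tau> (r a) = f a \<sigma>" using IH aW by blast
      ultimately show ?thesis using snoc.prems(2)[of b "r a" ?\<tau>] by simp
    qed
  next
    fix q assume "q \<notin> r ` (\<Union>b\<in>set (bs @ [b]). W b) \<union> X"
    then have q: "q \<notin> r ` W b \<union> X" "q \<notin> r ` ?W \<union> X" by auto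
    have "run A n inp (P b) ?\<tau> q = ?\<tau> q" using q(1) by (intro snoc.prems(2)) simp_all
    also have "\<dots> = \<sigma> q" using IH q(2) by blast
    finally show "run A n inp (P b) ?\<tau> q = \<sigma> q" .
  qed
qed

definition product_prog :: "nat \<Rightarrow> nat list \<Rightarrow> ('i, 'x) instr list" where
  "product_prog r rs = Const r 1 # map (Mult r r) rs"

lemma run_product_prog:
  assumes "r \<notin> set rs"
  shows "run A n inp (product_prog r rs) \<sigma> = \<sigma>(r := (\<Prod>a\<leftarrow>rs. \<sigma> a))"
proof -
  have "run A n inp (map (Mult r r) rs) \<tau> = \<tau>(r := \<tau> r * (\<Prod>a\<leftarrow>rs. \<tau> a))" for \<tau>
    using assms
  proof (induction rs arbitrary: \<tau>)
    case (Cons a rs)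
    define \<tau>' where "\<tau>' = \<tau>(r := \<tau> r * \<tau> a)"
    have "map \<tau>' rs = map \<tau> rs" using Cons.prems by (intro map_cong) (auto simp: \<tau>'_def)
    moreover have "run A n inp (map (Mult r r) (a # rs)) \<tau> = run A n inp (map (Mult r r) rs) \<tau>'"
      by (simp add: \<tau>'_def)
    moreover have "run A n inp (map (Mult r r) rs) \<tau>' = \<tau>'(r := \<tau>' r * (\<Prod>a\<leftarrow>rs. \<tau>' a))"
      using Cons.prems by (intro Cons.IH) simp
    ultimately have "run A n inp (map (Mult r r) (a # rs)) \<tau> = \<tau>'(r := \<tau>' r * (\<Prod>a\<leftarrow>rs. \<tau> a))"
      by (simp only:)
    then show ?case by (simp only:) (simp add: \<tau>'_def mult.assoc)
  qed simp
  then have "run A n inp (product_prog r rs) \<sigma> = \<sigma>(r := (\<Prod>a\<leftarrow>rs. (\<sigma>(r := 1)) a))"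
    by (simp add: product_prog_def)
  moreover have "map (\<sigma>(r := 1)) rs = map \<sigma> rs" using assms by (intro map_cong) auto
  ultimately show ?thesis by (simp only:)
qed

lemma run_sum_of_products:
  assumes "r \<noteq> acc" and "\<And>z. z \<in> set zs \<Longrightarrow> acc \<notin> set (rs z) \<and> r \<notin> set (rs z)"
  shows "run A n inp (concat (map (\<lambda>z. product_prog acc (rs z) @ [Add r r acc]) zs)) \<sigma> r
      = \<sigma> r + (\<Sum>z\<leftarrow>zs. \<Prod>a\<leftarrow>rs z. \<sigma> a) \<and>
    (\<forall>q. q \<noteq> r \<longrightarrow> q \<noteq> acc \<longrightarrow>
      run A n inp (concat (map (\<lambda>z. product_prog acc (rs z) @ [Add r r acc]) zs)) \<sigma> q = \<sigma> q)"
  using assms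
proof (induction zs arbitrary: \<sigma>)
  case (Cons z zs)
  define p where "p = (\<Prod>a\<leftarrow>rs z. \<sigma> a)"
  define \<tau> where "\<tau> = \<sigma>(acc := p, r := \<sigma> r + p)"
  have "run A n inp (product_prog acc (rs z) @ [Add r r acc]) \<sigma> = \<tau>"
    using Cons.prems by (simp add: run_product_prog \<tau>_def p_def)
  then have run: "run A n inp (concat (map (\<lambda>z. product_prog acc (rs z) @ [Add r r acc]) (z # zs))) \<sigma>
      = run A n inp (concat (map (\<lambda>z. product_prog acc (rs z) @ [Add r r acc]) zs)) \<tau>"
    by simp
  have "(\<Prod>a\<leftarrow>rs z'. \<tau> a) = (\<Prod>a\<leftarrow>rs z'. \<sigma> a)" if "z' \<in> set zs" for z'
    using Cons.prems(2)[of z'] that by (intro arg_cong[of _ _ prod_list] map_cong) (auto simp: \<tau>_def)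
  then have "(\<Sum>z\<leftarrow>zs. \<Prod>a\<leftarrow>rs z. \<tau> a) = (\<Sum>z\<leftarrow>zs. \<Prod>a\<leftarrow>rs z. \<sigma> a)"
    by (intro arg_cong[of _ _ sum_list] map_cong) auto
  moreover have "\<tau> r = \<sigma> r + p" "\<And>q. q \<noteq> r \<Longrightarrow> q \<noteq> acc \<Longrightarrow> \<tau> q = \<sigma> q" by (auto simp: \<tau>_def)
  ultimately show ?case
    unfolding run using Cons.IH[of \<tau>] Cons.prems by (simp add: p_def)
qed simp


section \<open>Storing factors up to translation\<close>

datatype ('v, 'e) source = Edge 'e | Momentum | Message 'v

text \<open>A table holds the values of one factor at the configurations that place the vertex \<open>pin\<close> at
  \<open>0\<close>; by translation invariance these determine all others.\<close>

datatype ('v, 'e) table = Table (source: "('v, 'e) source") (pin: 'v) (scope: "'v set")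

text \<open>The storage of the programs by purpose: the table entries, one accumulator, the two operands of
  a convolution, and the values on the momentum grid. Register numbers are assigned at the end.\<close>

datatype ('v, 'e, 'x) slot =
  Entry "('v, 'e) source" "'v \<Rightarrow> 'x" | Accumulator | Left 'x | Right 'x | Output "'x set"

definition pinned_configs :: "real ^ 'd ^ 'd::finite \<Rightarrow> nat \<Rightarrow> 'v set \<Rightarrow> 'v set \<Rightarrow> ('v \<Rightarrow> real ^ 'd) set" where
  "pinned_configs A n D U = (\<Pi>\<^sub>E w\<in>U. if w \<in> D then {0} else cell A n)"

abbreviation entries :: "real ^ 'd ^ 'd::finite \<Rightarrow> nat \<Rightarrow> ('v, 'e) table \<Rightarrow> ('v \<Rightarrow> real ^ 'd) set" where
  "entries A n T \<equiv> pinned_configs A n {pin T} (scope T)"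

text \<open>The table entry that represents a configuration: its translate with the pin at \<open>0\<close>.\<close>

definition normal ::
  "real ^ 'd ^ 'd::finite \<Rightarrow> nat \<Rightarrow> ('v, 'e) table \<Rightarrow> ('v \<Rightarrow> real ^ 'd) \<Rightarrow> 'v \<Rightarrow> real ^ 'd" where
  "normal A n T x = restrict (\<lambda>w. delta A n (x (pin T)) (x w)) (scope T)"

definition reg ::
  "real ^ 'd ^ 'd::finite \<Rightarrow> nat \<Rightarrow> (('v, 'e, real ^ 'd) slot \<Rightarrow> nat) \<Rightarrow> ('v, 'e) table
     \<Rightarrow> ('v \<Rightarrow> real ^ 'd) \<Rightarrow> nat" where
  "reg A n adr T x = adr (Entry (source T) (normal A n T x))"

definition well_pinned :: "('v, 'e) table \<Rightarrow> bool" where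
  "well_pinned T \<longleftrightarrow> finite (scope T) \<and> (scope T \<noteq> {} \<longrightarrow> pin T \<in> scope T)"

definition scratch :: "real ^ 'd ^ 'd::finite \<Rightarrow> nat \<Rightarrow> ('v, 'e, real ^ 'd) slot set" where
  "scratch A n = {Accumulator} \<union> Left ` cell A n \<union> Right ` cell A n"

definition slots ::
  "real ^ 'd ^ 'd::finite \<Rightarrow> nat \<Rightarrow> ('v, 'e) table set \<Rightarrow> ('v, 'e, real ^ 'd) slot set" where
  "slots A n H = (\<Union>T\<in>H. Entry (source T) ` entries A n T) \<union> scratch A n \<union> Output ` momentum_grid A n"

context torus
begin

lemma finite_pinned_configs: "finite U \<Longrightarrow> finite (pinned_configs A n D U)"
  unfolding pinned_configs_def by (rule finite_PiE) (auto simp: finite_cell)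

lemma card_pinned_configs:
  assumes "finite U"
  shows "card (pinned_configs A n D U) = N ^ card (U - D)"
proof -
  have "card (pinned_configs A n D U) = (\<Prod>w\<in>U. if w \<in> D then 1 else N)"
    unfolding pinned_configs_def card_PiE[OF assms] by (rule prod.cong) auto
  also have "\<dots> = N ^ card (U - D)"
    using assms by (simp add: prod.If_cases Diff_eq)
  finally show ?thesis .
qed

lemma card_entries: "well_pinned T \<Longrightarrow> card (entries A n T) = N ^ (card (scope T) - 1)"
  by (cases "scope T = {}") (simp_all add: card_pinned_configs well_pinned_def)

lemma pinned_configs_in_cell: "x \<in> pinned_configs A n D U \<Longrightarrow> w \<in> U \<Longrightarrow> x w \<in> cell A n"
  by (auto simp: pinned_configs_def PiE_iff split: if_splits dest!: bspec)

lemma normal_in_entries: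
  assumes "well_pinned T" and "\<And>w. w \<in> scope T \<Longrightarrow> x w \<in> cell A n"
  shows "normal A n T x \<in> entries A n T"
  using assms by (auto simp: normal_def pinned_configs_def well_pinned_def)

text \<open>Configurations that differ by a translation are represented by the same entry of a table.\<close>

lemma normal_shift:
  assumes "well_pinned T" and "c \<in> cell A n" and "\<And>w. w \<in> scope T \<Longrightarrow> x w \<in> cell A n"
    and "\<And>w. w \<in> scope T \<Longrightarrow> x' w = delta A n c (x w)"
  shows "normal A n T x' = normal A n T x"
  unfolding normal_def
proof (rule restrict_ext)
  fix w assume w: "w \<in> scope T"
  then have "pin T \<in> scope T" using assms(1) by (auto simp: well_pinned_def)
  then show "delta A n (x' (pin T)) (x' w) = delta A n (x (pin T)) (x w)"
    using assms w by simp
qed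

lemma normal_cong:
  assumes "well_pinned T" and "\<And>w. w \<in> scope T \<Longrightarrow> x' w = x w"
  shows "normal A n T x' = normal A n T x"
  using assms by (auto simp: normal_def well_pinned_def intro!: restrict_ext)

lemma finite_slots:
  assumes "finite H" and "\<And>T. T \<in> H \<Longrightarrow> well_pinned T"
  shows "finite (slots A n H :: ('v, 'e, real ^ 'd) slot set)"
  using assms
  by (auto simp: slots_def scratch_def finite_cell finite_momentum_grid well_pinned_def
      intro!: finite_imageI finite_pinned_configs)

text \<open>A table of scope \<open>U\<close> has one entry for each placement of the vertices of \<open>U\<close> other than the pin.
  The arrays have at most \<open>N\<close> entries, which is within the bound because of \<open>2 \<le> d\<close>.\<close>

lemma card_slots:
  fixes H :: "('v, 'e) table set"
  assumes "finite H" and "\<And>T. T \<in> H \<Longrightarrow> well_pinned T \<and> card (scope T) \<le> d" and "2 \<le> d"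
  shows "card (slots A n H) \<le> (card H + 4) * N ^ (d - 1)"
proof -
  have mono: "N ^ i \<le> N ^ (d - 1)" if "i \<le> d - 1" for i
    using that card_cell_pos by (intro power_increasing) auto
  have N1: "N \<le> N ^ (d - 1)" "1 \<le> N ^ (d - 1)" using mono[of 1] mono[of 0] assms(3) by auto
  have "card (\<Union>T\<in>H. Entry (source T) ` entries A n T :: ('v, 'e, real ^ 'd) slot set)
      \<le> (\<Sum>T\<in>H. card (Entry (source T) ` entries A n T :: ('v, 'e, real ^ 'd) slot set))"
    using assms(1) by (rule card_UN_le)
  also have "\<dots> \<le> (\<Sum>T\<in>H. N ^ (d - 1))"
  proof (rule sum_mono)
    fix T assume T: "T \<in> H"
    have "card (Entry (source T) ` entries A n T :: ('v, 'e, real ^ 'd) slot set) \<le> card (entries A n T)"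
      using assms(2)[OF T] by (intro card_image_le finite_pinned_configs) (simp add: well_pinned_def)
    also have "\<dots> \<le> N ^ (d - 1)"
    proof -
      have "card (scope T) - 1 \<le> d - 1" using assms(2)[OF T] by (intro diff_le_mono) simp
      then show ?thesis using assms(2)[OF T] mono by (simp only: card_entries)
    qed
    finally show "card (Entry (source T) ` entries A n T :: ('v, 'e, real ^ 'd) slot set) \<le> N ^ (d - 1)" .
  qed
  finally have 1: "card (\<Union>T\<in>H. Entry (source T) ` entries A n T :: ('v, 'e, real ^ 'd) slot set)
      \<le> card H * N ^ (d - 1)" by simp
  have "card (scratch A n :: ('v, 'e, real ^ 'd) slot set)
      \<le> card {Accumulator :: ('v, 'e, real ^ 'd) slot} + card (Left ` cell A n :: ('v, 'e, real ^ 'd) slot set)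
        + card (Right ` cell A n :: ('v, 'e, real ^ 'd) slot set)"
    unfolding scratch_def by (intro order_trans[OF card_Un_le] add_mono order_refl card_Un_le)
  also have "\<dots> \<le> 1 + N + N"
    by (intro add_mono card_image_le finite_cell) simp
  finally have 2: "card (scratch A n :: ('v, 'e, real ^ 'd) slot set) \<le> 1 + N + N" .
  have 3: "card (Output ` momentum_grid A n :: ('v, 'e, real ^ 'd) slot set) \<le> N"
    using card_image_le[OF finite_momentum_grid] card_momentum_grid by (rule order_trans)
  have "card (slots A n H) \<le> card H * N ^ (d - 1) + (1 + N + N) + N"
    unfolding slots_def using 1 2 3
    by (intro order_trans[OF card_Un_le] add_mono order_refl) auto
  also have "\<dots> \<le> card H * N ^ (d - 1) + 4 * N ^ (d - 1)" using N1 by linarith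
  finally show ?thesis by (simp add: algebra_simps)
qed

end

section \<open>Eliminating one vertex\<close>

lemma prod_list_partition:
  fixes f :: "'a \<Rightarrow> 'b::comm_monoid_mult"
  shows "(\<Prod>x\<leftarrow>xs. f x) = (\<Prod>x\<leftarrow>filter Q xs. f x) * (\<Prod>x\<leftarrow>filter (\<lambda>x. \<not> Q x) xs. f x)"
  by (induction xs) (auto simp: ac_simps)

lemma prod_list_cong:
  assumes "\<And>x. x \<in> set xs \<Longrightarrow> f x = g x"
  shows "(\<Prod>x\<leftarrow>xs. f x) = (\<Prod>x\<leftarrow>xs. g x)"
  using assms by (intro arg_cong[of _ _ prod_list] map_cong) auto

text \<open>The message of the bucket \<open>B\<close>, as a function of the memory that holds the tables.\<close>

definition bucket_sum ::
  "real ^ 'd ^ 'd::finite \<Rightarrow> nat \<Rightarrow> (('v, 'e, real ^ 'd) slot \<Rightarrow> nat) \<Rightarrow> ('v, 'e) table list \<Rightarrow> 'v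
     \<Rightarrow> ('v \<Rightarrow> real ^ 'd) \<Rightarrow> (nat \<Rightarrow> complex) \<Rightarrow> complex" where
  "bucket_sum A n adr B v y \<sigma> = (\<Sum>z\<in>cell A n. \<Prod>T\<leftarrow>B. \<sigma> (reg A n adr T (y(v := z))))"

definition direct_block ::
  "real ^ 'd ^ 'd::finite \<Rightarrow> nat \<Rightarrow> (('v, 'e, real ^ 'd) slot \<Rightarrow> nat) \<Rightarrow> ('v, 'e) table list \<Rightarrow> 'v
     \<Rightarrow> nat \<Rightarrow> ('v \<Rightarrow> real ^ 'd) \<Rightarrow> ('i, real ^ 'd) instr list" where
  "direct_block A n adr B v r y = Const r 0 # concat (map (\<lambda>z.
     product_prog (adr Accumulator) (map (\<lambda>T. reg A n adr T (y(v := z))) B)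
       @ [Add r r (adr Accumulator)]) (enum (cell A n)))"

definition direct_prog ::
  "real ^ 'd ^ 'd::finite \<Rightarrow> nat \<Rightarrow> (('v, 'e, real ^ 'd) slot \<Rightarrow> nat) \<Rightarrow> ('v, 'e) table list \<Rightarrow> 'v
     \<Rightarrow> ('v, 'e) table \<Rightarrow> ('i, real ^ 'd) instr list" where
  "direct_prog A n adr B v T =
     concat (map (\<lambda>y. direct_block A n adr B v (adr (Entry (source T) y)) y) (enum (entries A n T)))"

text \<open>The left operand collects the factors without \<open>u\<close>. The right operand collects the others,
  evaluated with \<open>v\<close> at \<open>0\<close> and \<open>u\<close> at the displacement \<open>z\<close>. The configuration \<open>y\<close> fixes the variables
  other than \<open>u\<close> and \<open>v\<close>.\<close>

definition conv_block ::
  "real ^ 'd ^ 'd::finite \<Rightarrow> nat \<Rightarrow> (('v, 'e, real ^ 'd) slot \<Rightarrow> nat) \<Rightarrow> ('v, 'e) table list \<Rightarrow> 'v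
     \<Rightarrow> 'v \<Rightarrow> ('v, 'e) table \<Rightarrow> ('v \<Rightarrow> real ^ 'd) \<Rightarrow> ('i, real ^ 'd) instr list" where
  "conv_block A n adr B v u T y =
     concat (map (\<lambda>z. product_prog (adr (Left z))
       (map (\<lambda>T'. reg A n adr T' (y(v := z))) (filter (\<lambda>T'. \<not> u \<in> scope T') B))) (enum (cell A n))) @
     concat (map (\<lambda>z. product_prog (adr (Right z))
       (map (\<lambda>T'. reg A n adr T' ((\<lambda>_. 0)(u := z))) (filter (\<lambda>T'. u \<in> scope T') B))) (enum (cell A n))) @
     [Convolve (\<lambda>x. adr (Entry (source T) (y(u := x)))) (\<lambda>z. adr (Left z)) (\<lambda>z. adr (Right z))]"

definition conv_prog ::
  "real ^ 'd ^ 'd::finite \<Rightarrow> nat \<Rightarrow> (('v, 'e, real ^ 'd) slot \<Rightarrow> nat) \<Rightarrow> ('v, 'e) table list \<Rightarrow> 'v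
     \<Rightarrow> 'v \<Rightarrow> ('v, 'e) table \<Rightarrow> ('i, real ^ 'd) instr list" where
  "conv_prog A n adr B v u T =
     concat (map (conv_block A n adr B v u T) (enum (pinned_configs A n {pin T, u} (scope T))))"

locale machine = torus A n
  for A :: "real ^ 'd ^ 'd::finite" and n +
  fixes adr :: "('v, 'e, real ^ 'd) slot \<Rightarrow> nat" and H :: "('v, 'e) table set"
    and inp :: "'i \<Rightarrow> complex"
  assumes inj_adr: "inj_on adr (slots A n H)"
begin

abbreviation exe :: "('i, real ^ 'd) instr list \<Rightarrow> (nat \<Rightarrow> complex) \<Rightarrow> nat \<Rightarrow> complex" where
  "exe \<equiv> run A n inp"

lemma adr_mem_iff: "a \<in> slots A n H \<Longrightarrow> S \<subseteq> slots A n H \<Longrightarrow> adr a \<in> adr ` S \<longleftrightarrow> a \<in> S"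
  by (rule inj_on_image_mem_iff[OF inj_adr])

lemma adr_eq_iff: "a \<in> slots A n H \<Longrightarrow> b \<in> slots A n H \<Longrightarrow> adr a = adr b \<longleftrightarrow> a = b"
  by (rule inj_on_eq_iff[OF inj_adr])

lemma entries_slots: "T \<in> H \<Longrightarrow> Entry (source T) ` entries A n T \<subseteq> slots A n H"
  and scratch_slots: "scratch A n \<subseteq> slots A n H"
  by (auto simp: slots_def)

lemma scratch_members:
  "Accumulator \<in> scratch A n" "z \<in> cell A n \<Longrightarrow> Left z \<in> scratch A n"
  "z \<in> cell A n \<Longrightarrow> Right z \<in> scratch A n"
  by (auto simp: scratch_def)

lemma array_run:
  assumes "\<And>z. z \<in> cell A n \<Longrightarrow> c z \<in> slots A n H" and "inj_on c (cell A n)"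
    and "\<And>z a. z \<in> cell A n \<Longrightarrow> a \<in> set (rs z) \<Longrightarrow> a \<notin> adr ` c ` cell A n"
  shows "(\<forall>z\<in>cell A n. exe (concat (map (\<lambda>z. product_prog (adr (c z)) (rs z)) (enum (cell A n)))) \<sigma> (adr (c z))
      = (\<Prod>a\<leftarrow>rs z. \<sigma> a)) \<and>
    (\<forall>q. q \<notin> adr ` c ` cell A n \<longrightarrow>
      exe (concat (map (\<lambda>z. product_prog (adr (c z)) (rs z)) (enum (cell A n)))) \<sigma> q = \<sigma> q)"
proof -
  let ?P = "\<lambda>z. product_prog (adr (c z)) (rs z)"
  have eq: "(\<Union>z\<in>set (enum (cell A n)). {z}) = cell A n" by (simp add: set_enum[OF finite_cell])
  have run: "exe (?P z) \<sigma> = \<sigma>(adr (c z) := (\<Prod>a\<leftarrow>rs z. \<sigma> a))" if "z \<in> cell A n" for z \<sigma>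
    using assms(3)[OF that] that by (intro run_product_prog) blast
  have "(\<forall>z\<in>(\<Union>z\<in>set (enum (cell A n)). {z}). exe (concat (map ?P (enum (cell A n)))) \<sigma> (adr (c z))
      = (\<Prod>a\<leftarrow>rs z. \<sigma> a)) \<and>
    (\<forall>q. q \<notin> (\<lambda>z. adr (c z)) ` (\<Union>z\<in>set (enum (cell A n)). {z}) \<union> {} \<longrightarrow>
      exe (concat (map ?P (enum (cell A n)))) \<sigma> q = \<sigma> q)"
  proof (rule run_loop)
    show "inj_on (\<lambda>z. adr (c z)) (\<Union>z\<in>set (enum (cell A n)). {z})"
      unfolding eq using assms(1,2) adr_eq_iff by (auto simp: inj_on_def)
    fix a and \<sigma> \<sigma>' :: "nat \<Rightarrow> complex" assume a: "a \<in> (\<Union>z\<in>set (enum (cell A n)). {z})"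
      and eq': "\<And>q. q \<notin> (\<lambda>z. adr (c z)) ` (\<Union>z\<in>set (enum (cell A n)). {z}) \<union> {} \<Longrightarrow> \<sigma> q = \<sigma>' q"
    show "(\<Prod>a\<leftarrow>rs a. \<sigma> a) = (\<Prod>a\<leftarrow>rs a. \<sigma>' a)"
    proof (rule prod_list_cong, rule eq')
      fix q assume "q \<in> set (rs a)"
      then have "q \<notin> adr ` c ` cell A n" using assms(3) a eq by blast
      then show "q \<notin> (\<lambda>z. adr (c z)) ` (\<Union>z\<in>set (enum (cell A n)). {z}) \<union> {}"
        unfolding eq by blast
    qed
  qed (auto simp: run set_enum[OF finite_cell])
  then show ?thesis unfolding eq by (simp add: image_image)
qed

end

text \<open>The condition on sources gives the new table \<open>T\<close> registers of its own.\<close>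

locale message_step = machine A n adr H inp
  for A :: "real ^ 'd ^ 'd::finite" and n and adr :: "('v, 'e, real ^ 'd) slot \<Rightarrow> nat"
    and H and inp :: "'i \<Rightarrow> complex" +
  fixes B :: "('v, 'e) table list" and v :: 'v and T :: "('v, 'e) table"
  assumes bucket: "\<And>T'. T' \<in> set B \<Longrightarrow> T' \<in> H \<and> well_pinned T' \<and> scope T' \<subseteq> insert v (scope T)
      \<and> source T' \<noteq> source T"
    and target: "T \<in> H" "well_pinned T" "v \<notin> scope T"
begin

definition written :: "('v, 'e, real ^ 'd) slot set" where
  "written = Entry (source T) ` entries A n T \<union> scratch A n"

lemma written_slots: "written \<subseteq> slots A n H"
  using entries_slots[OF target(1)] scratch_slots by (auto simp: written_def)

lemma reg_fresh:
  assumes "T' \<in> H" and "well_pinned T'" and "source T' \<noteq> source T"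
    and "\<And>w. w \<in> scope T' \<Longrightarrow> x w \<in> cell A n"
  shows "reg A n adr T' x \<notin> adr ` written"
proof -
  have "normal A n T' x \<in> entries A n T'" using assms by (intro normal_in_entries)
  then have "Entry (source T') (normal A n T' x) \<in> slots A n H"
    using entries_slots[OF assms(1)] by blast
  moreover have "Entry (source T') (normal A n T' x) \<notin> written"
    using assms(3) by (auto simp: written_def scratch_def)
  ultimately show ?thesis
    unfolding reg_def using adr_mem_iff[OF _ written_slots] by blast
qed

lemma bucket_reg_fresh:
  assumes "T' \<in> set B" and "\<And>w. w \<in> scope T' \<Longrightarrow> x w \<in> cell A n"
  shows "reg A n adr T' x \<notin> adr ` written"
  using bucket[OF assms(1)] assms(2) by (intro reg_fresh) auto

lemma update_in_cell:
  assumes "T' \<in> set B" and "\<And>w. w \<in> scope T \<Longrightarrow> y w \<in> cell A n" and "z \<in> cell A n"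
    and "w \<in> scope T'"
  shows "(y(v := z)) w \<in> cell A n"
  using bucket[OF assms(1)] assms by auto

lemma bucket_sum_local:
  assumes "\<And>w. w \<in> scope T \<Longrightarrow> y w \<in> cell A n" and "\<And>q. q \<notin> adr ` written \<Longrightarrow> \<sigma> q = \<sigma>' q"
  shows "bucket_sum A n adr B v y \<sigma> = bucket_sum A n adr B v y \<sigma>'"
  unfolding bucket_sum_def
proof (rule sum.cong, rule refl, rule prod_list_cong)
  fix z T' assume "z \<in> cell A n" "T' \<in> set B"
  then show "\<sigma> (reg A n adr T' (y(v := z))) = \<sigma>' (reg A n adr T' (y(v := z)))"
    using assms by (intro assms(2) bucket_reg_fresh update_in_cell)
qed

text \<open>What the elimination needs of a step, whether it is done directly or by convolutions.\<close>

definition computes_message :: "('i, real ^ 'd) instr list \<Rightarrow> bool" where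
  "computes_message P \<longleftrightarrow> (\<forall>\<sigma>.
     (\<forall>y\<in>entries A n T. exe P \<sigma> (adr (Entry (source T) y)) = bucket_sum A n adr B v y \<sigma>) \<and>
     (\<forall>q. q \<notin> adr ` written \<longrightarrow> exe P \<sigma> q = \<sigma> q))"

lemma computes_message_loop:
  assumes W: "(\<Union>b\<in>set bs. W b) = entries A n T"
    and run: "\<And>b \<sigma> y. b \<in> set bs \<Longrightarrow> y \<in> W b \<Longrightarrow>
      exe (P b) \<sigma> (adr (Entry (source T) y)) = bucket_sum A n adr B v y \<sigma>"
    and frame: "\<And>b \<sigma> q. b \<in> set bs \<Longrightarrow> q \<notin> adr ` (Entry (source T) ` W b \<union> scratch A n) \<Longrightarrow>
      exe (P b) \<sigma> q = \<sigma> q"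
  shows "computes_message (concat (map P bs))"
proof -
  let ?r = "\<lambda>y. adr (Entry (source T) y)"
  have eq: "adr ` (Entry (source T) ` Y \<union> scratch A n) = ?r ` Y \<union> adr ` scratch A n" for Y
    by (auto simp: image_Un image_image)
  have slot: "Entry (source T) y \<in> slots A n H" if "y \<in> entries A n T" for y
    using entries_slots[OF target(1)] that by blast
  have loop: "(\<forall>y\<in>(\<Union>b\<in>set bs. W b). exe (concat (map P bs)) \<sigma> (?r y) = bucket_sum A n adr B v y \<sigma>) \<and>
    (\<forall>q. q \<notin> ?r ` (\<Union>b\<in>set bs. W b) \<union> adr ` scratch A n \<longrightarrow> exe (concat (map P bs)) \<sigma> q = \<sigma> q)" for \<sigma>
  proof (rule run_loop[where X = "adr ` scratch A n"])
    show "inj_on ?r (\<Union>b\<in>set bs. W b)"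
      unfolding W using slot by (auto simp: inj_on_def adr_eq_iff)
    show "adr ` scratch A n \<inter> ?r ` (\<Union>b\<in>set bs. W b) = {}"
    proof -
      have "?r y \<notin> adr ` scratch A n" if "y \<in> entries A n T" for y
        using adr_mem_iff[OF slot[OF that] scratch_slots] by (auto simp: scratch_def)
      moreover have "S \<inter> ?r ` Y = {}" if "\<And>y. y \<in> Y \<Longrightarrow> ?r y \<notin> S" for S Y
        using that by blast
      ultimately show ?thesis unfolding W by simp
    qed
    show "exe (P b) \<sigma> q = \<sigma> q" if "b \<in> set bs" "q \<notin> ?r ` W b \<union> adr ` scratch A n" for b \<sigma> q
      using frame[OF that(1)] that(2) unfolding eq by blast
  next
    fix y and \<sigma> \<sigma>' :: "nat \<Rightarrow> complex" assume y: "y \<in> (\<Union>b\<in>set bs. W b)"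
      and eq': "\<And>q. q \<notin> ?r ` (\<Union>b\<in>set bs. W b) \<union> adr ` scratch A n \<Longrightarrow> \<sigma> q = \<sigma>' q"
    show "bucket_sum A n adr B v y \<sigma> = bucket_sum A n adr B v y \<sigma>'"
    proof (rule bucket_sum_local)
      show "y w \<in> cell A n" if "w \<in> scope T" for w
        using y unfolding W by (rule pinned_configs_in_cell[OF _ that])
      fix q assume "q \<notin> adr ` written"
      then have "q \<notin> ?r ` (\<Union>b\<in>set bs. W b) \<union> adr ` scratch A n" unfolding W written_def eq .
      then show "\<sigma> q = \<sigma>' q" by (rule eq')
    qed
  qed (rule run)
  show ?thesis
    unfolding computes_message_def written_def eq
  proof
    show "(\<forall>y\<in>entries A n T. exe (concat (map P bs)) \<sigma> (?r y) = bucket_sum A n adr B v y \<sigma>) \<and>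
        (\<forall>q. q \<notin> ?r ` entries A n T \<union> adr ` scratch A n \<longrightarrow> exe (concat (map P bs)) \<sigma> q = \<sigma> q)" for \<sigma>
      using loop[of \<sigma>] unfolding W .
  qed
qed

lemma direct_prog_computes_message: "computes_message (direct_prog A n adr B v T)"
  unfolding direct_prog_def
proof (rule computes_message_loop[where W = "\<lambda>y. {y}"])
  have fin: "finite (entries A n T)"
    using target(2) by (intro finite_pinned_configs) (simp add: well_pinned_def)
  show "(\<Union>y\<in>set (enum (entries A n T)). {y}) = entries A n T" by (simp add: set_enum[OF fin])
  fix y and \<sigma> :: "nat \<Rightarrow> complex" assume "y \<in> set (enum (entries A n T))"
  then have y: "y \<in> entries A n T" by (simp add: set_enum[OF fin])
  let ?r = "adr (Entry (source T) y)" and ?acc = "adr Accumulator"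
  let ?rs = "\<lambda>z. map (\<lambda>T'. reg A n adr T' (y(v := z))) B"
  have ry: "Entry (source T) y \<in> written" "Accumulator \<in> written"
    using y by (auto simp: written_def scratch_def)
  have ne: "?r \<noteq> ?acc" using ry written_slots by (subst adr_eq_iff) auto
  have fresh: "?acc \<notin> set (?rs z) \<and> ?r \<notin> set (?rs z)" if z: "z \<in> set (enum (cell A n))" for z
  proof -
    have z': "z \<in> cell A n" using z by (simp add: set_enum[OF finite_cell])
    have "q \<notin> adr ` written" if q: "q \<in> set (?rs z)" for q
    proof -
      obtain T' where T': "T' \<in> set B" "q = reg A n adr T' (y(v := z))" using q by auto
      show ?thesis
        unfolding T'(2) using T'(1) z' pinned_configs_in_cell[OF y]
        by (intro bucket_reg_fresh update_in_cell)
    qed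
    then show ?thesis using ry by blast
  qed
  define \<tau> where "\<tau> = \<sigma>(?r := 0)"
  have run: "exe (direct_block A n adr B v ?r y) \<sigma> ?r = \<tau> ?r + (\<Sum>z\<leftarrow>enum (cell A n). \<Prod>a\<leftarrow>?rs z. \<tau> a) \<and>
    (\<forall>q. q \<noteq> ?r \<longrightarrow> q \<noteq> ?acc \<longrightarrow> exe (direct_block A n adr B v ?r y) \<sigma> q = \<tau> q)"
    using run_sum_of_products[of ?r ?acc "enum (cell A n)" ?rs A n inp \<tau>, OF ne fresh]
    by (simp add: direct_block_def \<tau>_def)
  have "(\<Sum>z\<leftarrow>enum (cell A n). \<Prod>a\<leftarrow>?rs z. \<tau> a) = bucket_sum A n adr B v y \<tau>"
    by (simp add: sum_list_enum[OF finite_cell] bucket_sum_def o_def)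
  also have "\<dots> = bucket_sum A n adr B v y \<sigma>"
    using ry(1) pinned_configs_in_cell[OF y] by (intro bucket_sum_local) (auto simp: \<tau>_def)
  finally have val: "(\<Sum>z\<leftarrow>enum (cell A n). \<Prod>a\<leftarrow>?rs z. \<tau> a) = bucket_sum A n adr B v y \<sigma>" .
  show "exe (direct_block A n adr B v ?r y) \<sigma> (adr (Entry (source T) y')) = bucket_sum A n adr B v y' \<sigma>"
    if "y' \<in> {y}" for y'
  proof -
    have "exe (direct_block A n adr B v ?r y) \<sigma> ?r = \<tau> ?r + bucket_sum A n adr B v y \<sigma>"
      using run unfolding val by blast
    then show ?thesis using that by (simp add: \<tau>_def)
  qed
  show "exe (direct_block A n adr B v ?r y) \<sigma> q = \<sigma> q"
    if "q \<notin> adr ` (Entry (source T) ` {y} \<union> scratch A n)" for q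
  proof -
    have "q \<noteq> ?r" "q \<noteq> ?acc" using that scratch_members(1) by auto
    then show ?thesis using run by (simp add: \<tau>_def)
  qed
qed

text \<open>If every factor of the bucket that depends on \<open>u\<close> depends on the difference of \<open>u\<close> and \<open>v\<close>
  only, then for fixed values of the remaining variables the sum over \<open>v\<close> is a convolution whose
  result is indexed by \<open>u\<close>. The pinned variable has to be another one.\<close>

lemma conv_prog_computes_message:
  assumes u: "u \<in> scope T" "u \<noteq> pin T"
    and pair: "\<And>T'. T' \<in> set B \<Longrightarrow> u \<in> scope T' \<Longrightarrow> scope T' = {u, v}"
  shows "computes_message (conv_prog A n adr B v u T)"
  unfolding conv_prog_def
proof (rule computes_message_loop[where W = "\<lambda>y. (\<lambda>x. y(u := x)) ` cell A n"])
  let ?base = "pinned_configs A n {pin T, u} (scope T)"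
  have uv: "u \<noteq> v" using u target by auto
  have fin: "finite ?base"
    using target(2) by (intro finite_pinned_configs) (simp add: well_pinned_def)
  have upd: "y(u := x) \<in> entries A n T" if "y \<in> ?base" "x \<in> cell A n" for y x
    using that u by (auto simp: pinned_configs_def PiE_iff extensional_def)
  have "y \<in> (\<Union>y\<in>?base. (\<lambda>x. y(u := x)) ` cell A n)" if y: "y \<in> entries A n T" for y
  proof -
    have "y(u := 0) \<in> ?base" using y u by (auto simp: pinned_configs_def PiE_iff extensional_def)
    moreover have "y = (y(u := 0))(u := y u)" by simp
    moreover have "y u \<in> cell A n" using pinned_configs_in_cell[OF y] u by simp
    ultimately show ?thesis by blast
  qed
  then show "(\<Union>y\<in>set (enum ?base). (\<lambda>x. y(u := x)) ` cell A n) = entries A n T"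
    using upd by (auto simp: set_enum[OF fin])
  fix y and \<sigma> :: "nat \<Rightarrow> complex" assume "y \<in> set (enum ?base)"
  then have y: "y \<in> ?base" by (simp add: set_enum[OF fin])
  have y_cell: "y w \<in> cell A n" if "w \<in> scope T" for w
    using pinned_configs_in_cell[OF y that] .
  let ?BL = "filter (\<lambda>T'. \<not> u \<in> scope T') B" and ?BR = "filter (\<lambda>T'. u \<in> scope T') B"
  define f where "f z = (\<Prod>T'\<leftarrow>?BL. \<sigma> (reg A n adr T' (y(v := z))))" for z
  define g where "g z = (\<Prod>T'\<leftarrow>?BR. \<sigma> (reg A n adr T' ((\<lambda>_. 0)(u := z))))" for z
  define h where "h x = adr (Entry (source T) (y(u := x)))" for x
  define PL :: "('i, real ^ 'd) instr list" where "PL = concat (map (\<lambda>z. product_prog (adr (Left z))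
       (map (\<lambda>T'. reg A n adr T' (y(v := z))) ?BL)) (enum (cell A n)))"
  define PR :: "('i, real ^ 'd) instr list" where "PR = concat (map (\<lambda>z. product_prog (adr (Right z))
       (map (\<lambda>T'. reg A n adr T' ((\<lambda>_. 0)(u := z))) ?BR)) (enum (cell A n)))"
  let ?C = "Convolve h (\<lambda>z. adr (Left z)) (\<lambda>z. adr (Right z)) :: ('i, real ^ 'd) instr"
  have block: "conv_block A n adr B v u T y = PL @ PR @ [?C]"
    by (simp add: conv_block_def PL_def PR_def h_def[abs_def])
  let ?LS = "adr ` Left ` cell A n" and ?RS = "adr ` Right ` cell A n"
  have sub: "Left ` cell A n \<subseteq> written" "Right ` cell A n \<subseteq> written"
    by (auto simp: written_def scratch_def)
  then have sub': "?LS \<subseteq> adr ` written" "?RS \<subseteq> adr ` written" by (simp_all only: image_mono)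
  have fresh_L: "reg A n adr T' (y(v := z)) \<notin> adr ` written" if "z \<in> cell A n" "T' \<in> set B" for z T'
    using that y_cell by (intro bucket_reg_fresh update_in_cell)
  have fresh_R: "reg A n adr T' ((\<lambda>_. 0)(u := z)) \<notin> adr ` written" if "z \<in> cell A n" "T' \<in> set B" for z T'
    using that by (intro bucket_reg_fresh) auto
  have inj: "inj_on Left (cell A n)" "inj_on Right (cell A n)" by (auto simp: inj_on_def)
  have slot: "Left z \<in> slots A n H" "Right z \<in> slots A n H" if "z \<in> cell A n" for z
    using sub written_slots that by auto
  have pre_L: "a \<notin> ?LS"
    if z: "z \<in> cell A n" and a: "a \<in> set (map (\<lambda>T'. reg A n adr T' (y(v := z))) ?BL)" for z a
  proof -
    obtain T' where T': "T' \<in> set B" "a = reg A n adr T' (y(v := z))" using a by auto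
    show ?thesis unfolding T'(2) by (rule contra_subsetD[OF sub'(1) fresh_L[OF z T'(1)]])
  qed
  have pre_R: "a \<notin> ?RS"
    if z: "z \<in> cell A n" and a: "a \<in> set (map (\<lambda>T'. reg A n adr T' ((\<lambda>_. 0)(u := z))) ?BR)" for z a
  proof -
    obtain T' where T': "T' \<in> set B" "a = reg A n adr T' ((\<lambda>_. 0)(u := z))" using a by auto
    show ?thesis unfolding T'(2) by (rule contra_subsetD[OF sub'(2) fresh_R[OF z T'(1)]])
  qed
  have L: "(\<forall>z\<in>cell A n. exe PL \<sigma> (adr (Left z)) = f z) \<and> (\<forall>q. q \<notin> ?LS \<longrightarrow> exe PL \<sigma> q = \<sigma> q)"
    using array_run[of Left "\<lambda>z. map (\<lambda>T'. reg A n adr T' (y(v := z))) ?BL" \<sigma>, OF slot(1) inj(1) pre_L]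
    unfolding PL_def[symmetric] f_def list.map_comp o_def .
  have R: "(\<forall>z\<in>cell A n. exe PR \<tau> (adr (Right z))
        = (\<Prod>T'\<leftarrow>?BR. \<tau> (reg A n adr T' ((\<lambda>_. 0)(u := z))))) \<and> (\<forall>q. q \<notin> ?RS \<longrightarrow> exe PR \<tau> q = \<tau> q)" for \<tau>
    using array_run[of Right "\<lambda>z. map (\<lambda>T'. reg A n adr T' ((\<lambda>_. 0)(u := z))) ?BR" \<tau>, OF slot(2) inj(2) pre_R]
    unfolding PR_def[symmetric] list.map_comp o_def .
  define \<tau> where "\<tau> = exe PR (exe PL \<sigma>)"
  have \<tau>_right: "\<tau> (adr (Right z)) = g z" if z: "z \<in> cell A n" for z
  proof -
    have "\<tau> (adr (Right z)) = (\<Prod>T'\<leftarrow>?BR. exe PL \<sigma> (reg A n adr T' ((\<lambda>_. 0)(u := z))))"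
      using R z by (simp add: \<tau>_def)
    also have "\<dots> = g z"
      unfolding g_def
    proof (rule prod_list_cong)
      fix T' assume "T' \<in> set ?BR"
      then have "T' \<in> set B" by simp
      then have "reg A n adr T' ((\<lambda>_. 0)(u := z)) \<notin> ?LS"
        by (rule contra_subsetD[OF sub'(1) fresh_R[OF z]])
      then show "exe PL \<sigma> (reg A n adr T' ((\<lambda>_. 0)(u := z))) = \<sigma> (reg A n adr T' ((\<lambda>_. 0)(u := z)))"
        using L by blast
    qed
    finally show ?thesis .
  qed
  have \<tau>_left: "\<tau> (adr (Left z)) = f z" if z: "z \<in> cell A n" for z
  proof -
    have "Left z \<in> slots A n H" "Right ` cell A n \<subseteq> slots A n H" using sub written_slots z by auto
    then have "adr (Left z) \<notin> ?RS" using adr_mem_iff by blast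
    then show ?thesis using R L z by (simp add: \<tau>_def)
  qed
  have \<tau>_frame: "\<tau> q = \<sigma> q" if "q \<notin> adr ` scratch A n" for q
  proof -
    have "q \<notin> ?LS" "q \<notin> ?RS" using that by (auto simp: scratch_def)
    then have "exe PR (exe PL \<sigma>) q = exe PL \<sigma> q" "exe PL \<sigma> q = \<sigma> q" using R L by blast+
    then show ?thesis by (simp add: \<tau>_def)
  qed
  have h_inj: "inj_on h (cell A n)"
  proof (rule inj_onI)
    fix a b assume ab: "a \<in> cell A n" "b \<in> cell A n" "h a = h b"
    have "Entry (source T) (y(u := a)) \<in> slots A n H" "Entry (source T) (y(u := b)) \<in> slots A n H"
      using upd[OF y] ab entries_slots[OF target(1)] by blast+
    then have "y(u := a) = y(u := b)" using ab(3) by (simp add: h_def adr_eq_iff)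
    then show "a = b" by (metis fun_upd_same)
  qed
  have conv: "(\<Sum>z\<in>cell A n. f z * g (delta A n z x)) = bucket_sum A n adr B v (y(u := x)) \<sigma>"
    if x: "x \<in> cell A n" for x
    unfolding bucket_sum_def
  proof (rule sum.cong, rule refl)
    fix z assume z: "z \<in> cell A n"
    have "f z = (\<Prod>T'\<leftarrow>?BL. \<sigma> (reg A n adr T' ((y(u := x))(v := z))))"
      unfolding f_def reg_def using bucket by (intro prod_list_cong arg_cong[of _ _ \<sigma>] arg_cong[of _ _ adr]
          arg_cong[of _ _ "Entry _"] normal_cong) auto
    moreover have "g (delta A n z x) = (\<Prod>T'\<leftarrow>?BR. \<sigma> (reg A n adr T' ((y(u := x))(v := z))))"
      unfolding g_def reg_def
    proof (intro prod_list_cong arg_cong[of _ _ \<sigma>] arg_cong[of _ _ adr] arg_cong[of _ _ "Entry _"])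
      fix T' assume T': "T' \<in> set ?BR"
      then have sc: "scope T' = {u, v}" using pair by auto
      show "normal A n T' ((\<lambda>_. 0)(u := delta A n z x)) = normal A n T' ((y(u := x))(v := z))"
        using T' bucket[of T'] z x uv by (intro normal_shift[of _ z]) (auto simp: sc)
    qed
    ultimately show "f z * g (delta A n z x) = (\<Prod>T'\<leftarrow>B. \<sigma> (reg A n adr T' ((y(u := x))(v := z))))"
      using prod_list_partition[of "\<lambda>T'. \<sigma> (reg A n adr T' ((y(u := x))(v := z)))" B "\<lambda>T'. u \<in> scope T'"]
      by (simp add: mult.commute)
  qed
  show "exe (conv_block A n adr B v u T y) \<sigma> (adr (Entry (source T) y')) = bucket_sum A n adr B v y' \<sigma>"
    if y': "y' \<in> (\<lambda>x. y(u := x)) ` cell A n" for y'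
  proof -
    obtain x where x: "x \<in> cell A n" "y' = y(u := x)" using y' by blast
    have "exe [?C] \<tau> (h x) = (\<Sum>z\<in>cell A n. \<tau> (adr (Left z)) * \<tau> (adr (Right (delta A n z x))))"
      using x(1) h_inj by simp
    also have "\<dots> = (\<Sum>z\<in>cell A n. f z * g (delta A n z x))"
      using x(1) by (intro sum.cong) (simp_all add: \<tau>_left \<tau>_right)
    finally show ?thesis unfolding block using conv[OF x(1)] by (simp add: \<tau>_def x(2) h_def)
  qed
  show "exe (conv_block A n adr B v u T y) \<sigma> q = \<sigma> q"
    if q: "q \<notin> adr ` (Entry (source T) ` ((\<lambda>x. y(u := x)) ` cell A n) \<union> scratch A n)" for q
  proof -
    have "q \<notin> h ` cell A n" "q \<notin> adr ` scratch A n" using q by (auto simp: h_def)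
    then show ?thesis unfolding block using \<tau>_frame[of q] by (simp add: \<tau>_def)
  qed
qed

text \<open>Reading the message at an arbitrary configuration: the normal form shifts all positions by the
  same vector, and so does the substitution of the summation variable.\<close>

lemma message_value:
  assumes P: "computes_message P" and x: "\<And>w. w \<in> scope T \<Longrightarrow> x w \<in> cell A n"
  shows "exe P \<sigma> (reg A n adr T x) = bucket_sum A n adr B v x \<sigma>"
proof -
  let ?y = "normal A n T x"
  \<comment> \<open>With an empty scope there is no pin in the cell; then no shift takes place.\<close>
  define c where "c = (if scope T = {} then 0 else x (pin T))"
  have c: "c \<in> cell A n" using x target(2) by (auto simp: c_def well_pinned_def)
  have "?y \<in> entries A n T" using target(2) x by (rule normal_in_entries)
  then have "exe P \<sigma> (reg A n adr T x) = bucket_sum A n adr B v ?y \<sigma>"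
    using P by (simp add: computes_message_def reg_def)
  also have "\<dots> = (\<Sum>z\<in>cell A n. \<Prod>T'\<leftarrow>B. \<sigma> (reg A n adr T' (?y(v := delta A n c z))))"
    unfolding bucket_sum_def by (rule sum.reindex_bij_betw[OF bij_delta[OF c], symmetric])
  also have "\<dots> = bucket_sum A n adr B v x \<sigma>"
    unfolding bucket_sum_def reg_def
  proof (intro sum.cong refl prod_list_cong arg_cong[of _ _ \<sigma>] arg_cong[of _ _ adr] arg_cong[of _ _ "Entry _"])
    fix z T' assume z: "z \<in> cell A n" and T': "T' \<in> set B"
    show "normal A n T' (?y(v := delta A n c z)) = normal A n T' (x(v := z))"
    proof (rule normal_shift[OF _ c])
      show "well_pinned T'" using bucket[OF T'] by blast
      fix w assume w: "w \<in> scope T'"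
      show "(x(v := z)) w \<in> cell A n" using T' x z w by (rule update_in_cell)
      show "(?y(v := delta A n c z)) w = delta A n c ((x(v := z)) w)"
        using bucket[OF T'] w by (auto simp: normal_def c_def)
    qed
  qed
  finally show ?thesis .
qed

end

section \<open>Eliminating all vertices\<close>

definition scopes :: "('v, 'e) table list \<Rightarrow> 'v set multiset" where
  "scopes L = image_mset scope (mset L)"

text \<open>The part of the definition of a convolutional step that concerns the scopes.\<close>

definition partner :: "'v \<Rightarrow> 'v set multiset \<Rightarrow> 'v \<Rightarrow> bool" where
  "partner v Us u \<longleftrightarrow> u \<in> bucket_scope v Us \<and> (\<forall>U\<in>#Us. v \<in> U \<longrightarrow> u \<in> U \<longrightarrow> U = {u, v})"

text \<open>Besides the output variable of the convolution the scope must contain a vertex to be pinned.\<close>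

definition convolvable :: "'v \<Rightarrow> 'v set multiset \<Rightarrow> bool" where
  "convolvable v Us \<longleftrightarrow> 2 \<le> card (bucket_scope v Us) \<and> (\<exists>u. partner v Us u)"

definition conv_vertex :: "'v \<Rightarrow> 'v set multiset \<Rightarrow> 'v" where
  "conv_vertex v Us = (SOME u. partner v Us u)"

text \<open>The pin is any vertex of the scope, other than the output variable if there is a convolution.\<close>

definition message :: "'v \<Rightarrow> 'v set multiset \<Rightarrow> ('v, 'e) table" where
  "message v Us = Table (Message v)
     (SOME p. p \<in> bucket_scope v Us - (if convolvable v Us then {conv_vertex v Us} else {}))
     (bucket_scope v Us)"

definition bucket_tables :: "'v \<Rightarrow> ('v, 'e) table list \<Rightarrow> ('v, 'e) table list" where
  "bucket_tables v L = filter (\<lambda>T. v \<in> scope T) L"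

definition next_tables :: "'v \<Rightarrow> ('v, 'e) table list \<Rightarrow> ('v, 'e) table list" where
  "next_tables v L = message v (scopes L) # filter (\<lambda>T. v \<notin> scope T) L"

definition step_prog ::
  "real ^ 'd ^ 'd::finite \<Rightarrow> nat \<Rightarrow> (('v, 'e, real ^ 'd) slot \<Rightarrow> nat) \<Rightarrow> ('v, 'e) table list \<Rightarrow> 'v
     \<Rightarrow> ('i, real ^ 'd) instr list" where
  "step_prog A n adr L v =
     (if convolvable v (scopes L)
      then conv_prog A n adr (bucket_tables v L) v (conv_vertex v (scopes L)) (message v (scopes L))
      else direct_prog A n adr (bucket_tables v L) v (message v (scopes L)))"

fun elim_prog ::
  "real ^ 'd ^ 'd::finite \<Rightarrow> nat \<Rightarrow> (('v, 'e, real ^ 'd) slot \<Rightarrow> nat) \<Rightarrow> ('v, 'e) table list \<Rightarrow> 'v list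
     \<Rightarrow> ('i, real ^ 'd) instr list" where
  "elim_prog A n adr L [] = []"
| "elim_prog A n adr L (v # vs) = step_prog A n adr L v @ elim_prog A n adr (next_tables v L) vs"

fun all_tables :: "('v, 'e) table list \<Rightarrow> 'v list \<Rightarrow> ('v, 'e) table set" where
  "all_tables L [] = set L"
| "all_tables L (v # vs) = set L \<union> all_tables (next_tables v L) vs"

lemma message_simps [simp]:
  "source (message v Us) = Message v" "scope (message v Us) = bucket_scope v Us"
  by (simp_all add: message_def)

lemma scopes_next: "scopes (next_tables v L) = eliminate_scope v (scopes L)"
  by (simp add: scopes_def next_tables_def eliminate_scope_def filter_mset_image_mset mset_filter)

lemma bucket_scope_scopes:
  "bucket_scope v (scopes L) = (\<Union>T\<in>set (bucket_tables v L). scope T) - {v}"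
  by (auto simp: bucket_scope_def scopes_def bucket_tables_def)

lemma set_subset_all_tables: "set L \<subseteq> all_tables L vs"
  by (cases vs) auto

lemma conv_vertex_partner: "convolvable v Us \<Longrightarrow> partner v Us (conv_vertex v Us)"
  unfolding convolvable_def conv_vertex_def by (blast intro: someI_ex)

lemma pin_message:
  assumes "bucket_scope v Us \<noteq> {}"
  shows "pin (message v Us) \<in> bucket_scope v Us - (if convolvable v Us then {conv_vertex v Us} else {})"
proof -
  have "bucket_scope v Us - (if convolvable v Us then {conv_vertex v Us} else {}) \<noteq> {}"
  proof
    assume "bucket_scope v Us - (if convolvable v Us then {conv_vertex v Us} else {}) = {}"
    then have "convolvable v Us" "bucket_scope v Us \<subseteq> {conv_vertex v Us}"
      using assms by (auto split: if_splits)
    then have "2 \<le> card (bucket_scope v Us)" "card (bucket_scope v Us) \<le> 1"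
      using card_mono[of "{conv_vertex v Us}" "bucket_scope v Us"] by (auto simp: convolvable_def)
    then show False by simp
  qed
  then show ?thesis
    unfolding message_def table.sel by (intro some_in_eq[THEN iffD2])
qed

lemma well_pinned_message:
  assumes "finite (bucket_scope v Us)"
  shows "well_pinned (message v Us)"
  using assms pin_message[of v Us] unfolding well_pinned_def message_simps by blast

text \<open>The part of the lattice sum that remains when only the vertices in \<open>R\<close> and the pin \<open>s\<close> of the
  sum are left. The weight \<open>w\<close> is the factor that is not stored in a table.\<close>

definition weighted_sum ::
  "real ^ 'd ^ 'd::finite \<Rightarrow> nat \<Rightarrow> (('v, 'e, real ^ 'd) slot \<Rightarrow> nat) \<Rightarrow> 'v
     \<Rightarrow> (('v \<Rightarrow> real ^ 'd) \<Rightarrow> complex) \<Rightarrow> 'v set \<Rightarrow> ('v, 'e) table list \<Rightarrow> (nat \<Rightarrow> complex) \<Rightarrow> complex" where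
  "weighted_sum A n adr s w R L \<sigma> =
     (\<Sum>x\<in>R \<rightarrow>\<^sub>E cell A n. w (x(s := 0)) * (\<Prod>T\<leftarrow>L. \<sigma> (reg A n adr T (x(s := 0)))))"

lemma sum_PiE_insert:
  assumes "v \<notin> R"
  shows "(\<Sum>x\<in>insert v R \<rightarrow>\<^sub>E C. f x) = (\<Sum>x\<in>R \<rightarrow>\<^sub>E C. \<Sum>z\<in>C. f (x(v := z)))"
proof -
  have "(\<Sum>x\<in>insert v R \<rightarrow>\<^sub>E C. f x) = (\<Sum>p\<in>C \<times> (R \<rightarrow>\<^sub>E C). f (case p of (z, x) \<Rightarrow> x(v := z)))"
    unfolding PiE_insert_eq using sum.reindex[OF inj_combinator[OF assms, of "\<lambda>_. C"], of f]
    by (simp add: o_def)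
  also have "\<dots> = (\<Sum>z\<in>C. \<Sum>x\<in>R \<rightarrow>\<^sub>E C. f (x(v := z)))"
    by (simp add: sum.cartesian_product case_prod_unfold)
  finally show ?thesis by (simp add: sum.swap[of _ C])
qed

context machine
begin

text \<open>The last condition keeps the registers of the messages that are still to come free.\<close>

definition tables_ok :: "'v \<Rightarrow> 'v set \<Rightarrow> ('v, 'e) table list \<Rightarrow> bool" where
  "tables_ok s R L \<longleftrightarrow> (\<forall>T\<in>set L. T \<in> H \<and> well_pinned T \<and> scope T \<subseteq> insert s R \<and>
     (\<forall>v\<in>R. source T \<noteq> Message v))"

lemma config_in_cell:
  assumes "x \<in> R \<rightarrow>\<^sub>E cell A n" and "w \<in> insert s R"
  shows "(x(s := 0)) w \<in> cell A n"
  using assms by (auto simp: PiE_iff)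

lemma message_ok:
  assumes ok: "tables_ok s (insert v R) L" and v: "v \<notin> R" "v \<noteq> s"
    and H: "message v (scopes L) \<in> H"
  shows "scope (message v (scopes L) :: ('v, 'e) table) \<subseteq> insert s R"
    and "tables_ok s R (next_tables v L)"
    and "message_step A n adr H (bucket_tables v L) v (message v (scopes L))"
proof -
  let ?B = "bucket_tables v L" and ?M = "message v (scopes L) :: ('v, 'e) table"
  have L: "T \<in> H" "well_pinned T" "scope T \<subseteq> insert s (insert v R)" "source T \<noteq> Message v"
    if "T \<in> set L" for T using ok that by (auto simp: tables_ok_def)
  have B: "set ?B \<subseteq> set L" by (auto simp: bucket_tables_def)
  show scope_M: "scope ?M \<subseteq> insert s R"
    using L(3) v B unfolding message_simps bucket_scope_scopes by blast
  have "finite (scope ?M)"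
    using L(2) B unfolding message_simps bucket_scope_scopes by (auto simp: well_pinned_def)
  then have wp_M: "well_pinned ?M" using well_pinned_message by simp
  show "tables_ok s R (next_tables v L)"
    using ok H wp_M scope_M v(1) by (auto simp: tables_ok_def next_tables_def)
  show "message_step A n adr H ?B v ?M"
  proof unfold_locales
    fix T' assume T': "T' \<in> set ?B"
    then have "T' \<in> set L" "v \<in> scope T'" by (auto simp: bucket_tables_def)
    then show "T' \<in> H \<and> well_pinned T' \<and> scope T' \<subseteq> insert v (scope ?M) \<and> source T' \<noteq> source ?M"
      using L T' unfolding message_simps bucket_scope_scopes by auto
  next
    show "v \<notin> scope ?M" by (simp add: bucket_scope_def)
  qed (use H wp_M in auto)
qed

lemma pin_message_neq_conv_vertex:
  assumes "convolvable v Us"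
  shows "conv_vertex v Us \<in> bucket_scope v Us"
    and "conv_vertex v Us \<noteq> pin (message v Us :: ('v, 'e) table)"
proof -
  show u: "conv_vertex v Us \<in> bucket_scope v Us"
    using conv_vertex_partner[OF assms] by (simp add: partner_def)
  then have "bucket_scope v Us \<noteq> {}" by auto
  then have "pin (message v Us :: ('v, 'e) table)
      \<in> bucket_scope v Us - (if convolvable v Us then {conv_vertex v Us} else {})"
    by (rule pin_message)
  then show "conv_vertex v Us \<noteq> pin (message v Us :: ('v, 'e) table)" using assms by auto
qed

text \<open>Distributivity: the weight and the factors outside of the bucket do not depend on \<open>v\<close>, so they
  can be taken out of the sum over the position of \<open>v\<close>, which is then the message.\<close>

lemma eliminate_vertex:
  assumes ok: "tables_ok s (insert v R) L" and v: "v \<notin> R" "v \<noteq> s"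
    and H: "message v (scopes L) \<in> H" and w: "\<And>x z. w (x(v := z)) = w x"
  shows "weighted_sum A n adr s w R (next_tables v L) (exe (step_prog A n adr L v) \<sigma>)
    = weighted_sum A n adr s w (insert v R) L \<sigma>"
proof -
  let ?B = "bucket_tables v L" and ?M = "message v (scopes L) :: ('v, 'e) table"
  have L: "T \<in> H" "well_pinned T" "scope T \<subseteq> insert s (insert v R)" "source T \<noteq> Message v"
    if "T \<in> set L" for T using ok that by (auto simp: tables_ok_def)
  note scope_M = message_ok(1)[OF ok v H]
  interpret message_step A n adr H inp ?B v ?M by (rule message_ok(3)[OF ok v H])
  have P: "computes_message (step_prog A n adr L v)"
  proof (cases "convolvable v (scopes L)")
    case True
    let ?u = "conv_vertex v (scopes L)"
    have u: "partner v (scopes L) ?u" using conv_vertex_partner[OF True] .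
    have "computes_message (conv_prog A n adr ?B v ?u ?M)"
    proof (rule conv_prog_computes_message)
      show "?u \<in> scope ?M" "?u \<noteq> pin ?M"
        using pin_message_neq_conv_vertex[OF True] by simp_all
      show "scope T' = {?u, v}" if "T' \<in> set ?B" "?u \<in> scope T'" for T'
        using u that by (auto simp: partner_def scopes_def bucket_tables_def)
    qed
    then show ?thesis using True by (simp add: step_prog_def)
  next
    case False
    then show ?thesis using direct_prog_computes_message by (simp add: step_prog_def)
  qed
  let ?\<sigma>' = "exe (step_prog A n adr L v) \<sigma>"
  let ?rest = "filter (\<lambda>T. v \<notin> scope T) L"
  have split: "(\<Sum>z\<in>cell A n. w ((x(v := z))(s := 0)) *
        (\<Prod>T\<leftarrow>L. \<sigma> (reg A n adr T ((x(v := z))(s := 0)))))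
      = w (x(s := 0)) * (\<Prod>T\<leftarrow>next_tables v L. ?\<sigma>' (reg A n adr T (x(s := 0))))"
    if x: "x \<in> R \<rightarrow>\<^sub>E cell A n" for x
  proof -
    define x0 where "x0 = x(s := 0)"
    have swap: "(x(v := z))(s := 0) = x0(v := z)" for z
      using v(2) by (simp add: x0_def fun_upd_twist)
    have x0: "x0 w \<in> cell A n" if "w \<in> insert s R" for w
      unfolding x0_def by (rule config_in_cell[OF x that])
    have rest: "\<sigma> (reg A n adr T (x0(v := z))) = ?\<sigma>' (reg A n adr T x0)" if T: "T \<in> set ?rest" for T z
    proof -
      have T': "T \<in> set L" "v \<notin> scope T" using T by auto
      have "normal A n T (x0(v := z)) = normal A n T x0"
        using L(2)[OF T'(1)] T'(2) by (intro normal_cong) auto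
      moreover have "reg A n adr T x0 \<notin> adr ` written"
        using L[OF T'(1)] T'(2) x0 by (intro reg_fresh) auto
      ultimately show ?thesis using P by (simp add: reg_def computes_message_def)
    qed
    have "(\<Prod>T\<leftarrow>L. \<sigma> (reg A n adr T (x0(v := z))))
        = (\<Prod>T\<leftarrow>?B. \<sigma> (reg A n adr T (x0(v := z)))) * (\<Prod>T\<leftarrow>?rest. ?\<sigma>' (reg A n adr T x0))" for z
      using prod_list_partition[of "\<lambda>T. \<sigma> (reg A n adr T (x0(v := z)))" L "\<lambda>T. v \<in> scope T"]
        prod_list_cong[of ?rest "\<lambda>T. \<sigma> (reg A n adr T (x0(v := z)))" "\<lambda>T. ?\<sigma>' (reg A n adr T x0)"] rest
      by (simp only: bucket_tables_def)
    then have "(\<Sum>z\<in>cell A n. w (x0(v := z)) * (\<Prod>T\<leftarrow>L. \<sigma> (reg A n adr T (x0(v := z)))))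
        = w x0 * (bucket_sum A n adr ?B v x0 \<sigma> * (\<Prod>T\<leftarrow>?rest. ?\<sigma>' (reg A n adr T x0)))"
      by (simp add: w bucket_sum_def sum_distrib_left sum_distrib_right)
    also have "bucket_sum A n adr ?B v x0 \<sigma> = ?\<sigma>' (reg A n adr ?M x0)"
      using scope_M x0 by (intro message_value[OF P, symmetric]) auto
    finally show ?thesis unfolding swap x0_def[symmetric] by (simp add: next_tables_def del: fun_upd_apply)
  qed
  show "weighted_sum A n adr s w R (next_tables v L) ?\<sigma>' = weighted_sum A n adr s w (insert v R) L \<sigma>"
    unfolding weighted_sum_def sum_PiE_insert[OF v(1)]
    by (rule sum.cong[OF refl]) (rule split[symmetric])
qed

lemma eliminate_all:
  assumes "distinct vs" and "set vs \<inter> R = {}" and "s \<notin> set vs"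
    and "tables_ok s (set vs \<union> R) L" and "all_tables L vs \<subseteq> H"
    and "\<And>v x z. v \<in> set vs \<Longrightarrow> w (x(v := z)) = w x"
  shows "weighted_sum A n adr s w R (fold next_tables vs L) (exe (elim_prog A n adr L vs) \<sigma>)
      = weighted_sum A n adr s w (set vs \<union> R) L \<sigma> \<and> tables_ok s R (fold next_tables vs L)"
  using assms
proof (induction vs arbitrary: L \<sigma>)
  case (Cons v vs)
  have "message v (scopes L) \<in> set (next_tables v L)" by (simp add: next_tables_def)
  then have H: "message v (scopes L) \<in> H"
    using Cons.prems(5) set_subset_all_tables[of "next_tables v L" vs] by auto
  have ok: "tables_ok s (insert v (set vs \<union> R)) L" using Cons.prems(4) by simp
  have v: "v \<notin> set vs \<union> R" "v \<noteq> s" using Cons.prems(1-3) by auto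
  have w: "w (x(v := z)) = w x" for x z by (rule Cons.prems(6)) simp
  note step = eliminate_vertex[OF ok v H w] message_ok(2)[OF ok v H]
  have "weighted_sum A n adr s w R (fold next_tables vs (next_tables v L))
      (exe (elim_prog A n adr (next_tables v L) vs) (exe (step_prog A n adr L v) \<sigma>))
    = weighted_sum A n adr s w (set vs \<union> R) (next_tables v L) (exe (step_prog A n adr L v) \<sigma>)
    \<and> tables_ok s R (fold next_tables vs (next_tables v L))"
  proof (rule Cons.IH[OF _ _ _ step(2)])
    show "w (x(u := z)) = w x" if "u \<in> set vs" for u x z
      using that by (intro Cons.prems(6)) simp
  qed (use Cons.prems(1-5) in auto)
  then show ?case using step(1)[of \<sigma>] by simp
qed simp


end


section \<open>Reading the kernels and evaluating the last factors\<close>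

definition edge_table :: "('v, 'e) pre_digraph \<Rightarrow> 'e \<Rightarrow> ('v, 'e) table" where
  "edge_table G e = Table (Edge e) (tail G e) {tail G e, head G e}"

definition momentum_table :: "'v \<Rightarrow> 'v \<Rightarrow> ('v, 'e) table" where
  "momentum_table s t = Table Momentum s {s, t}"

definition initial_tables :: "('v, 'e) pre_digraph \<Rightarrow> 'v \<Rightarrow> 'v \<Rightarrow> ('v, 'e) table list" where
  "initial_tables G s t = momentum_table s t # map (edge_table G) (enum (arcs G))"

text \<open>The instruction \<open>mom\<close> decides whether the table of the momentum factor receives phases or ones.\<close>

definition load_instr ::
  "('v, 'e) pre_digraph \<Rightarrow> (('v, 'e, 'x) slot \<Rightarrow> nat) \<Rightarrow> ('e \<Rightarrow> 'x \<Rightarrow> 'i) \<Rightarrow> (nat \<Rightarrow> 'x \<Rightarrow> ('i, 'x) instr)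
     \<Rightarrow> 'v \<Rightarrow> ('v, 'e) table \<times> ('v \<Rightarrow> 'x) \<Rightarrow> ('i, 'x) instr" where
  "load_instr G adr ker mom t = (\<lambda>(T, y). case source T of
       Edge e \<Rightarrow> Input (adr (Entry (source T) y)) (ker e (y (head G e)))
     | _ \<Rightarrow> mom (adr (Entry (source T) y)) (y t))"

definition load_prog ::
  "real ^ 'd ^ 'd::finite \<Rightarrow> nat \<Rightarrow> ('v, 'e) pre_digraph \<Rightarrow> (('v, 'e, real ^ 'd) slot \<Rightarrow> nat)
     \<Rightarrow> ('e \<Rightarrow> real ^ 'd \<Rightarrow> 'i) \<Rightarrow> (nat \<Rightarrow> real ^ 'd \<Rightarrow> ('i, real ^ 'd) instr) \<Rightarrow> 'v \<Rightarrow> 'v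
     \<Rightarrow> ('i, real ^ 'd) instr list" where
  "load_prog A n G adr ker mom s t = map (load_instr G adr ker mom t)
     (enum (SIGMA T:set (initial_tables G s t). entries A n T))"

text \<open>In the end only \<open>s\<close> is left, at its position \<open>0\<close>.\<close>

definition final_prog ::
  "real ^ 'd ^ 'd::finite \<Rightarrow> nat \<Rightarrow> (('v, 'e, real ^ 'd) slot \<Rightarrow> nat) \<Rightarrow> 'v \<Rightarrow> ('v, 'e) table list
     \<Rightarrow> ('i, real ^ 'd) instr list" where
  "final_prog A n adr s L =
     product_prog (adr Accumulator) (map (\<lambda>T. reg A n adr T ((\<lambda>_. undefined)(s := 0))) L)"

definition fourier_prog ::
  "real ^ 'd ^ 'd::finite \<Rightarrow> nat \<Rightarrow> (('v, 'e, real ^ 'd) slot \<Rightarrow> nat) \<Rightarrow> 'v \<Rightarrow> 'v \<Rightarrow> ('v, 'e) table list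
     \<Rightarrow> ('i, real ^ 'd) instr list" where
  "fourier_prog A n adr s t L =
     concat (map (\<lambda>z. product_prog (adr (Left z))
       (map (\<lambda>T. reg A n adr T ((\<lambda>_. undefined)(t := z, s := 0))) L)) (enum (cell A n))) @
     [Fourier (\<lambda>\<kappa>. adr (Output \<kappa>)) (\<lambda>z. adr (Left z))]"

lemma initial_tables_source_inj:
  "finite (arcs G) \<Longrightarrow> inj_on source (set (initial_tables G s t))"
  by (auto simp: inj_on_def initial_tables_def edge_table_def momentum_table_def)

lemma initial_tables_well_pinned: "T \<in> set (initial_tables G s t) \<Longrightarrow> well_pinned T"
  by (auto simp: well_pinned_def initial_tables_def edge_table_def momentum_table_def)

lemma scopes_initial_tables: "finite (arcs G) \<Longrightarrow> scopes (initial_tables G s t) = initial_scopes G s t"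
proof -
  assume fin: "finite (arcs G)"
  have "mset_set (arcs G) = mset (enum (arcs G))"
    using mset_set_set[OF distinct_enum[OF fin]] by (simp add: set_enum[OF fin])
  then show ?thesis
    by (simp add: scopes_def initial_tables_def initial_scopes_def momentum_table_def edge_table_def
        image_mset.compositionality o_def)
qed

context machine
begin

lemma reg_not_scratch:
  assumes "tables_ok s R L" and "T \<in> set L" and "\<And>w. w \<in> insert s R \<Longrightarrow> x w \<in> cell A n"
    and "S \<subseteq> scratch A n"
  shows "reg A n adr T x \<notin> adr ` S"
proof -
  have T: "T \<in> H" "well_pinned T" "scope T \<subseteq> insert s R" using assms(1,2) by (auto simp: tables_ok_def)
  then have "Entry (source T) (normal A n T x) \<in> slots A n H"
    using assms(3) entries_slots[OF T(1)] normal_in_entries[OF T(2), of x] by blast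
  moreover have "S \<subseteq> slots A n H" using assms(4) scratch_slots by (rule order_trans)
  moreover have "Entry (source T) (normal A n T x) \<notin> S" using assms(4) by (auto simp: scratch_def)
  ultimately show ?thesis unfolding reg_def using adr_mem_iff by blast
qed

lemma final_prog_run:
  assumes "tables_ok s {} L"
  shows "weighted_sum A n adr s w {} L \<sigma>
    = w ((\<lambda>_. undefined)(s := 0)) * exe (final_prog A n adr s L) \<sigma> (adr Accumulator)"
proof -
  let ?x = "(\<lambda>_. undefined)(s := 0) :: 'v \<Rightarrow> real ^ 'd"
  have "reg A n adr T ?x \<notin> adr ` {Accumulator}" if "T \<in> set L" for T
    using reg_not_scratch[OF assms that, of ?x "{Accumulator}"] scratch_members(1) by simp
  then have "adr Accumulator \<noteq> reg A n adr T ?x" if "T \<in> set L" for T using that by fastforce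
  then have "adr Accumulator \<notin> set (map (\<lambda>T. reg A n adr T ?x) L)"
    by (simp add: image_iff)
  then have "exe (final_prog A n adr s L) \<sigma> (adr Accumulator) = (\<Prod>T\<leftarrow>L. \<sigma> (reg A n adr T ?x))"
    unfolding final_prog_def by (simp add: run_product_prog o_def)
  then show ?thesis by (simp add: weighted_sum_def del: fun_upd_apply)
qed

text \<open>For \<open>x s = 0\<close> the displacement from \<open>s\<close> to \<open>t\<close> is the position of \<open>t\<close>, so the weighted sum is a
  discrete Fourier transform in this position.\<close>

lemma fourier_prog_run:
  assumes ok: "tables_ok s {t} L" and st: "s \<noteq> t" and \<kappa>: "\<kappa> \<in> momentum_grid A n" "k \<in> \<kappa>"
  shows "exe (fourier_prog A n adr s t L) \<sigma> (adr (Output \<kappa>))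
    = weighted_sum A n adr s (\<lambda>x. phase k (delta A n (x s) (x t))) {t} L \<sigma>"
proof -
  let ?x = "\<lambda>z. (\<lambda>_. undefined)(t := z, s := 0) :: 'v \<Rightarrow> real ^ 'd"
  let ?rs = "\<lambda>z. map (\<lambda>T. reg A n adr T (?x z)) L"
  let ?f = "\<lambda>z. \<Prod>T\<leftarrow>L. \<sigma> (reg A n adr T (?x z))"
  define P :: "('i, real ^ 'd) instr list" where
    "P = concat (map (\<lambda>z. product_prog (adr (Left z)) (?rs z)) (enum (cell A n)))"
  have left: "Left ` cell A n \<subseteq> scratch A n" by (auto simp: scratch_def)
  have pre: "a \<notin> adr ` Left ` cell A n" if z: "z \<in> cell A n" and a: "a \<in> set (?rs z)" for z a
  proof -
    obtain T where T: "T \<in> set L" "a = reg A n adr T (?x z)" using a by auto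
    show ?thesis unfolding T(2)
    proof (rule reg_not_scratch[OF ok T(1) _ left])
      show "?x z w \<in> cell A n" if "w \<in> insert s {t}" for w using that z by auto
    qed
  qed
  have slot: "Left z \<in> slots A n H" if "z \<in> cell A n" for z
    using left scratch_slots that by blast
  have inj_Left: "inj_on Left (cell A n)" by (auto simp: inj_on_def)
  have "(\<forall>z\<in>cell A n. exe P \<sigma> (adr (Left z)) = (\<Prod>a\<leftarrow>?rs z. \<sigma> a)) \<and>
      (\<forall>q. q \<notin> adr ` Left ` cell A n \<longrightarrow> exe P \<sigma> q = \<sigma> q)"
    unfolding P_def by (rule array_run) (fact slot, fact inj_Left, fact pre)
  then have run: "exe P \<sigma> (adr (Left z)) = ?f z" if "z \<in> cell A n" for z
    using that by (simp add: o_def del: fun_upd_apply)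
  have inj: "inj_on (\<lambda>\<kappa>. adr (Output \<kappa>)) (momentum_grid A n)"
  proof (rule inj_onI)
    fix a b assume ab: "a \<in> momentum_grid A n" "b \<in> momentum_grid A n" "adr (Output a) = adr (Output b)"
    then have "Output a \<in> slots A n H" "Output b \<in> slots A n H" by (auto simp: slots_def)
    then show "a = b" using ab(3) by (simp add: adr_eq_iff)
  qed
  have "exe (fourier_prog A n adr s t L) \<sigma> (adr (Output \<kappa>))
      = (\<Sum>y\<in>cell A n. phase (SOME k. k \<in> \<kappa>) y * exe P \<sigma> (adr (Left y)))"
    using \<kappa>(1) inv_into_f_f[OF inj \<kappa>(1)] by (simp add: fourier_prog_def P_def)
  also have "\<dots> = (\<Sum>y\<in>cell A n. phase k y * ?f y)"
  proof (rule sum.cong[OF refl])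
    fix y assume y: "y \<in> cell A n"
    have "(SOME k. k \<in> \<kappa>) \<in> \<kappa>" using \<kappa>(2) by (rule someI)
    then show "phase (SOME k. k \<in> \<kappa>) y * exe P \<sigma> (adr (Left y)) = phase k y * ?f y"
      using phase_eq_of_grid_class[OF \<kappa>(1) _ \<kappa>(2) y] run[OF y] by simp
  qed
  also have "\<dots> = weighted_sum A n adr s (\<lambda>x. phase k (delta A n (x s) (x t))) {t} L \<sigma>"
    unfolding weighted_sum_def using st
    by (subst sum_PiE_insert) (simp_all cong: sum.cong)
  finally show ?thesis .
qed

lemma load_prog_run:
  assumes fin: "finite (arcs G)" and H: "set (initial_tables G s t) \<subseteq> H"
    and ker: "\<And>e x. e \<in> arcs G \<Longrightarrow> inp (ker e x) = K e x"
    and mom: "\<And>r z \<sigma>. exec A n inp (mom r z) \<sigma> = \<sigma>(r := m z)"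
    and T: "T \<in> set (initial_tables G s t)" and y: "y \<in> entries A n T"
  shows "exe (load_prog A n G adr ker mom s t) \<sigma> (adr (Entry (source T) y))
    = (case source T of Edge e \<Rightarrow> K e (y (head G e)) | _ \<Rightarrow> m (y t))"
proof -
  let ?S = "SIGMA T:set (initial_tables G s t). entries A n T"
  let ?r = "\<lambda>(T, y). adr (Entry (source T) y)"
  let ?f = "\<lambda>p (\<sigma> :: nat \<Rightarrow> complex). case p of (T, y) \<Rightarrow>
    (case source T of Edge e \<Rightarrow> K e (y (head G e)) | _ \<Rightarrow> m (y t))"
  let ?P = "\<lambda>p. [load_instr G adr ker mom t p]"
  have "finite ?S"
  proof (rule finite_SigmaI)
    fix T assume "T \<in> set (initial_tables G s t)"
    then have "well_pinned T" by (rule initial_tables_well_pinned)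
    then show "finite (entries A n T)" by (intro finite_pinned_configs) (simp add: well_pinned_def)
  qed simp
  then have set: "(\<Union>p\<in>set (enum ?S). {p}) = ?S" by (simp add: set_enum)
  have run: "exe (?P (T, y)) \<sigma> = \<sigma>(?r (T, y) := ?f (T, y) \<sigma>)" if "T \<in> set (initial_tables G s t)" for T y \<sigma>
    using that ker mom
    by (auto simp: load_instr_def initial_tables_def edge_table_def momentum_table_def set_enum[OF fin]
        split: source.split)
  have loop: "(\<forall>p\<in>(\<Union>p\<in>set (enum ?S). {p}). exe (concat (map ?P (enum ?S))) \<sigma> (?r p) = ?f p \<sigma>) \<and>
    (\<forall>q. q \<notin> ?r ` (\<Union>p\<in>set (enum ?S). {p}) \<union> {} \<longrightarrow> exe (concat (map ?P (enum ?S))) \<sigma> q = \<sigma> q)"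
  proof (rule run_loop)
    show "inj_on ?r (\<Union>p\<in>set (enum ?S). {p})"
      unfolding set
    proof (rule inj_onI)
      fix p q assume p: "p \<in> ?S" and q: "q \<in> ?S" and eq: "?r p = ?r q"
      have slot: "Entry (source (fst p)) (snd p) \<in> slots A n H" if "p \<in> ?S" for p
        using that H entries_slots by fastforce
      have "Entry (source (fst p)) (snd p) = Entry (source (fst q)) (snd q)"
        using eq slot[OF p] slot[OF q] by (simp add: adr_eq_iff case_prod_unfold)
      then show "p = q"
        using inj_onD[OF initial_tables_source_inj[OF fin, of s t], of "fst p" "fst q"] p q
        by (auto simp: prod_eq_iff)
    qed
    show "exe (?P p) \<sigma> (?r p') = ?f p' \<sigma>" if "p \<in> set (enum ?S)" "p' \<in> {p}" for p p' \<sigma>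
    proof -
      have "p \<in> ?S" using that(1) set by blast
      then obtain T y where "p = (T, y)" "T \<in> set (initial_tables G s t)" by blast
      then show ?thesis using that(2) run[of T y \<sigma>] by simp
    qed
    show "exe (?P p) \<sigma> q = \<sigma> q" if "p \<in> set (enum ?S)" "q \<notin> ?r ` {p} \<union> {}" for p \<sigma> q
    proof -
      have "p \<in> ?S" using that(1) set by blast
      then obtain T y where "p = (T, y)" "T \<in> set (initial_tables G s t)" by blast
      then show ?thesis using that(2) run[of T y \<sigma>] by simp
    qed
  qed auto
  have prog: "concat (map ?P (enum ?S)) = load_prog A n G adr ker mom s t"
  proof -
    have "concat (map (\<lambda>p. [g p]) ps) = map g ps" for g :: "'p \<Rightarrow> 'q" and ps by (induction ps) simp_all
    then show ?thesis unfolding load_prog_def .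
  qed
  have "(T, y) \<in> (\<Union>p\<in>set (enum ?S). {p})" unfolding set using T y by blast
  from bspec[OF conjunct1[OF loop] this] show ?thesis unfolding prog by simp
qed

lemma initial_tables_scope:
  assumes "fin_digraph G" and "s \<in> verts G" and "t \<in> verts G" and "T \<in> set (initial_tables G s t)"
  shows "scope T \<subseteq> verts G"
proof -
  interpret fin_digraph G by fact
  show ?thesis
    using assms(2-4) by (auto simp: initial_tables_def edge_table_def momentum_table_def set_enum)
qed

lemma initial_tables_ok:
  assumes "fin_digraph G" and H: "set (initial_tables G s t) \<subseteq> H"
    and "s \<in> verts G" and "t \<in> verts G"
  shows "tables_ok s (verts G - {s}) (initial_tables G s t)"
  unfolding tables_ok_def
proof (intro ballI conjI)
  fix T assume T: "T \<in> set (initial_tables G s t)"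
  show "T \<in> H" using H T by (rule subsetD)
  show "well_pinned T" using T by (rule initial_tables_well_pinned)
  show "scope T \<subseteq> insert s (verts G - {s})"
    using initial_tables_scope[OF assms(1,3,4) T] by auto
  show "source T \<noteq> Message v" for v
    using T by (auto simp: initial_tables_def edge_table_def momentum_table_def)
qed

text \<open>The weight and the contents of the momentum table share the momentum factor between them.\<close>

lemma load_prog_weighted_sum:
  assumes G: "fin_digraph G" and H: "set (initial_tables G s t) \<subseteq> H"
    and s: "s \<in> verts G" and t: "t \<in> verts G"
    and ker: "\<And>e x. e \<in> arcs G \<Longrightarrow> inp (ker e x) = K e x"
    and mom: "\<And>r z \<sigma>. exec A n inp (mom r z) \<sigma> = \<sigma>(r := m z)"
    and w: "\<And>x. w x * m (delta A n (x s) (x t)) = phase k (delta A n (x s) (x t))"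
  shows "weighted_sum A n adr s w (verts G - {s}) (initial_tables G s t)
      (exe (load_prog A n G adr ker mom s t) \<sigma>) = torus_sum A n G K s t s k"
proof -
  interpret fin_digraph G by (fact G)
  let ?\<tau> = "exe (load_prog A n G adr ker mom s t) \<sigma>"
  note scope = initial_tables_scope[OF G s t]
  have load: "?\<tau> (adr (Entry (source T) y)) = (case source T of Edge e \<Rightarrow> K e (y (head G e)) | _ \<Rightarrow> m (y t))"
    if "T \<in> set (initial_tables G s t)" "y \<in> entries A n T" for T y
    by (rule load_prog_run[OF finite_arcs H]) (fact ker, fact mom, fact that, fact that)
  show "weighted_sum A n adr s w (verts G - {s}) (initial_tables G s t) ?\<tau> = torus_sum A n G K s t s k"
    unfolding weighted_sum_def torus_sum_def Let_def
  proof (rule sum.cong[OF refl])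
    fix x0 assume x0: "x0 \<in> (verts G - {s}) \<rightarrow>\<^sub>E cell A n"
    define x where "x = x0(s := 0)"
    have x: "x v \<in> cell A n" if "v \<in> verts G" for v
      unfolding x_def by (rule config_in_cell[OF x0]) (use that in blast)
    have val: "?\<tau> (reg A n adr T x)
        = (case source T of Edge e \<Rightarrow> K e (normal A n T x (head G e)) | _ \<Rightarrow> m (normal A n T x t))"
      if "T \<in> set (initial_tables G s t)" for T
      unfolding reg_def
    proof (rule load[OF that])
      show "normal A n T x \<in> entries A n T"
        by (intro normal_in_entries initial_tables_well_pinned[OF that] x) (rule subsetD[OF scope[OF that]])
    qed
    have edge: "?\<tau> (reg A n adr (edge_table G e) x) = K e (delta A n (x (tail G e)) (x (head G e)))"
      if "e \<in> arcs G" for e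
      using val[of "edge_table G e"] that
      by (simp add: initial_tables_def set_enum) (simp add: edge_table_def normal_def)
    have momentum: "?\<tau> (reg A n adr (momentum_table s t) x) = m (delta A n (x s) (x t))"
      using val[of "momentum_table s t"]
      by (simp add: initial_tables_def) (simp add: momentum_table_def normal_def)
    have "(\<Prod>T\<leftarrow>initial_tables G s t. ?\<tau> (reg A n adr T x))
        = m (delta A n (x s) (x t)) * (\<Prod>e\<leftarrow>enum (arcs G). ?\<tau> (reg A n adr (edge_table G e) x))"
      by (simp add: initial_tables_def momentum o_def)
    also have "(\<Prod>e\<leftarrow>enum (arcs G). ?\<tau> (reg A n adr (edge_table G e) x))
        = (\<Prod>e\<in>arcs G. K e (delta A n (x (tail G e)) (x (head G e))))"
      by (simp add: prod.distinct_set_conv_list[symmetric] distinct_enum set_enum edge)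
    finally show "w (x0(s := 0)) * (\<Prod>T\<leftarrow>initial_tables G s t. ?\<tau> (reg A n adr T (x0(s := 0))))
        = phase k (delta A n ((x0(s := 0)) s) ((x0(s := 0)) t)) *
          (\<Prod>e\<in>arcs G. K e (delta A n ((x0(s := 0)) (tail G e)) ((x0(s := 0)) (head G e))))"
      unfolding x_def[symmetric] using w[of x] by (simp add: mult.assoc[symmetric])
  qed
qed

end

section \<open>Registers\<close>

definition used :: "real ^ 'd ^ 'd::finite \<Rightarrow> nat \<Rightarrow> ('i, real ^ 'd) instr list \<Rightarrow> nat set" where
  "used A n P = (\<Union>c\<in>set P. registers A n c)"

lemma used_simps [simp]:
  "used A n [] = {}" "used A n (c # P) = registers A n c \<union> used A n P"
  "used A n (P @ Q) = used A n P \<union> used A n Q"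
  "used A n (concat (map g xs)) = (\<Union>x\<in>set xs. used A n (g x))"
  by (auto simp: used_def)

lemma used_product_prog [simp]: "used A n (product_prog r rs) = insert r (set rs)"
  by (auto simp: used_def product_prog_def)

context machine
begin

lemma reg_in_slots:
  assumes "T \<in> H" and "well_pinned T" and "\<And>w. w \<in> scope T \<Longrightarrow> x w \<in> cell A n"
  shows "reg A n adr T x \<in> adr ` slots A n H"
  unfolding reg_def
  by (intro imageI subsetD[OF entries_slots[OF assms(1)]] normal_in_entries assms(2,3))

abbreviation in_slots :: "('i, real ^ 'd) instr list \<Rightarrow> bool" where
  "in_slots P \<equiv> used A n P \<subseteq> adr ` slots A n H"

lemma array_used:
  assumes "\<And>z. z \<in> cell A n \<Longrightarrow> c z \<in> scratch A n"
    and "\<And>z a. z \<in> cell A n \<Longrightarrow> a \<in> set (rs z) \<Longrightarrow> a \<in> adr ` slots A n H"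
  shows "in_slots (concat (map (\<lambda>z. product_prog (adr (c z)) (rs z)) (enum (cell A n))))"
proof -
  have "adr (c z) \<in> adr ` slots A n H" if "z \<in> cell A n" for z
    by (intro imageI subsetD[OF scratch_slots] assms(1) that)
  then show ?thesis using assms(2) by (auto simp: set_enum[OF finite_cell])
qed

lemma load_prog_used:
  assumes fin: "finite (arcs G)" and H: "set (initial_tables G s t) \<subseteq> H"
    and mom: "\<And>r z. registers A n (mom r z) = {r}"
  shows "in_slots (load_prog A n G adr ker mom s t)"
proof -
  let ?S = "SIGMA T:set (initial_tables G s t). entries A n T"
  have "finite ?S"
  proof (rule finite_SigmaI)
    fix T assume "T \<in> set (initial_tables G s t)"
    then have "well_pinned T" by (rule initial_tables_well_pinned)
    then show "finite (entries A n T)" by (intro finite_pinned_configs) (simp add: well_pinned_def)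
  qed simp
  then have "set (enum ?S) = ?S" by (rule set_enum)
  moreover have "registers A n (load_instr G adr ker mom t (T, y)) = {adr (Entry (source T) y)}" for T y
    by (simp add: load_instr_def mom split: source.split)
  moreover have "adr (Entry (source T) y) \<in> adr ` slots A n H"
    if "T \<in> set (initial_tables G s t)" "y \<in> entries A n T" for T y
    by (intro imageI subsetD[OF entries_slots[OF subsetD[OF H that(1)]]] that(2))
  ultimately show ?thesis by (auto simp: used_def load_prog_def)
qed

lemma final_prog_used:
  assumes ok: "tables_ok s {} L"
  shows "in_slots (final_prog A n adr s L)"
proof -
  have "reg A n adr T ((\<lambda>_. undefined)(s := 0)) \<in> adr ` slots A n H" if "T \<in> set L" for T
    using ok that by (intro reg_in_slots) (auto simp: tables_ok_def)
  moreover have "adr Accumulator \<in> adr ` slots A n H"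
    by (intro imageI subsetD[OF scratch_slots] scratch_members(1))
  ultimately show ?thesis unfolding final_prog_def used_product_prog by auto
qed

lemma fourier_prog_used:
  assumes ok: "tables_ok s {t} L"
  shows "in_slots (fourier_prog A n adr s t L)"
proof -
  have reg: "reg A n adr T ((\<lambda>_. undefined)(t := z, s := 0)) \<in> adr ` slots A n H"
    if "T \<in> set L" "z \<in> cell A n" for T z
    using ok that by (intro reg_in_slots) (auto simp: tables_ok_def)
  have "used A n (concat (map (\<lambda>z. product_prog (adr (Left z))
       (map (\<lambda>T. reg A n adr T ((\<lambda>_. undefined)(t := z, s := 0))) L)) (enum (cell A n)))
         :: ('i, real ^ 'd) instr list) \<subseteq> adr ` slots A n H"
  proof (rule array_used)
    fix z a assume z: "z \<in> cell A n"
      and "a \<in> set (map (\<lambda>T. reg A n adr T ((\<lambda>_. undefined)(t := z, s := 0))) L)"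
    then show "a \<in> adr ` slots A n H" using reg by (auto simp del: fun_upd_apply)
  qed (auto simp: scratch_def)
  moreover have "(\<lambda>\<kappa>. adr (Output \<kappa>)) ` momentum_grid A n \<subseteq> adr ` slots A n H"
    by (auto simp: slots_def)
  moreover have "(\<lambda>z. adr (Left z)) ` cell A n \<subseteq> adr ` slots A n H"
    by (intro image_subsetI imageI subsetD[OF scratch_slots] scratch_members)
  ultimately show ?thesis unfolding fourier_prog_def by (simp only: used_simps registers.simps Un_subset_iff) simp
qed

end

context message_step
begin

lemma entry_in_slots: "y \<in> entries A n T \<Longrightarrow> adr (Entry (source T) y) \<in> adr ` slots A n H"
  by (intro imageI subsetD[OF entries_slots[OF target(1)]])

lemma bucket_reg_in_slots:
  assumes "T' \<in> set B" and "\<And>w. w \<in> scope T' \<Longrightarrow> x w \<in> cell A n"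
  shows "reg A n adr T' x \<in> adr ` slots A n H"
  using bucket[OF assms(1)] assms(2) by (intro reg_in_slots) auto

lemma direct_prog_used: "in_slots (direct_prog A n adr B v T)"
proof -
  have fin: "finite (entries A n T)"
    using target(2) by (intro finite_pinned_configs) (simp add: well_pinned_def)
  have acc: "adr Accumulator \<in> adr ` slots A n H"
    by (intro imageI subsetD[OF scratch_slots] scratch_members(1))
  have reg: "reg A n adr T' (y(v := z)) \<in> adr ` slots A n H"
    if "y \<in> entries A n T" "z \<in> cell A n" "T' \<in> set B" for y z T'
    using that pinned_configs_in_cell[OF that(1)] by (intro bucket_reg_in_slots update_in_cell)
  have "used A n (direct_block A n adr B v (adr (Entry (source T) y)) y :: ('i, real ^ 'd) instr list)
      \<subseteq> adr ` slots A n H" if "y \<in> entries A n T" for y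
    using entry_in_slots[OF that] acc reg[OF that]
    by (auto simp: direct_block_def set_enum[OF finite_cell] simp del: fun_upd_apply)
  then show ?thesis by (auto simp: direct_prog_def set_enum[OF fin])
qed

lemma conv_prog_used:
  assumes u: "u \<in> scope T" "u \<noteq> pin T"
  shows "in_slots (conv_prog A n adr B v u T)"
proof -
  let ?base = "pinned_configs A n {pin T, u} (scope T)"
  have fin: "finite ?base"
    using target(2) by (intro finite_pinned_configs) (simp add: well_pinned_def)
  have "used A n (conv_block A n adr B v u T y :: ('i, real ^ 'd) instr list) \<subseteq> adr ` slots A n H"
    if y: "y \<in> ?base" for y
  proof -
    have upd: "y(u := x) \<in> entries A n T" if "x \<in> cell A n" for x
      using that y u by (auto simp: pinned_configs_def PiE_iff extensional_def)
    have "used A n (concat (map (\<lambda>z. product_prog (adr (Left z))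
       (map (\<lambda>T'. reg A n adr T' (y(v := z))) (filter (\<lambda>T'. \<not> u \<in> scope T') B))) (enum (cell A n)))
         :: ('i, real ^ 'd) instr list) \<subseteq> adr ` slots A n H"
    proof (rule array_used)
      fix z a assume z: "z \<in> cell A n"
        and "a \<in> set (map (\<lambda>T'. reg A n adr T' (y(v := z))) (filter (\<lambda>T'. \<not> u \<in> scope T') B))"
      then obtain T' where T': "T' \<in> set B" "a = reg A n adr T' (y(v := z))" by auto
      show "a \<in> adr ` slots A n H"
        unfolding T'(2) using T'(1) z pinned_configs_in_cell[OF y]
        by (intro bucket_reg_in_slots update_in_cell)
    qed (auto simp: scratch_def)
    moreover have "used A n (concat (map (\<lambda>z. product_prog (adr (Right z))
       (map (\<lambda>T'. reg A n adr T' ((\<lambda>_. 0)(u := z))) (filter (\<lambda>T'. u \<in> scope T') B))) (enum (cell A n)))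
         :: ('i, real ^ 'd) instr list) \<subseteq> adr ` slots A n H"
    proof (rule array_used)
      fix z a assume z: "z \<in> cell A n"
        and "a \<in> set (map (\<lambda>T'. reg A n adr T' ((\<lambda>_. 0)(u := z))) (filter (\<lambda>T'. u \<in> scope T') B))"
      then obtain T' where T': "T' \<in> set B" "a = reg A n adr T' ((\<lambda>_. 0)(u := z))" by auto
      show "a \<in> adr ` slots A n H"
        unfolding T'(2) using T'(1) z by (intro bucket_reg_in_slots) auto
    qed (auto simp: scratch_def)
    moreover have "(\<lambda>x. adr (Entry (source T) (y(u := x)))) ` cell A n \<subseteq> adr ` slots A n H"
      by (intro image_subsetI entry_in_slots upd)
    moreover have "(\<lambda>z. adr (Left z)) ` cell A n \<subseteq> adr ` slots A n H"
      by (intro image_subsetI imageI subsetD[OF scratch_slots] scratch_members)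
    moreover have "(\<lambda>z. adr (Right z)) ` cell A n \<subseteq> adr ` slots A n H"
      by (intro image_subsetI imageI subsetD[OF scratch_slots] scratch_members)
    ultimately show ?thesis unfolding conv_block_def by (simp only: used_simps registers.simps Un_subset_iff) simp
  qed
  then show ?thesis by (auto simp: conv_prog_def set_enum[OF fin])
qed

end

context machine
begin

lemma elim_prog_used:
  assumes "distinct vs" and "set vs \<inter> R = {}" and "s \<notin> set vs"
    and "tables_ok s (set vs \<union> R) L" and "all_tables L vs \<subseteq> H"
  shows "in_slots (elim_prog A n adr L vs)"
  using assms
proof (induction vs arbitrary: L)
  case (Cons v vs)
  let ?M = "message v (scopes L) :: ('v, 'e) table"
  have "?M \<in> set (next_tables v L)" by (simp add: next_tables_def)
  then have H: "?M \<in> H"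
    using Cons.prems(5) set_subset_all_tables[of "next_tables v L" vs] by auto
  have ok: "tables_ok s (insert v (set vs \<union> R)) L" using Cons.prems(4) by simp
  have v: "v \<notin> set vs \<union> R" "v \<noteq> s" using Cons.prems(1-3) by auto
  interpret message_step A n adr H inp "bucket_tables v L" v ?M
    by (rule message_ok(3)[OF ok v H])
  have "in_slots (step_prog A n adr L v)"
    using direct_prog_used conv_prog_used pin_message_neq_conv_vertex[of v "scopes L"]
    by (simp add: step_prog_def)
  moreover have "in_slots (elim_prog A n adr (next_tables v L) vs)"
    using Cons.prems message_ok(2)[OF ok v H] by (intro Cons.IH) auto
  ultimately show ?case by simp
qed simp

end


section \<open>Operations\<close>

lemma operations_simps [simp]:
  "operations F A n [] = 0"
  "operations F A n (c # P) = (if is_fft c then F (card (cell A n)) else 1) + operations F A n P"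
  "operations F A n (P @ Q) = operations F A n P + operations F A n Q"
  "operations F A n (concat (map g xs)) = (\<Sum>x\<leftarrow>xs. operations F A n (g x))"
proof -
  show "operations F A n (concat (map g xs)) = (\<Sum>x\<leftarrow>xs. operations F A n (g x))"
    by (induction xs) (simp_all add: operations_def)
qed (simp_all add: operations_def)

lemma operations_map:
  assumes "\<And>x. \<not> is_fft (g x)"
  shows "operations F A n (map g xs) = length xs"
  using assms by (induction xs) auto

lemma operations_product_prog [simp]: "operations F A n (product_prog r rs) = 1 + length rs"
  by (simp add: product_prog_def operations_map)

context torus
begin

text \<open>The two terms account for the direct steps, whose scopes have at most \<open>q\<close> vertices, and for the
  convolutional ones, with at most \<open>d\<close> vertices and one FFT per \<open>N\<close> entries of the table.\<close>

definition cost_bound :: "nat \<Rightarrow> nat \<Rightarrow> (nat \<Rightarrow> nat) \<Rightarrow> nat" where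
  "cost_bound d q F = N ^ q + N ^ (d - 2) * (N + F N)"

lemma pow_mono: "i \<le> j \<Longrightarrow> N ^ i \<le> N ^ j"
  by (rule power_increasing[OF _ card_cell_pos])

lemma direct_prog_operations:
  fixes adr :: "('v, 'e, real ^ 'd) slot \<Rightarrow> nat"
  assumes T: "well_pinned T" and q: "card (scope T) \<le> q" "1 \<le> q" and B: "length B \<le> l"
  shows "operations F A n (direct_prog A n adr B v T :: ('i, real ^ 'd) instr list) \<le> (3 + 2 * l) * N ^ q"
proof -
  have fin: "finite (entries A n T)" using T by (intro finite_pinned_configs) (simp add: well_pinned_def)
  have "operations F A n (direct_prog A n adr B v T :: ('i, real ^ 'd) instr list)
      = N ^ (card (scope T) - 1) * (1 + N * (2 + length B))"
    by (simp add: direct_prog_def direct_block_def sum_list_triv length_enum[OF fin]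
        length_enum[OF finite_cell] card_entries[OF T])
  also have "\<dots> \<le> N ^ (card (scope T) - 1) * (N * (3 + 2 * l))"
  proof (rule mult_left_mono)
    have "1 + N * (2 + length B) \<le> N * 1 + N * (2 + l)"
      using card_cell_pos B by (intro add_mono mult_left_mono) auto
    also have "\<dots> \<le> N * (3 + 2 * l)" by (simp add: algebra_simps)
    finally show "1 + N * (2 + length B) \<le> N * (3 + 2 * l)" .
  qed simp
  also have "\<dots> = (3 + 2 * l) * N ^ (Suc (card (scope T) - 1))" by simp
  also have "\<dots> \<le> (3 + 2 * l) * N ^ q"
    using q by (intro mult_left_mono pow_mono) auto
  finally show ?thesis .
qed

lemma conv_prog_operations:
  fixes adr :: "('v, 'e, real ^ 'd) slot \<Rightarrow> nat"
  assumes T: "well_pinned T" and u: "u \<in> scope T" "u \<noteq> pin T" and d: "card (scope T) \<le> d"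
    and B: "length B \<le> l"
  shows "operations F A n (conv_prog A n adr B v u T :: ('i, real ^ 'd) instr list)
    \<le> (3 + 2 * l) * (N ^ (d - 2) * (N + F N))"
proof -
  let ?base = "pinned_configs A n {pin T, u} (scope T)"
  have fin: "finite ?base" "finite (scope T)"
    using T by (auto intro!: finite_pinned_configs simp: well_pinned_def)
  have "pin T \<in> scope T" using T u by (auto simp: well_pinned_def)
  then have "card (scope T - {pin T, u}) = card (scope T) - 2"
    using u fin(2) by (subst card_Diff_subset) auto
  then have card: "card ?base = N ^ (card (scope T) - 2)" by (simp add: card_pinned_configs fin(2))
  have len: "length (filter Q B) \<le> l" for Q using B length_filter_le order_trans by blast
  let ?c = "N * (1 + length (filter (\<lambda>T'. \<not> u \<in> scope T') B))
      + (N * (1 + length (filter (\<lambda>T'. u \<in> scope T') B)) + F N)"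
  have "operations F A n (conv_prog A n adr B v u T :: ('i, real ^ 'd) instr list)
      = N ^ (card (scope T) - 2) * ?c"
    by (simp add: conv_prog_def conv_block_def sum_list_triv length_enum[OF fin(1)]
        length_enum[OF finite_cell] card)
  also have "\<dots> \<le> N ^ (d - 2) * ((3 + 2 * l) * (N + F N))"
  proof (rule mult_mono)
    show "N ^ (card (scope T) - 2) \<le> N ^ (d - 2)" using d by (intro pow_mono diff_le_mono)
    have "?c \<le> N * (1 + l) + (N * (1 + l) + F N)"
      using len by (intro add_mono mult_left_mono) auto
    also have "\<dots> \<le> (3 + 2 * l) * (N + F N)" by (simp add: algebra_simps)
    finally show "?c \<le> (3 + 2 * l) * (N + F N)" .
  qed simp_all
  finally show ?thesis by (simp only: mult.left_commute)
qed

lemma step_prog_operations: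
  fixes adr :: "('v, 'e, real ^ 'd) slot \<Rightarrow> nat"
  assumes fin: "finite (bucket_scope v (scopes L))"
    and d: "card (bucket_scope v (scopes L)) \<le> d" and "1 \<le> q"
    and q: "convolvable v (scopes L) \<or> card (bucket_scope v (scopes L)) \<le> q"
  shows "operations F A n (step_prog A n adr L v :: ('i, real ^ 'd) instr list)
    \<le> (3 + 2 * length L) * cost_bound d q F"
proof -
  let ?M = "message v (scopes L) :: ('v, 'e) table"
  have M: "well_pinned ?M" using fin by (rule well_pinned_message)
  have len: "length (bucket_tables v L) \<le> length L" by (simp add: bucket_tables_def)
  show ?thesis
  proof (cases "convolvable v (scopes L)")
    case True
    let ?u = "conv_vertex v (scopes L)"
    have u: "?u \<in> bucket_scope v (scopes L)"
      using conv_vertex_partner[OF True] by (simp add: partner_def)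
    then have "bucket_scope v (scopes L) \<noteq> {}" by auto
    then have "pin ?M \<in> bucket_scope v (scopes L)
        - (if convolvable v (scopes L) then {?u} else {})" by (rule pin_message)
    then have "?u \<noteq> pin ?M" using True by auto
    then have "operations F A n (conv_prog A n adr (bucket_tables v L) v ?u ?M :: ('i, real ^ 'd) instr list)
        \<le> (3 + 2 * length L) * (N ^ (d - 2) * (N + F N))"
      using u d by (intro conv_prog_operations M len) simp_all
    also have "\<dots> \<le> (3 + 2 * length L) * cost_bound d q F"
      unfolding cost_bound_def by (rule mult_left_mono) simp_all
    finally show ?thesis using True by (simp add: step_prog_def)
  next
    case False
    have "operations F A n (direct_prog A n adr (bucket_tables v L) v ?M :: ('i, real ^ 'd) instr list)
        \<le> (3 + 2 * length L) * N ^ q"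
      using q False assms(3) by (intro direct_prog_operations M len) simp_all
    also have "\<dots> \<le> (3 + 2 * length L) * cost_bound d q F"
      unfolding cost_bound_def by (rule mult_left_mono) simp_all
    finally show ?thesis using False by (simp add: step_prog_def)
  qed
qed

lemma load_prog_operations:
  assumes fin: "finite (arcs G)" and mom: "\<And>r z. \<not> is_fft (mom r z)" and q: "1 \<le> q"
  shows "operations F A n (load_prog A n G adr ker mom s t :: ('i, real ^ 'd) instr list)
    \<le> Suc (card (arcs G)) * cost_bound d q F"
proof -
  let ?L = "initial_tables G s t"
  let ?S = "SIGMA T:set ?L. entries A n T"
  have entries: "finite (entries A n T)" "card (entries A n T) \<le> N" if "T \<in> set ?L" for T
  proof -
    have wp: "well_pinned T" using that by (rule initial_tables_well_pinned)
    then show "finite (entries A n T)" by (intro finite_pinned_configs) (simp add: well_pinned_def)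
    have "card (scope T) \<le> 2"
      using that by (auto simp: initial_tables_def edge_table_def momentum_table_def card_insert_if)
    then have "card (scope T) - 1 \<le> 1" by simp
    then show "card (entries A n T) \<le> N" using pow_mono by (fastforce simp: card_entries[OF wp])
  qed
  have "operations F A n (load_prog A n G adr ker mom s t :: ('i, real ^ 'd) instr list) = card ?S"
  proof -
    have "\<not> is_fft (load_instr G adr ker mom t p)" for p
      by (simp add: load_instr_def case_prod_unfold mom split: source.split)
    then show ?thesis
      unfolding load_prog_def by (subst operations_map) (auto simp: length_enum finite_SigmaI entries)
  qed
  also have "\<dots> = (\<Sum>T\<in>set ?L. card (entries A n T))" by (rule card_SigmaI) (use entries in auto)
  also have "\<dots> \<le> (\<Sum>T\<in>set ?L. N)" by (rule sum_mono) (rule entries)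
  also have "\<dots> = card (set ?L) * N" by simp
  also have "\<dots> \<le> Suc (card (arcs G)) * cost_bound d q F"
  proof (rule mult_mono)
    have "card (set ?L) \<le> length ?L" by (rule card_length)
    then show "card (set ?L) \<le> Suc (card (arcs G))" by (simp add: initial_tables_def length_enum[OF fin])
    show "N \<le> cost_bound d q F" using pow_mono[OF q] by (simp add: cost_bound_def)
  qed simp_all
  finally show ?thesis .
qed

lemma final_prog_operations:
  "operations F A n (final_prog A n adr s L :: ('i, real ^ 'd) instr list) \<le> (1 + length L) * cost_bound d q F"
proof -
  have "1 \<le> N ^ q" using card_cell_pos by (rule one_le_power)
  then have "1 \<le> cost_bound d q F" unfolding cost_bound_def by (rule trans_le_add1)
  then have "(1 + length L) * 1 \<le> (1 + length L) * cost_bound d q F" by (rule mult_left_mono) simp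
  then show ?thesis by (simp add: final_prog_def)
qed

lemma fourier_prog_operations:
  "operations F A n (fourier_prog A n adr s t L :: ('i, real ^ 'd) instr list)
    \<le> (1 + length L) * cost_bound d q F"
proof -
  have "1 \<le> N ^ (d - 2)" using card_cell_pos by (rule one_le_power)
  then have "1 * (N + F N) \<le> N ^ (d - 2) * (N + F N)" by (rule mult_right_mono) simp
  then have "N + F N \<le> cost_bound d q F" unfolding cost_bound_def mult_1 by (rule trans_le_add2)
  then have "(1 + length L) * (N + F N) \<le> (1 + length L) * cost_bound d q F" by (rule mult_left_mono) simp
  moreover have "N * (1 + length L) + F N \<le> (1 + length L) * (N + F N)" by (simp add: algebra_simps)
  moreover have "operations F A n (fourier_prog A n adr s t L :: ('i, real ^ 'd) instr list)
      = N * (1 + length L) + F N"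
    by (simp add: fourier_prog_def sum_list_triv length_enum[OF finite_cell])
  ultimately show ?thesis by linarith
qed

end

abbreviation cheap_steps :: "nat \<Rightarrow> nat \<Rightarrow> 'v set multiset \<Rightarrow> 'v list \<Rightarrow> bool" where
  "cheap_steps d q \<equiv> all_steps (\<lambda>v Us. card (bucket_scope v Us) \<le> d \<and>
     (convolvable v Us \<or> card (bucket_scope v Us) \<le> q))"

text \<open>The tables, and with them the number of factors of each bucket, do not depend on \<open>n\<close>. So one
  constant suits all \<open>n\<close>.\<close>

lemma elim_prog_operations:
  assumes A: "invertible A" and q: "1 \<le> q" and L: "\<And>T. T \<in> set L \<Longrightarrow> finite (scope T)"
    and steps: "cheap_steps d q (scopes L) vs"
  shows "\<exists>C. \<forall>n\<ge>1. \<forall>adr :: ('v, 'e, real ^ 'd::finite) slot \<Rightarrow> nat.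
    operations F A n (elim_prog A n adr L vs :: ('i, real ^ 'd) instr list)
      \<le> C * torus.cost_bound A n d q F"
  using L steps
proof (induction vs arbitrary: L)
  case (Cons v vs)
  have fin: "finite (bucket_scope v (scopes L))"
    using Cons.prems(1) by (auto simp: bucket_scope_scopes bucket_tables_def)
  have "\<exists>C. \<forall>n\<ge>1. \<forall>adr :: ('v, 'e, real ^ 'd) slot \<Rightarrow> nat.
    operations F A n (elim_prog A n adr (next_tables v L) vs :: ('i, real ^ 'd) instr list)
      \<le> C * torus.cost_bound A n d q F"
  proof (rule Cons.IH)
    show "finite (scope T)" if "T \<in> set (next_tables v L)" for T
      using that fin Cons.prems(1) by (auto simp: next_tables_def)
    show "cheap_steps d q (scopes (next_tables v L)) vs"
      using Cons.prems(2) by (simp add: scopes_next)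
  qed
  then obtain C where C: "\<And>n (adr :: ('v, 'e, real ^ 'd) slot \<Rightarrow> nat). n \<ge> 1 \<Longrightarrow>
    operations F A n (elim_prog A n adr (next_tables v L) vs :: ('i, real ^ 'd) instr list)
      \<le> C * torus.cost_bound A n d q F" by blast
  have "operations F A n (elim_prog A n adr L (v # vs) :: ('i, real ^ 'd) instr list)
      \<le> (3 + 2 * length L + C) * torus.cost_bound A n d q F"
    if n: "n \<ge> 1" for n and adr :: "('v, 'e, real ^ 'd) slot \<Rightarrow> nat"
  proof -
    interpret torus A n using A n by unfold_locales
    have "operations F A n (step_prog A n adr L v :: ('i, real ^ 'd) instr list)
        \<le> (3 + 2 * length L) * cost_bound d q F"
      using Cons.prems(2) by (intro step_prog_operations fin q) simp_all
    then show ?thesis using C[OF n, of adr] by (simp add: algebra_simps)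
  qed
  then show ?case by blast
qed simp

section \<open>Evaluation at one momentum and on the momentum grid\<close>

definition full_prog ::
  "real ^ 'd ^ 'd::finite \<Rightarrow> nat \<Rightarrow> ('v, 'e) pre_digraph \<Rightarrow> (('v, 'e, real ^ 'd) slot \<Rightarrow> nat)
     \<Rightarrow> ('e \<Rightarrow> real ^ 'd \<Rightarrow> 'i) \<Rightarrow> (nat \<Rightarrow> real ^ 'd \<Rightarrow> ('i, real ^ 'd) instr) \<Rightarrow> 'v \<Rightarrow> 'v \<Rightarrow> 'v list
     \<Rightarrow> ('i, real ^ 'd) instr list" where
  "full_prog A n G adr ker mom s t \<pi> =
     load_prog A n G adr ker mom s t @ elim_prog A n adr (initial_tables G s t) \<pi> @
     final_prog A n adr s (fold next_tables \<pi> (initial_tables G s t))"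

text \<open>The ordering ends with \<open>t\<close>, which is left to the Fourier transform.\<close>

definition spectrum_prog ::
  "real ^ 'd ^ 'd::finite \<Rightarrow> nat \<Rightarrow> ('v, 'e) pre_digraph \<Rightarrow> (('v, 'e, real ^ 'd) slot \<Rightarrow> nat)
     \<Rightarrow> ('e \<Rightarrow> real ^ 'd \<Rightarrow> 'i) \<Rightarrow> (nat \<Rightarrow> real ^ 'd \<Rightarrow> ('i, real ^ 'd) instr) \<Rightarrow> 'v \<Rightarrow> 'v \<Rightarrow> 'v list
     \<Rightarrow> ('i, real ^ 'd) instr list" where
  "spectrum_prog A n G adr ker mom s t \<pi> =
     load_prog A n G adr ker mom s t @ elim_prog A n adr (initial_tables G s t) (butlast \<pi>) @
     fourier_prog A n adr s t (fold next_tables (butlast \<pi>) (initial_tables G s t))"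

lemma finite_all_tables: "finite (all_tables L vs)"
  by (induction vs arbitrary: L) auto

lemma all_tables_mono: "all_tables L vs \<subseteq> all_tables L (vs @ ws)"
  using set_subset_all_tables by (induction vs arbitrary: L) auto

lemma all_tables_small:
  assumes "\<And>T. T \<in> set L \<Longrightarrow> well_pinned T \<and> card (scope T) \<le> d"
    and "width_at_most d (scopes L) vs" and "T \<in> all_tables L vs"
  shows "well_pinned T \<and> card (scope T) \<le> d"
  using assms
proof (induction vs arbitrary: L)
  case (Cons v vs)
  show ?case
  proof (cases "T \<in> set L")
    case True
    then show ?thesis using Cons.prems(1) by blast
  next
    case False
    have "finite (bucket_scope v (scopes L))"
      using Cons.prems(1) by (auto simp: bucket_scope_scopes bucket_tables_def well_pinned_def)
    then have "well_pinned T' \<and> card (scope T') \<le> d" if "T' \<in> set (next_tables v L)" for T'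
      using that Cons.prems(1,2) well_pinned_message by (auto simp: next_tables_def)
    moreover have "width_at_most d (scopes (next_tables v L)) vs"
      using Cons.prems(2) by (simp add: scopes_next)
    ultimately show ?thesis using Cons.IH[of "next_tables v L"] Cons.prems(3) False by simp
  qed
qed auto

context machine
begin

context
  fixes G :: "('v, 'e) pre_digraph" and s t :: 'v and \<pi> :: "'v list"
    and ker :: "'e \<Rightarrow> real ^ 'd \<Rightarrow> 'i" and mom :: "nat \<Rightarrow> real ^ 'd \<Rightarrow> ('i, real ^ 'd) instr"
    and K :: "('e, 'd) kernels" and m :: "real ^ 'd \<Rightarrow> complex"
  assumes G: "fin_digraph G" and s: "s \<in> verts G" and t: "t \<in> verts G"
    and \<pi>: "distinct \<pi>" "set \<pi> = verts G - {s}" "s \<noteq> t \<longrightarrow> last \<pi> = t"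
    and H: "all_tables (initial_tables G s t) \<pi> \<subseteq> H"
    and ker: "\<And>e x. e \<in> arcs G \<Longrightarrow> inp (ker e x) = K e x"
    and mom: "\<And>r z \<sigma>. exec A n inp (mom r z) \<sigma> = \<sigma>(r := m z)" "\<And>r z. registers A n (mom r z) = {r}"
begin

lemma initial_H: "set (initial_tables G s t) \<subseteq> H"
  using set_subset_all_tables H by (rule order_trans)

lemma load_ok: "tables_ok s (verts G - {s}) (initial_tables G s t)"
  using G initial_H s t by (rule initial_tables_ok)

lemma s_notin_ordering: "s \<notin> set \<pi>"
  using \<pi>(2) by simp

lemma full_elimination:
  assumes "\<And>v x z. v \<in> set \<pi> \<Longrightarrow> w (x(v := z)) = w x"
  shows "weighted_sum A n adr s w {} (fold next_tables \<pi> (initial_tables G s t))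
      (exe (elim_prog A n adr (initial_tables G s t) \<pi>) \<sigma>)
    = weighted_sum A n adr s w (verts G - {s}) (initial_tables G s t) \<sigma>
    \<and> tables_ok s {} (fold next_tables \<pi> (initial_tables G s t))"
  using eliminate_all[OF \<pi>(1) Int_empty_right s_notin_ordering _ H assms, of \<sigma>] load_ok
  unfolding Un_empty_right \<pi>(2) by blast

lemma full_prog_run:
  assumes "\<And>x. m (delta A n (x s) (x t)) = phase k (delta A n (x s) (x t))"
  shows "exe (full_prog A n G adr ker mom s t \<pi>) \<sigma> (adr Accumulator) = torus_sum A n G K s t s k"
proof -
  let ?L = "initial_tables G s t"
  define \<sigma>\<^sub>1 where "\<sigma>\<^sub>1 = exe (load_prog A n G adr ker mom s t) \<sigma>"
  define \<sigma>\<^sub>2 where "\<sigma>\<^sub>2 = exe (elim_prog A n adr ?L \<pi>) \<sigma>\<^sub>1"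
  have "weighted_sum A n adr s (\<lambda>_. 1) (verts G - {s}) ?L \<sigma>\<^sub>1 = torus_sum A n G K s t s k"
    unfolding \<sigma>\<^sub>1_def
    by (rule load_prog_weighted_sum[OF G initial_H s t]) (fact ker, fact mom(1), simp add: assms)
  moreover have "weighted_sum A n adr s (\<lambda>_. 1) {} (fold next_tables \<pi> ?L) \<sigma>\<^sub>2
      = weighted_sum A n adr s (\<lambda>_. 1) (verts G - {s}) ?L \<sigma>\<^sub>1
      \<and> tables_ok s {} (fold next_tables \<pi> ?L)"
    unfolding \<sigma>\<^sub>2_def by (rule full_elimination) simp
  ultimately have "weighted_sum A n adr s (\<lambda>_. 1) {} (fold next_tables \<pi> ?L) \<sigma>\<^sub>2 = torus_sum A n G K s t s k"
    and ok: "tables_ok s {} (fold next_tables \<pi> ?L)" by simp_all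
  then show ?thesis
    using final_prog_run[OF ok, of "\<lambda>_. 1" \<sigma>\<^sub>2] by (simp add: full_prog_def \<sigma>\<^sub>1_def \<sigma>\<^sub>2_def)
qed

lemma full_prog_used: "in_slots (full_prog A n G adr ker mom s t \<pi>)"
proof -
  let ?L = "initial_tables G s t"
  have "tables_ok s {} (fold next_tables \<pi> ?L)"
    using full_elimination[of "\<lambda>_. 1"] by simp
  then have "in_slots (final_prog A n adr s (fold next_tables \<pi> ?L))"
    by (rule final_prog_used)
  moreover have "in_slots (elim_prog A n adr ?L \<pi>)"
    by (rule elim_prog_used[OF \<pi>(1) Int_empty_right s_notin_ordering _ H]) (simp add: \<pi>(2) load_ok)
  moreover have "in_slots (load_prog A n G adr ker mom s t)"
    using fin_digraph.finite_arcs[OF G] initial_H mom(2) by (rule load_prog_used)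
  ultimately show ?thesis by (simp add: full_prog_def)
qed

context
  assumes st: "s \<noteq> t"
begin

lemma ordering_split: "\<pi> = butlast \<pi> @ [t]"
proof -
  have "t \<in> set \<pi>" unfolding \<pi>(2) using st t by simp
  then have "\<pi> \<noteq> []" by auto
  then have "butlast \<pi> @ [last \<pi>] = \<pi>" by (rule append_butlast_last_id)
  moreover have "last \<pi> = t" using \<pi>(3) st by blast
  ultimately show ?thesis by simp
qed

lemma butlast_ordering:
  "distinct (butlast \<pi>)" "set (butlast \<pi>) \<inter> {t} = {}" "s \<notin> set (butlast \<pi>)"
  "set (butlast \<pi>) \<union> {t} = verts G - {s}" "all_tables (initial_tables G s t) (butlast \<pi>) \<subseteq> H"
proof -
  have "distinct (butlast \<pi> @ [t])" "set (butlast \<pi> @ [t]) = verts G - {s}"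
    unfolding ordering_split[symmetric] by (rule \<pi>)+
  then show "distinct (butlast \<pi>)" "set (butlast \<pi>) \<inter> {t} = {}" "s \<notin> set (butlast \<pi>)"
    "set (butlast \<pi>) \<union> {t} = verts G - {s}" by auto
  show "all_tables (initial_tables G s t) (butlast \<pi>) \<subseteq> H"
    using all_tables_mono[of "initial_tables G s t" "butlast \<pi>" "[t]", unfolded ordering_split[symmetric]] H
    by (rule order_trans)
qed

lemma spectrum_elimination:
  assumes "\<And>v x z. v \<in> set (butlast \<pi>) \<Longrightarrow> w (x(v := z)) = w x"
  shows "weighted_sum A n adr s w {t} (fold next_tables (butlast \<pi>) (initial_tables G s t))
      (exe (elim_prog A n adr (initial_tables G s t) (butlast \<pi>)) \<sigma>)
    = weighted_sum A n adr s w (verts G - {s}) (initial_tables G s t) \<sigma>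
    \<and> tables_ok s {t} (fold next_tables (butlast \<pi>) (initial_tables G s t))"
  using eliminate_all[OF butlast_ordering(1-3) _ butlast_ordering(5) assms, of \<sigma>] load_ok
  unfolding butlast_ordering(4) by blast

lemma spectrum_prog_run:
  assumes m: "\<And>z. m z = 1" and \<kappa>: "\<kappa> \<in> momentum_grid A n" "k \<in> \<kappa>"
  shows "exe (spectrum_prog A n G adr ker mom s t \<pi>) \<sigma> (adr (Output \<kappa>)) = torus_sum A n G K s t s k"
proof -
  let ?L = "initial_tables G s t"
  let ?w = "\<lambda>x :: 'v \<Rightarrow> real ^ 'd. phase k (delta A n (x s) (x t))"
  define \<sigma>\<^sub>1 where "\<sigma>\<^sub>1 = exe (load_prog A n G adr ker mom s t) \<sigma>"
  define \<sigma>\<^sub>2 where "\<sigma>\<^sub>2 = exe (elim_prog A n adr ?L (butlast \<pi>)) \<sigma>\<^sub>1"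
  have "weighted_sum A n adr s ?w (verts G - {s}) ?L \<sigma>\<^sub>1 = torus_sum A n G K s t s k"
    unfolding \<sigma>\<^sub>1_def
    by (rule load_prog_weighted_sum[OF G initial_H s t]) (fact ker, fact mom(1), simp add: m)
  moreover have "weighted_sum A n adr s ?w {t} (fold next_tables (butlast \<pi>) ?L) \<sigma>\<^sub>2
      = weighted_sum A n adr s ?w (verts G - {s}) ?L \<sigma>\<^sub>1
      \<and> tables_ok s {t} (fold next_tables (butlast \<pi>) ?L)"
    unfolding \<sigma>\<^sub>2_def
  proof (rule spectrum_elimination)
    fix v :: 'v and x :: "'v \<Rightarrow> real ^ 'd" and z assume "v \<in> set (butlast \<pi>)"
    then have "v \<noteq> s" "v \<noteq> t" using butlast_ordering(2,3) by auto
    then show "?w (x(v := z)) = ?w x" by simp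
  qed
  ultimately have "weighted_sum A n adr s ?w {t} (fold next_tables (butlast \<pi>) ?L) \<sigma>\<^sub>2
      = torus_sum A n G K s t s k"
    and ok: "tables_ok s {t} (fold next_tables (butlast \<pi>) ?L)" by simp_all
  then show ?thesis
    using fourier_prog_run[OF ok st \<kappa>, of \<sigma>\<^sub>2] by (simp add: spectrum_prog_def \<sigma>\<^sub>1_def \<sigma>\<^sub>2_def)
qed

lemma spectrum_prog_used: "in_slots (spectrum_prog A n G adr ker mom s t \<pi>)"
proof -
  let ?L = "initial_tables G s t"
  have "tables_ok s {t} (fold next_tables (butlast \<pi>) ?L)"
    using spectrum_elimination[of "\<lambda>_. 1"] by blast
  then have "in_slots (fourier_prog A n adr s t (fold next_tables (butlast \<pi>) ?L))"
    by (rule fourier_prog_used)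
  moreover have "in_slots (elim_prog A n adr ?L (butlast \<pi>))"
    by (rule elim_prog_used[OF butlast_ordering(1-3) _ butlast_ordering(5)]) (simp only: butlast_ordering(4) load_ok)
  moreover have "in_slots (load_prog A n G adr ker mom s t)"
    using fin_digraph.finite_arcs[OF G] initial_H mom(2) by (rule load_prog_used)
  ultimately show ?thesis by (simp add: spectrum_prog_def)
qed

end

end

end

lemma full_prog_operations:
  fixes ker :: "'e \<Rightarrow> real ^ 'd::finite \<Rightarrow> 'i" and \<pi> :: "'v list"
  assumes A: "invertible A" and fin: "finite (arcs G)" and mom: "\<And>r z. \<not> is_fft (mom r z)" and q: "1 \<le> q"
    and steps: "cheap_steps d q (initial_scopes G s t) \<pi>"
  shows "\<exists>C. \<forall>n\<ge>1. \<forall>adr. operations F A n (full_prog A n G adr ker mom s t \<pi>)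
    \<le> C * torus.cost_bound A n d q F"
proof -
  let ?L = "initial_tables G s t :: ('v, 'e) table list"
  let ?L' = "fold next_tables \<pi> ?L"
  have "\<exists>C. \<forall>n\<ge>1. \<forall>adr :: ('v, 'e, real ^ 'd) slot \<Rightarrow> nat.
      operations F A n (elim_prog A n adr ?L \<pi> :: ('i, real ^ 'd) instr list) \<le> C * torus.cost_bound A n d q F"
  proof (rule elim_prog_operations[OF A q])
    show "finite (scope T)" if "T \<in> set ?L" for T
      using initial_tables_well_pinned[OF that] by (simp add: well_pinned_def)
  qed (simp only: scopes_initial_tables[OF fin] steps)
  then obtain C where C: "\<And>n (adr :: ('v, 'e, real ^ 'd) slot \<Rightarrow> nat). n \<ge> 1 \<Longrightarrow>
      operations F A n (elim_prog A n adr ?L \<pi> :: ('i, real ^ 'd) instr list) \<le> C * torus.cost_bound A n d q F"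
    by blast
  have "operations F A n (full_prog A n G adr ker mom s t \<pi>)
      \<le> (Suc (card (arcs G)) + C + (1 + length ?L')) * torus.cost_bound A n d q F"
    if n: "n \<ge> 1" for n and adr :: "('v, 'e, real ^ 'd) slot \<Rightarrow> nat"
  proof -
    interpret torus A n using A n by unfold_locales
    have "operations F A n (load_prog A n G adr ker mom s t) \<le> Suc (card (arcs G)) * cost_bound d q F"
      using fin mom q by (rule load_prog_operations)
    moreover have "operations F A n (final_prog A n adr s ?L' :: ('i, real ^ 'd) instr list)
        \<le> (1 + length ?L') * cost_bound d q F"
      by (rule final_prog_operations)
    ultimately show ?thesis using C[OF n, of adr] unfolding full_prog_def operations_simps add_mult_distrib
      by linarith
  qed
  then show ?thesis by blast
qed

lemma spectrum_prog_operations: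
  fixes ker :: "'e \<Rightarrow> real ^ 'd::finite \<Rightarrow> 'i" and \<pi> :: "'v list"
  assumes A: "invertible A" and fin: "finite (arcs G)" and mom: "\<And>r z. \<not> is_fft (mom r z)" and q: "1 \<le> q"
    and steps: "cheap_steps d q (initial_scopes G s t) (butlast \<pi>)"
  shows "\<exists>C. \<forall>n\<ge>1. \<forall>adr. operations F A n (spectrum_prog A n G adr ker mom s t \<pi>)
    \<le> C * torus.cost_bound A n d q F"
proof -
  let ?L = "initial_tables G s t :: ('v, 'e) table list"
  let ?L' = "fold next_tables (butlast \<pi>) ?L"
  have "\<exists>C. \<forall>n\<ge>1. \<forall>adr :: ('v, 'e, real ^ 'd) slot \<Rightarrow> nat.
      operations F A n (elim_prog A n adr ?L (butlast \<pi>) :: ('i, real ^ 'd) instr list)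
        \<le> C * torus.cost_bound A n d q F"
  proof (rule elim_prog_operations[OF A q])
    show "finite (scope T)" if "T \<in> set ?L" for T
      using initial_tables_well_pinned[OF that] by (simp add: well_pinned_def)
  qed (simp only: scopes_initial_tables[OF fin] steps)
  then obtain C where C: "\<And>n (adr :: ('v, 'e, real ^ 'd) slot \<Rightarrow> nat). n \<ge> 1 \<Longrightarrow>
      operations F A n (elim_prog A n adr ?L (butlast \<pi>) :: ('i, real ^ 'd) instr list)
        \<le> C * torus.cost_bound A n d q F"
    by blast
  have "operations F A n (spectrum_prog A n G adr ker mom s t \<pi>)
      \<le> (Suc (card (arcs G)) + C + (1 + length ?L')) * torus.cost_bound A n d q F"
    if n: "n \<ge> 1" for n and adr :: "('v, 'e, real ^ 'd) slot \<Rightarrow> nat"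
  proof -
    interpret torus A n using A n by unfold_locales
    have "operations F A n (load_prog A n G adr ker mom s t) \<le> Suc (card (arcs G)) * cost_bound d q F"
      using fin mom q by (rule load_prog_operations)
    moreover have "operations F A n (fourier_prog A n adr s t ?L' :: ('i, real ^ 'd) instr list)
        \<le> (1 + length ?L') * cost_bound d q F"
      by (rule fourier_prog_operations)
    ultimately show ?thesis using C[OF n, of adr] unfolding spectrum_prog_def operations_simps add_mult_distrib
      by linarith
  qed
  then show ?thesis by blast
qed


section \<open>Asymptotics\<close>

lemma filterlim_card_cell:
  assumes "invertible A"
  shows "filterlim (\<lambda>n. card (cell A n)) at_top at_top"
proof (rule filterlim_at_top_mono[OF filterlim_ident])
  have "n \<le> card (cell A n)" if "n \<ge> 1" for n
  proof -
    interpret torus A n using assms that by unfold_locales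
    show ?thesis by (rule n_le_card_cell)
  qed
  then show "eventually (\<lambda>n. n \<le> card (cell A n)) at_top"
    using eventually_ge_at_top[of 1] by (rule eventually_mono[rotated])
qed

text \<open>Estimates in \<open>N\<close> carry over to \<open>n\<close>, since \<open>N \<ge> n\<close> tends to infinity.\<close>

lemma card_cell_bigo:
  assumes A: "invertible A" and h: "h \<in> O(g)" and f: "\<And>n. n \<ge> 1 \<Longrightarrow> real (f n) \<le> h (card (cell A n))"
  shows "(\<lambda>n. real (f n)) \<in> O(\<lambda>n. g (card (cell A n)) :: real)"
proof -
  have "(\<lambda>n. real (f n)) \<in> O(\<lambda>n. h (card (cell A n)))"
  proof (rule landau_o.big_mono)
    show "eventually (\<lambda>n. norm (real (f n)) \<le> norm (h (card (cell A n)))) at_top"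
      using eventually_ge_at_top[of 1]
    proof eventually_elim
      case (elim n)
      then show ?case using f[of n] by simp
    qed
  qed
  also have "(\<lambda>n. h (card (cell A n))) \<in> O(\<lambda>n. g (card (cell A n)))"
    using landau_o.big.compose[OF h filterlim_card_cell[OF A]] .
  finally show ?thesis .
qed

lemma eventually_one_le_ln: "eventually (\<lambda>N::nat. 1 \<le> ln (real N)) at_top"
  using eventually_ge_at_top[of 3]
proof eventually_elim
  case (elim N)
  have "exp 1 \<le> real N" using exp_le elim by linarith
  then show ?case using elim by (subst ln_ge_iff) auto
qed

lemma bigo_mult_ln: "(\<lambda>N. real N ^ i) \<in> O(\<lambda>N. real N ^ i * ln (real N))"
proof (rule landau_o.big_mono)
  show "eventually (\<lambda>N. norm (real N ^ i) \<le> norm (real N ^ i * ln (real N))) at_top"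
    using eventually_one_le_ln
  proof eventually_elim
    case (elim N)
    then have "real N ^ i * 1 \<le> real N ^ i * ln (real N)" by (intro mult_left_mono) auto
    then show ?case using elim by simp
  qed
qed

lemma mult_ln_bigo: "(\<lambda>N. real N ^ i * ln (real N)) \<in> O(\<lambda>N. real N ^ Suc i)"
proof (rule landau_o.big_mono)
  show "eventually (\<lambda>N. norm (real N ^ i * ln (real N)) \<le> norm (real N ^ Suc i)) at_top"
    using eventually_ge_at_top[of 1]
  proof eventually_elim
    case (elim N)
    then have "0 \<le> ln (real N)" "ln (real N) \<le> real N" using ln_le_minus_one[of "real N"] by auto
    then have "real N ^ i * ln (real N) \<le> real N ^ i * real N" by (intro mult_left_mono) auto
    then show ?case using \<open>0 \<le> ln (real N)\<close> by (simp add: mult.commute)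
  qed
qed

lemma fft_terms_bigo:
  fixes F :: "nat \<Rightarrow> nat"
  assumes F: "(\<lambda>N. real (F N)) \<in> O(\<lambda>N. real N * ln (real N))" and d: "2 \<le> d"
  shows "(\<lambda>N. real N ^ (d - 2) * (real N + real (F N))) \<in> O(\<lambda>N. real N ^ (d - 1) * ln (real N))"
proof -
  have d': "d - 1 = Suc (d - 2)" using d by simp
  have "(\<lambda>N. real N + real (F N)) \<in> O(\<lambda>N. real N * ln (real N))"
    using bigo_mult_ln[of 1] F by (intro sum_in_bigo) simp_all
  then have "(\<lambda>N. real N ^ (d - 2) * (real N + real (F N)))
      \<in> O(\<lambda>N. real N ^ (d - 2) * (real N * ln (real N)))"
    by (intro landau_o.big.mult landau_o.big_refl)
  then show ?thesis unfolding d' by (simp only: power_Suc2 mult.assoc)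
qed

lemma cost_bound_bigo:
  assumes A: "invertible A" and F: "(\<lambda>N. real (F N)) \<in> O(\<lambda>N. real N * ln (real N))" and d: "2 \<le> d"
    and f: "\<And>n. n \<ge> 1 \<Longrightarrow> f n \<le> C * torus.cost_bound A n d q F"
  shows "q = d \<Longrightarrow> (\<lambda>n. real (f n)) \<in> O(\<lambda>n. real (card (cell A n)) ^ d)"
    and "q = d - 1 \<Longrightarrow> (\<lambda>n. real (f n)) \<in> O(\<lambda>n. real (card (cell A n)) ^ (d - 1) * ln (real (card (cell A n))))"
proof -
  define h where "h N = real C * (real N ^ q + real N ^ (d - 2) * (real N + real (F N)))" for N
  have le: "real (f n) \<le> h (card (cell A n))" if n: "n \<ge> 1" for n
  proof -
    interpret torus A n using A n by unfold_locales
    have "real (f n) \<le> real (C * cost_bound d q F)" using f[OF n] by (rule of_nat_mono)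
    then show ?thesis by (simp add: cost_bound_def h_def)
  qed
  note fft = fft_terms_bigo[OF F d]
  have d': "Suc (d - 1) = d" using d by simp
  show "(\<lambda>n. real (f n)) \<in> O(\<lambda>n. real (card (cell A n)) ^ d)" if q: "q = d"
  proof (rule card_cell_bigo[where h = h and f = f, OF A _ le])
    have "(\<lambda>N. real N ^ (d - 2) * (real N + real (F N))) \<in> O(\<lambda>N. real N ^ d)"
      using landau_o.big_trans[OF fft mult_ln_bigo] unfolding d' .
    then show "h \<in> O(\<lambda>N. real N ^ d)"
      unfolding h_def q by (cases "C = 0") (auto intro!: sum_in_bigo)
  qed
  show "(\<lambda>n. real (f n)) \<in> O(\<lambda>n. real (card (cell A n)) ^ (d - 1) * ln (real (card (cell A n))))"
    if q: "q = d - 1"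
  proof (rule card_cell_bigo[where h = h and f = f, OF A _ le])
    show "h \<in> O(\<lambda>N. real N ^ (d - 1) * ln (real N))"
      unfolding h_def q using fft bigo_mult_ln[of "d - 1"]
      by (cases "C = 0") (auto intro!: sum_in_bigo)
  qed
qed

lemma memory_bigo:
  assumes A: "invertible A" and S: "(\<lambda>N. real (S N)) \<in> O(\<lambda>N. real N)" and d: "2 \<le> d"
    and f: "\<And>n. n \<ge> 1 \<Longrightarrow> f n \<le> C * card (cell A n) ^ (d - 1) + S (card (cell A n))"
  shows "(\<lambda>n. real (f n)) \<in> O(\<lambda>n. real (card (cell A n)) ^ (d - 1))"
proof (rule card_cell_bigo[where h = "\<lambda>N. real C * real N ^ (d - 1) + real (S N)" and f = f, OF A])
  have "(\<lambda>N. real N) \<in> O(\<lambda>N. real N ^ (d - 1))"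
  proof (rule landau_o.big_mono)
    show "eventually (\<lambda>N. norm (real N) \<le> norm (real N ^ (d - 1))) at_top"
      using eventually_ge_at_top[of 1]
    proof eventually_elim
      case (elim N)
      then have "real N ^ 1 \<le> real N ^ (d - 1)" using d by (intro power_increasing) auto
      then show ?case by simp
    qed
  qed
  then have "(\<lambda>N. real (S N)) \<in> O(\<lambda>N. real N ^ (d - 1))" using S by (rule landau_o.big_trans[rotated])
  then show "(\<lambda>N. real C * real N ^ (d - 1) + real (S N)) \<in> O(\<lambda>N. real N ^ (d - 1))"
    by (cases "C = 0") (auto intro!: sum_in_bigo)
  show "real (f n) \<le> real C * real (card (cell A n)) ^ (d - 1) + real (S (card (cell A n)))" if "n \<ge> 1" for n
    using of_nat_mono[OF f[OF that], where 'a = real] by simp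
qed


section \<open>Resources of the programs\<close>

text \<open>Any assignment of distinct registers to the slots will do.\<close>

definition address :: "real ^ 'd ^ 'd::finite \<Rightarrow> nat \<Rightarrow> ('v, 'e) table set \<Rightarrow> ('v, 'e, real ^ 'd) slot \<Rightarrow> nat" where
  "address A n H = to_nat_on (slots A n H)"

context machine
begin

lemma memory_le:
  assumes "in_slots P" and "finite H" and "\<And>T. T \<in> H \<Longrightarrow> well_pinned T \<and> card (scope T) \<le> d" and "2 \<le> d"
  shows "memory S A n P \<le> (card H + 4) * N ^ (d - 1) + S N"
proof -
  have fin: "finite (slots A n H)" using assms(2,3) by (intro finite_slots) auto
  have "card (used A n P) \<le> card (adr ` slots A n H)"
    using fin assms(1) by (intro card_mono) auto
  also have "\<dots> \<le> card (slots A n H)" by (rule card_image_le[OF fin])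
  also have "\<dots> \<le> (card H + 4) * N ^ (d - 1)" by (rule card_slots[OF assms(2-4)])
  finally show ?thesis unfolding memory_def used_def by (intro add_mono) auto
qed

end

text \<open>A step whose scope has \<open>d\<close> vertices is one of maximal width, as no scope is larger. A
  translation-invariant factor has scope \<open>{u, v}\<close>, so a convolutional step satisfies a condition on
  the scopes, which do not depend on \<open>n\<close>, the kernels or the momentum.\<close>

lemma convolutional_steps:
  assumes adm: "admissible_ordering G s t \<pi>" and d: "treewidth_st G s t = d" "2 \<le> d"
    and conv: "max_steps_convolutional A n G K s t k \<pi>"
  shows "cheap_steps d (d - 1) (initial_scopes G s t) \<pi>"
  unfolding all_steps_iff
proof (intro allI impI)
  fix j assume j: "j < length \<pi>"
  let ?v = "\<pi> ! j" and ?Us = "scopes_before G s t \<pi> j"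
  have le: "card (step_scope G s t \<pi> i) \<le> d" if "i < length \<pi>" for i
    using adm that d(1) by (simp add: admissible_ordering_def)
  have "convolvable ?v ?Us" if "\<not> card (bucket_scope ?v ?Us) \<le> d - 1"
  proof -
    have card: "card (step_scope G s t \<pi> j) = d"
      using le[OF j] that by (simp add: step_scope_def)
    have "width G s t \<pi> = d"
      unfolding width_def
    proof (rule Max_eqI)
      show "d \<in> (\<lambda>j. card (step_scope G s t \<pi> j)) ` {..<length \<pi>}" using j card by force
    qed (use le in auto)
    then have "convolutional_step A n G K s t k \<pi> j"
      using conv j card by (simp add: max_steps_convolutional_def)
    then obtain u where u: "u \<in> bucket_scope ?v ?Us"
      and inv: "\<And>\<phi>. \<phi> \<in># bucket ?v (factors_before A n G K s t k \<pi> j) \<Longrightarrow> u \<in> fst \<phi> \<Longrightarrow>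
        translation_invariant A n u ?v \<phi>"
      unfolding convolutional_step_def step_scope_def by blast
    have "U = {u, ?v}" if U: "U \<in># ?Us" "?v \<in> U" "u \<in> U" for U
    proof -
      have "U \<in># image_mset fst (factors_before A n G K s t k \<pi> j)"
        using U(1) by (simp only: scopes_before_eq)
      then obtain \<phi> where "\<phi> \<in># factors_before A n G K s t k \<pi> j" "U = fst \<phi>" by auto
      then show ?thesis using inv[of \<phi>] U(2,3) by (simp add: bucket_def translation_invariant_def)
    qed
    then have "partner ?v ?Us u" using u by (auto simp: partner_def)
    then show ?thesis using card d(2) by (auto simp: convolvable_def step_scope_def)
  qed
  then show "card (bucket_scope ?v (fold eliminate_scope (take j \<pi>) (initial_scopes G s t))) \<le> d \<and>
     (convolvable ?v (fold eliminate_scope (take j \<pi>) (initial_scopes G s t)) \<or>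
      card (bucket_scope ?v (fold eliminate_scope (take j \<pi>) (initial_scopes G s t))) \<le> d - 1)"
    using le[OF j] unfolding step_scope_def scopes_before_def by blast
qed

lemma machine_address:
  fixes H :: "('v, 'e) table set"
  assumes "invertible (A :: real ^ 'd ^ 'd::finite)" and "n \<ge> 1" and "finite H" and "\<And>T. T \<in> H \<Longrightarrow> well_pinned T"
  shows "machine A n (address A n H :: ('v, 'e, real ^ 'd) slot \<Rightarrow> nat) H"
proof -
  interpret torus A n using assms(1,2) by unfold_locales
  have "countable (slots A n H :: ('v, 'e, real ^ 'd) slot set)"
    using assms(3,4) by (intro countable_finite finite_slots)
  then show ?thesis
    unfolding address_def by unfold_locales (rule inj_on_to_nat_on)
qed

lemma width_at_most_admissible:
  assumes "admissible_ordering G s t \<pi>"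
  shows "width_at_most (treewidth_st G s t) (initial_scopes G s t) \<pi>"
  using assms by (simp add: all_steps_iff admissible_ordering_def step_scope_def scopes_before_def)

lemma tables_of_admissible:
  assumes "finite (arcs G)" and "admissible_ordering G s t \<pi>" and "2 \<le> treewidth_st G s t"
    and T: "T \<in> all_tables (initial_tables G s t) \<pi>"
  shows "well_pinned T \<and> card (scope T) \<le> treewidth_st G s t"
proof (rule all_tables_small[OF _ _ T])
  fix T' assume T': "T' \<in> set (initial_tables G s t)"
  then have "card (scope T') \<le> 2"
    by (auto simp: initial_tables_def edge_table_def momentum_table_def card_insert_if)
  then show "well_pinned T' \<and> card (scope T') \<le> treewidth_st G s t"
    using initial_tables_well_pinned[OF T'] assms(3) by simp
next
  show "width_at_most (treewidth_st G s t) (scopes (initial_tables G s t)) \<pi>"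
    using width_at_most_admissible[OF assms(2)] by (simp only: scopes_initial_tables[OF assms(1)])
qed

context
  fixes A :: "real ^ 'd ^ 'd::finite" and G :: "('v, 'e) pre_digraph" and s t :: 'v and \<pi> :: "'v list"
    and F S :: "nat \<Rightarrow> nat" and d :: nat
  assumes A: "invertible A" and G: "fin_digraph G" and s: "s \<in> verts G" and t: "t \<in> verts G"
    and adm: "admissible_ordering G s t \<pi>" and d: "d = treewidth_st G s t" "2 \<le> d"
begin

lemma ordering: "distinct \<pi>" "set \<pi> = verts G - {s}" "s \<noteq> t \<longrightarrow> last \<pi> = t"
  using adm by (auto simp: admissible_ordering_def)

definition tables :: "('v, 'e) table set" where "tables = all_tables (initial_tables G s t) \<pi>"

lemma tables_small: "finite tables" "T \<in> tables \<Longrightarrow> well_pinned T \<and> card (scope T) \<le> d"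
  using finite_all_tables tables_of_admissible[OF fin_digraph.finite_arcs[OF G] adm] d
  by (auto simp: tables_def)

lemma all_tables_ordering: "all_tables (initial_tables G s t) \<pi> \<subseteq> tables"
  by (simp add: tables_def)

lemma machine_ordering: "n \<ge> 1 \<Longrightarrow> machine A n (address A n tables) tables"
  using A tables_small by (intro machine_address) auto

lemma single_momentum_program:
  obtains P :: "nat \<Rightarrow> (('e, real ^ 'd) single_input, real ^ 'd) instr list" and out and C
  where "\<And>n K k. n \<ge> 1 \<Longrightarrow> evaluates_at_momentum A n G K s t k (P n) (out n)"
    and "\<And>q. 1 \<le> q \<Longrightarrow> cheap_steps d q (initial_scopes G s t) \<pi> \<Longrightarrow>
      \<exists>C. \<forall>n\<ge>1. operations F A n (P n) \<le> C * torus.cost_bound A n d q F"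
    and "\<And>n. n \<ge> 1 \<Longrightarrow> memory S A n (P n) \<le> C * card (cell A n) ^ (d - 1) + S (card (cell A n))"
proof
  define mom :: "nat \<Rightarrow> real ^ 'd \<Rightarrow> (('e, real ^ 'd) single_input, real ^ 'd) instr" where
    "mom r z = Input r (Phase_Value z)" for r z
  define P where "P n = full_prog A n G (address A n tables) Kernel_Value mom s t \<pi>" for n
  define out where "out n = address A n tables (Accumulator :: ('v, 'e, real ^ 'd) slot)" for n
  show "evaluates_at_momentum A n G K s t k (P n) (out n)" if "n \<ge> 1" for n K k
  proof -
    interpret machine A n "address A n tables" tables "input_values K k" using machine_ordering[OF that] .
    show ?thesis
      unfolding evaluates_at_momentum_def P_def out_def
      by (intro allI full_prog_run[where m = "phase k"] G s t ordering all_tables_ordering) (simp_all add: mom_def)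
  qed
  show "\<exists>C. \<forall>n\<ge>1. operations F A n (P n) \<le> C * torus.cost_bound A n d q F"
    if "1 \<le> q" "cheap_steps d q (initial_scopes G s t) \<pi>" for q
    using full_prog_operations[OF A fin_digraph.finite_arcs[OF G] _ that, of mom F Kernel_Value]
    unfolding P_def by (auto simp: mom_def)
  show "memory S A n (P n) \<le> (card tables + 4) * card (cell A n) ^ (d - 1) + S (card (cell A n))" if "n \<ge> 1" for n
  proof -
    interpret machine A n "address A n tables" tables "input_values (\<lambda>_ _. 0) 0" using machine_ordering[OF that] .
    show ?thesis
      unfolding P_def using tables_small d(2)
      by (intro memory_le full_prog_used[where m = "phase 0" and K = "\<lambda>_ _. 0"] G s t ordering all_tables_ordering)
        (simp_all add: mom_def)
  qed
qed

text \<open>For \<open>s = t\<close> the sum does not depend on the momentum, and one register serves the whole grid.\<close>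

lemma momentum_grid_program:
  obtains P :: "nat \<Rightarrow> ('e \<times> (real ^ 'd), real ^ 'd) instr list" and out and C
  where "\<And>n K. n \<ge> 1 \<Longrightarrow> evaluates_on_grid A n G K s t (P n) (out n)"
    and "\<And>q. 1 \<le> q \<Longrightarrow> cheap_steps d q (initial_scopes G s t) \<pi> \<Longrightarrow>
      \<exists>C. \<forall>n\<ge>1. operations F A n (P n) \<le> C * torus.cost_bound A n d q F"
    and "\<And>n. n \<ge> 1 \<Longrightarrow> memory S A n (P n) \<le> C * card (cell A n) ^ (d - 1) + S (card (cell A n))"
proof (cases "s = t")
  case True
  define mom :: "nat \<Rightarrow> real ^ 'd \<Rightarrow> ('e \<times> (real ^ 'd), real ^ 'd) instr" where
    "mom r z = Const r 1" for r z
  define P where "P n = full_prog A n G (address A n tables) Pair mom s t \<pi>" for n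
  define out where "out n \<kappa> = address A n tables (Accumulator :: ('v, 'e, real ^ 'd) slot)"
    for n and \<kappa> :: "(real ^ 'd) set"
  show thesis
  proof (rule that[of P out "card tables + 4"])
    show "evaluates_on_grid A n G K s t (P n) (out n)" if "n \<ge> 1" for n K
    proof -
      interpret machine A n "address A n tables" tables "\<lambda>(e, x). K e x" using machine_ordering[OF that] .
      show ?thesis
        unfolding evaluates_on_grid_def P_def out_def
        by (intro allI ballI full_prog_run[where m = "\<lambda>_. 1"] G s t ordering all_tables_ordering) (simp_all add: mom_def True)
    qed
    show "\<exists>C. \<forall>n\<ge>1. operations F A n (P n) \<le> C * torus.cost_bound A n d q F"
      if "1 \<le> q" "cheap_steps d q (initial_scopes G s t) \<pi>" for q
      using full_prog_operations[OF A fin_digraph.finite_arcs[OF G] _ that, of mom F Pair]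
      unfolding P_def by (auto simp: mom_def)
    show "memory S A n (P n) \<le> (card tables + 4) * card (cell A n) ^ (d - 1) + S (card (cell A n))"
      if "n \<ge> 1" for n
    proof -
      interpret machine A n "address A n tables" tables "\<lambda>_. 0" using machine_ordering[OF that] .
      show ?thesis
        unfolding P_def using tables_small d(2)
        by (intro memory_le full_prog_used[where m = "\<lambda>_. 1" and K = "\<lambda>_ _. 0"] G s t ordering all_tables_ordering)
          (simp_all add: mom_def)
    qed
  qed
next
  case False
  define mom :: "nat \<Rightarrow> real ^ 'd \<Rightarrow> ('e \<times> (real ^ 'd), real ^ 'd) instr" where
    "mom r z = Const r 1" for r z
  define P where "P n = spectrum_prog A n G (address A n tables) Pair mom s t \<pi>" for n
  define out where "out n \<kappa> = address A n tables (Output \<kappa> :: ('v, 'e, real ^ 'd) slot)" for n \<kappa>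
  show thesis
  proof (rule that[of P out "card tables + 4"])
    show "evaluates_on_grid A n G K s t (P n) (out n)" if "n \<ge> 1" for n K
    proof -
      interpret machine A n "address A n tables" tables "\<lambda>(e, x). K e x" using machine_ordering[OF that] .
      show ?thesis
        unfolding evaluates_on_grid_def P_def out_def
        by (intro allI ballI spectrum_prog_run[where m = "\<lambda>_. 1"] G s t ordering all_tables_ordering False) (simp_all add: mom_def)
    qed
    show "\<exists>C. \<forall>n\<ge>1. operations F A n (P n) \<le> C * torus.cost_bound A n d q F"
      if q: "1 \<le> q" and steps: "cheap_steps d q (initial_scopes G s t) \<pi>" for q
    proof -
      have "t \<in> set \<pi>" unfolding ordering(2) using t False by simp
      then have "\<pi> \<noteq> []" by auto
      then have "butlast \<pi> @ [last \<pi>] = \<pi>" by (rule append_butlast_last_id)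
      then have "cheap_steps d q (initial_scopes G s t) (butlast \<pi> @ [last \<pi>])" using steps by (simp only:)
      then have "cheap_steps d q (initial_scopes G s t) (butlast \<pi>)" unfolding all_steps_append ..
      then show ?thesis
        using spectrum_prog_operations[OF A fin_digraph.finite_arcs[OF G] _ q, of mom d s t \<pi> F Pair]
        unfolding P_def by (auto simp: mom_def)
    qed
    show "memory S A n (P n) \<le> (card tables + 4) * card (cell A n) ^ (d - 1) + S (card (cell A n))"
      if "n \<ge> 1" for n
    proof -
      interpret machine A n "address A n tables" tables "\<lambda>_. 0" using machine_ordering[OF that] .
      show ?thesis
        unfolding P_def using tables_small d(2)
        by (intro memory_le spectrum_prog_used[where m = "\<lambda>_. 1" and K = "\<lambda>_ _. 0"] G s t ordering all_tables_ordering False)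
          (simp_all add: mom_def)
    qed
  qed
qed

end

theorem theorem7p5:
  fixes A :: "real ^ 'd ^ 'd::finite"
    and G :: "('v, 'e) pre_digraph"
    and s t :: 'v
    and fft_ops fft_space :: "nat \<Rightarrow> nat"
  assumes "invertible A"
    and "fin_digraph G" and "loopfree_digraph G"
    and "s \<in> verts G" and "t \<in> verts G"
    and "is_block G"
    and "treewidth G \<ge> 2"
    and "(\<lambda>N. real (fft_ops N)) \<in> O(\<lambda>N. real N * ln (real N))"
    and "(\<lambda>N. real (fft_space N)) \<in> O(\<lambda>N. real N)"
  shows
    "(\<exists>\<pi>. admissible_ordering G s t \<pi>) \<and>
     (\<forall>\<pi>. admissible_ordering G s t \<pi> \<longrightarrow>
        (\<exists>P out.
           (\<forall>n\<ge>1. \<forall>K k. l1_kernels A G K \<longrightarrow>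
              evaluates_at_momentum A n G K s t k (P n) (out n)) \<and>
           (\<lambda>n. real (operations fft_ops A n (P n)))
              \<in> O(\<lambda>n. real (card (cell A n)) ^ treewidth_st G s t) \<and>
           (\<lambda>n. real (memory fft_space A n (P n)))
              \<in> O(\<lambda>n. real (card (cell A n)) ^ (treewidth_st G s t - 1))) \<and>
        (\<exists>P out.
           (\<forall>n\<ge>1. \<forall>K. l1_kernels A G K \<longrightarrow>
              evaluates_on_grid A n G K s t (P n) (out n)) \<and>
           (\<lambda>n. real (operations fft_ops A n (P n)))
              \<in> O(\<lambda>n. real (card (cell A n)) ^ treewidth_st G s t) \<and>
           (\<lambda>n. real (memory fft_space A n (P n)))
              \<in> O(\<lambda>n. real (card (cell A n)) ^ (treewidth_st G s t - 1))) \<and>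
        (\<exists>P out.
           (\<forall>n\<ge>1. \<forall>K k. l1_kernels A G K \<longrightarrow> max_steps_convolutional A n G K s t k \<pi> \<longrightarrow>
              evaluates_at_momentum A n G K s t k (P n) (out n)) \<and>
           (\<lambda>n. real (operations fft_ops A n (P n)))
              \<in> O(\<lambda>n. real (card (cell A n)) ^ (treewidth_st G s t - 1) *
                       ln (real (card (cell A n)))) \<and>
           (\<lambda>n. real (memory fft_space A n (P n)))
              \<in> O(\<lambda>n. real (card (cell A n)) ^ (treewidth_st G s t - 1))) \<and>
        (\<exists>P out.
           (\<forall>n\<ge>1. \<forall>K. l1_kernels A G K \<longrightarrow>
              (\<forall>\<kappa> \<in> momentum_grid A n. \<forall>k \<in> \<kappa>. max_steps_convolutional A n G K s t k \<pi>) \<longrightarrow>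
              evaluates_on_grid A n G K s t (P n) (out n)) \<and>
           (\<lambda>n. real (operations fft_ops A n (P n)))
              \<in> O(\<lambda>n. real (card (cell A n)) ^ (treewidth_st G s t - 1) *
                       ln (real (card (cell A n)))) \<and>
           (\<lambda>n. real (memory fft_space A n (P n)))
              \<in> O(\<lambda>n. real (card (cell A n)) ^ (treewidth_st G s t - 1))))"
proof -
  let ?d = "treewidth_st G s t"
  note fin = fin_digraph.finite_arcs[OF assms(2)]
  have d: "2 \<le> ?d"
    using treewidth_le_treewidth_st[OF assms(2,4,5)] assms(7) by linarith
  note cost = cost_bound_bigo[OF assms(1,8) d]
  show ?thesis (is "?exists \<and> (\<forall>\<pi>. _ \<longrightarrow> ?single \<pi> \<and> ?grid \<pi> \<and> ?single_conv \<pi> \<and> ?grid_conv \<pi>)")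
  proof (rule conjI, goal_cases)
    case 1
    show ?case using assms(2,4,5) by (rule admissible_ordering_exists)
  next
    case 2
    show ?case
    proof (rule allI, rule impI)
      fix \<pi> assume adm: "admissible_ordering G s t \<pi>"
      let ?cheap = "\<lambda>q. cheap_steps ?d q (initial_scopes G s t) \<pi>"
      have cheap: "?cheap ?d"
        using width_at_most_admissible[OF adm] by (simp add: all_steps_iff)
      have conv: "?cheap (?d - 1)" if "max_steps_convolutional A n G K s t k \<pi>" for n K k
        using convolutional_steps[OF adm refl d that] .
      obtain P :: "nat \<Rightarrow> (('e, real ^ 'd) single_input, real ^ 'd) instr list" and out C
        where P: "\<And>n K k. n \<ge> 1 \<Longrightarrow> evaluates_at_momentum A n G K s t k (P n) (out n)"
        and P_ops: "\<And>q. 1 \<le> q \<Longrightarrow> ?cheap q \<Longrightarrow>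
          \<exists>C. \<forall>n\<ge>1. operations fft_ops A n (P n) \<le> C * torus.cost_bound A n ?d q fft_ops"
        and P_mem: "\<And>n. n \<ge> 1 \<Longrightarrow> memory fft_space A n (P n)
          \<le> C * card (cell A n) ^ (?d - 1) + fft_space (card (cell A n))"
        by (rule single_momentum_program[where F = fft_ops and S = fft_space, OF assms(1,2,4,5) adm refl d]) blast
      obtain P' :: "nat \<Rightarrow> ('e \<times> (real ^ 'd), real ^ 'd) instr list" and out' C'
        where P': "\<And>n K. n \<ge> 1 \<Longrightarrow> evaluates_on_grid A n G K s t (P' n) (out' n)"
        and P'_ops: "\<And>q. 1 \<le> q \<Longrightarrow> ?cheap q \<Longrightarrow>
          \<exists>C. \<forall>n\<ge>1. operations fft_ops A n (P' n) \<le> C * torus.cost_bound A n ?d q fft_ops"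
        and P'_mem: "\<And>n. n \<ge> 1 \<Longrightarrow> memory fft_space A n (P' n)
          \<le> C' * card (cell A n) ^ (?d - 1) + fft_space (card (cell A n))"
        by (rule momentum_grid_program[where F = fft_ops and S = fft_space, OF assms(1,2,4,5) adm refl d]) blast
      have d1: "1 \<le> ?d" "1 \<le> ?d - 1" using d by simp_all
      obtain C1 where "\<And>n. n \<ge> 1 \<Longrightarrow> operations fft_ops A n (P n) \<le> C1 * torus.cost_bound A n ?d ?d fft_ops"
        using P_ops[OF d1(1) cheap] by blast
      from cost(1)[OF this refl] have ops: "(\<lambda>n. real (operations fft_ops A n (P n)))
          \<in> O(\<lambda>n. real (card (cell A n)) ^ ?d)" .
      obtain C2 where "\<And>n. n \<ge> 1 \<Longrightarrow> operations fft_ops A n (P' n) \<le> C2 * torus.cost_bound A n ?d ?d fft_ops"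
        using P'_ops[OF d1(1) cheap] by blast
      from cost(1)[OF this refl] have ops': "(\<lambda>n. real (operations fft_ops A n (P' n)))
          \<in> O(\<lambda>n. real (card (cell A n)) ^ ?d)" .
      have mem: "(\<lambda>n. real (memory fft_space A n (P n))) \<in> O(\<lambda>n. real (card (cell A n)) ^ (?d - 1))"
        using memory_bigo[OF assms(1,9) d P_mem] .
      have mem': "(\<lambda>n. real (memory fft_space A n (P' n))) \<in> O(\<lambda>n. real (card (cell A n)) ^ (?d - 1))"
        using memory_bigo[OF assms(1,9) d P'_mem] .
      have single: "?single \<pi>" using P ops mem by blast
      have grid: "?grid \<pi>" using P' ops' mem' by blast
      have convs: "?single_conv \<pi> \<and> ?grid_conv \<pi>"
      proof (cases "?cheap (?d - 1)")
        case True
        obtain C3 where "\<And>n. n \<ge> 1 \<Longrightarrow>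
            operations fft_ops A n (P n) \<le> C3 * torus.cost_bound A n ?d (?d - 1) fft_ops"
          using P_ops[OF d1(2) True] by blast
        note ops = cost(2)[OF this refl]
        obtain C4 where "\<And>n. n \<ge> 1 \<Longrightarrow>
            operations fft_ops A n (P' n) \<le> C4 * torus.cost_bound A n ?d (?d - 1) fft_ops"
          using P'_ops[OF d1(2) True] by blast
        note ops' = cost(2)[OF this refl]
        show ?thesis
        proof (rule conjI, goal_cases)
          case 1
          show ?case using P ops mem by blast
        next
          case 2
          show ?case using P' ops' mem' by blast
        qed
      next
        case False
        \<comment> \<open>No kernels and momenta satisfy the hypothesis, so any program will do.\<close>
        have none: "\<not> max_steps_convolutional A n G K s t k \<pi>" for n K k using conv False by blast
        show ?thesis using none unfolding evaluates_on_grid_def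
          by (intro conjI exI[of _ "\<lambda>_. []"] exI) (auto simp: memory_def)
      qed
      show "?single \<pi> \<and> ?grid \<pi> \<and> ?single_conv \<pi> \<and> ?grid_conv \<pi>"
        using single grid convs by blast
    qed
  qed
qed

end
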